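(* Let $\lambda$ be a Young diagram and let $[\nu]_{|\lambda|}$ be any standard Young tableau of shape $\lambda$, with corresponding primitive idempotent $e([\nu]_{|\lambda|})\in H_{|\lambda|}(q)\subset H_{|\lambda|+1}(q)$. Then $$e([\nu]_{|\lambda|})\prod_{r=1}^{k+1}\left(y_{|\lambda|+1}-q^{2(\lambda_{(r)}-n_{r-1})}\right)=0,$$ and for each $j=1,\dots,k+1$ the primitive idempotent $e([\nu_j]_{|\lambda|+1})\in H_{|\lambda|+1}(q)$ corresponding to the standard tableau $[\nu_j]_{|\lambda|+1}$, obtained from $[\nu]_{|\lambda|}$ by adding a node filled with $|\lambda|+1$ in row $n_{j-1}+1$ and column $\lambda_{(j)}+1$, is given by $$e([\nu_j]_{|\lambda|+1})=e([\nu]_{|\lambda|})\prod_{\substack{r=1\\ r\neq j}}^{k+1}\frac{y_{|\lambda|+1}-q^{2(\lambda_{(r)}-n_{r-1})}}{q^{2(\lambda_{(j)}-n_{j-1})}-q^{2(\lambda_{(r)}-n_{r-1})}}.$$ Starting from $e([\nu]_1)=1$ for the one-node tableau, repeated application of this formula yields the primitive idempotents corresponding to all standard Young tableaux.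
   Context: Let $q\in\mathbf{C}\setminus\{0\}$ be generic, i.e. $q\neq \exp(2\pi i k/m)$ for all integers $k,m$ with $m\ne 0$ (so $q$ is not a root of unity). The $A$-type Hecke algebra $H_n=H_n(q)$ is the unital associative $\mathbf{C}$-algebra generated by $\sigma_1,\dots,\sigma_{n-1}$ with relations $\sigma_i\sigma_{i+1}\sigma_i=\sigma_{i+1}\sigma_i\sigma_{i+1}$, $\sigma_i\sigma_j=\sigma_j\sigma_i$ for $|i-j|>1$, and $\sigma_i^2-1=(q-q^{-1})\sigma_i$ ($H_1=\mathbf{C}$); $H_n\subset H_{n+1}$ in the obvious way. The Jucys-Murphy elements are $y_1=1$, $y_{i+1}=\sigma_i y_i\sigma_i$; they pairwise commute. A standard Young tableau $[\nu]_n$ is a Young diagram with $n$ nodes filled with $1,\dots,n$, increasing along rows to the right and along columns downwards. The content of the node in row $r$ and column $c$ is $q^{2(c-r)}$, and the content string of $[\nu]_n$ is $(a_1,\dots,a_n)$ with $a_i$ the content of the node filled with $i$. The primitive idempotent $e([\nu]_n)\in H_n$ corresponding to $[\nu]_n$ is the unique primitive idempotent $e$ with $y_ie=ey_i=a_ie$ for $i=1,\dots,n$. Notation for $\lambda$: $\lambda$ has row lengths $\lambda_1\ge\lambda_2\ge\dots\ge\lambda_{n}>0$ with $n=n_k$ rows, $|\lambda|=\sum_i\lambda_i\geq 1$ is the number of nodes, and the distinct row lengths are $\lambda_{(1)}>\lambda_{(2)}>\dots>\lambda_{(k)}$, with $$\lambda_1=\dots=\lambda_{n_1}=\lambda_{(1)},\quad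 \lambda_{n_1+1}=\dots=\lambda_{n_2}=\lambda_{(2)},\ \dots,\ \lambda_{n_{k-1}+1}=\dots=\lambda_{n_k}=\lambda_{(k)}.$$ By convention $n_0=0$ and $\lambda_{(k+1)}=0$. *)

theory Defs
  imports
    Complex_Main
    "HOL-Library.Poly_Mapping"
    "HOL-Algebra.QuotRing"
begin

section \<open>The free algebra on countably many letters\<close>

text \<open>
  Words under concatenation form a monoid, written additively because the convolution product
  on \<^typ>\<open>'a \<Rightarrow>\<^sub>0 'b\<close> asks for a \<^class>\<open>monoid_add\<close> of exponents. The monoid algebra
  \<open>hword \<Rightarrow>\<^sub>0 complex\<close> is the free unital associative complex algebra on the letters
  \<open>0, 1, 2, \<dots>\<close>; its product is not commutative.
\<close>

datatype hword = Word (letters: "nat list")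

instantiation hword :: monoid_add
begin

definition zero_hword :: hword where "0 = Word []"

definition plus_hword :: "hword \<Rightarrow> hword \<Rightarrow> hword"
  where "u + v = Word (letters u @ letters v)"

instance
  by standard (simp_all add: zero_hword_def plus_hword_def)

end

type_synonym free_elt = "hword \<Rightarrow>\<^sub>0 complex"

definition fgen :: "nat \<Rightarrow> free_elt"
  where "fgen i = Poly_Mapping.single (Word [i]) 1"

definition fscal :: "complex \<Rightarrow> free_elt"
  where "fscal c = Poly_Mapping.single 0 c"

text \<open>The free algebra on the letters \<open>1, \<dots>, n - 1\<close>.\<close>

definition free_alg :: "nat \<Rightarrow> free_elt ring" where
  "free_alg n = \<lparr>carrier = {f. \<forall>w\<in>Poly_Mapping.keys f. set (letters w) \<subseteq> {1..<n}},
     monoid.mult = (*), one = 1, ring.zero = 0, add = (+)\<rparr>"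


section \<open>The Hecke algebra\<close>

definition generic :: "complex \<Rightarrow> bool" where
  "generic q \<longleftrightarrow> q \<noteq> 0 \<and>
     (\<forall>k m :: int. m \<noteq> 0 \<longrightarrow> q \<noteq> exp (2 * complex_of_real pi * \<i> * of_int k / of_int m))"

definition hecke_rels :: "complex \<Rightarrow> nat \<Rightarrow> free_elt set" where
  "hecke_rels q n =
     {fgen i * fgen (i + 1) * fgen i - fgen (i + 1) * fgen i * fgen (i + 1) | i.
        1 \<le> i \<and> i + 1 < n} \<union>
     {fgen i * fgen j - fgen j * fgen i | i j.
        i \<in> {1..<n} \<and> j \<in> {1..<n} \<and> \<bar>int i - int j\<bar> > 1} \<union>
     {fgen i * fgen i - 1 - fscal (q - inverse q) * fgen i | i. i \<in> {1..<n}}"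

definition hecke_ideal :: "complex \<Rightarrow> nat \<Rightarrow> free_elt set"
  where "hecke_ideal q n = Idl\<^bsub>free_alg n\<^esub> (hecke_rels q n)"

definition hecke :: "complex \<Rightarrow> nat \<Rightarrow> free_elt set ring"
  where "hecke q n = free_alg n Quot hecke_ideal q n"

definition hecke_gen :: "complex \<Rightarrow> nat \<Rightarrow> nat \<Rightarrow> free_elt set"  (* \<sigma>_i *)
  where "hecke_gen q n i = hecke_ideal q n +>\<^bsub>free_alg n\<^esub> fgen i"

text \<open>Complex scalars act through the multiples of the unit.\<close>

definition hecke_scal :: "complex \<Rightarrow> nat \<Rightarrow> complex \<Rightarrow> free_elt set"
  where "hecke_scal q n c = hecke_ideal q n +>\<^bsub>free_alg n\<^esub> fscal c"

text \<open>
  The natural homomorphism from \<open>hecke q n\<close> to \<open>hecke q (n + 1)\<close>. The ideal of relations of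
  the former lies in that of the latter, so adding the latter to a coset \<open>I + f\<close> gives the coset
  of the same \<open>f\<close> in \<open>hecke q (n + 1)\<close>.
\<close>

definition hecke_incl :: "complex \<Rightarrow> nat \<Rightarrow> free_elt set \<Rightarrow> free_elt set"
  where "hecke_incl q n X = hecke_ideal q (n + 1) <+>\<^bsub>free_alg (n + 1)\<^esub> X"

fun jucys_murphy :: "complex \<Rightarrow> nat \<Rightarrow> nat \<Rightarrow> free_elt set" where
  "jucys_murphy q n 0 = \<one>\<^bsub>hecke q n\<^esub>"  \<comment> \<open>unused index\<close>
| "jucys_murphy q n (Suc 0) = \<one>\<^bsub>hecke q n\<^esub>"
| "jucys_murphy q n (Suc (Suc i)) =
     hecke_gen q n (Suc i) \<otimes>\<^bsub>hecke q n\<^esub> jucys_murphy q n (Suc i)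
       \<otimes>\<^bsub>hecke q n\<^esub> hecke_gen q n (Suc i)"

text \<open>Products of a list in the given order, as the ring need not be commutative.\<close>

definition list_prod :: "('a, 'b) ring_scheme \<Rightarrow> 'a list \<Rightarrow> 'a"
  where "list_prod R xs = foldr (\<otimes>\<^bsub>R\<^esub>) xs \<one>\<^bsub>R\<^esub>"

definition idempotent_in :: "('a, 'b) ring_scheme \<Rightarrow> 'a \<Rightarrow> bool"
  where "idempotent_in R e \<longleftrightarrow> e \<in> carrier R \<and> e \<otimes>\<^bsub>R\<^esub> e = e"

definition primitive_idempotent :: "('a, 'b) ring_scheme \<Rightarrow> 'a \<Rightarrow> bool" where
  "primitive_idempotent R e \<longleftrightarrow> idempotent_in R e \<and> e \<noteq> \<zero>\<^bsub>R\<^esub> \<and>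
     (\<forall>f g. idempotent_in R f \<and> idempotent_in R g \<and>
        f \<otimes>\<^bsub>R\<^esub> g = \<zero>\<^bsub>R\<^esub> \<and> g \<otimes>\<^bsub>R\<^esub> f = \<zero>\<^bsub>R\<^esub> \<and> e = f \<oplus>\<^bsub>R\<^esub> g
        \<longrightarrow> f = \<zero>\<^bsub>R\<^esub> \<or> g = \<zero>\<^bsub>R\<^esub>)"


section \<open>Young diagrams and standard tableaux\<close>

text \<open>
  A diagram is given by the list of its row lengths, so row \<open>r\<close> has length \<open>lam ! (r - 1)\<close>.
\<close>

definition young_diagram :: "nat list \<Rightarrow> bool"
  where "young_diagram lam \<longleftrightarrow> lam \<noteq> [] \<and> sorted_wrt (\<ge>) lam \<and> (\<forall>x\<in>set lam. 0 < x)"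

definition nodes :: "nat list \<Rightarrow> (nat \<times> nat) set"  (* (row, column), counted from 1 *)
  where "nodes lam = {(r, c). r \<in> {1..length lam} \<and> c \<in> {1..lam ! (r - 1)}}"

definition num_blocks :: "nat list \<Rightarrow> nat"  (* k *)
  where "num_blocks lam = card (set lam)"

text \<open>
  For a decreasing list, \<^const>\<open>remdups\<close> lists the distinct row lengths in decreasing order;
  the appended \<open>0\<close> is the value at \<open>k + 1\<close>. The number of rows in the first \<open>r\<close> blocks
  is \<open>n_r\<close>, in particular \<open>n_0 = 0\<close>.
\<close>

definition block_len :: "nat list \<Rightarrow> nat \<Rightarrow> nat"  (* \<lambda>_(r), for 1 \<le> r \<le> k + 1 *)
  where "block_len lam r = (remdups lam @ [0]) ! (r - 1)"

definition block_end :: "nat list \<Rightarrow> nat \<Rightarrow> nat"  (* n_r, for 0 \<le> r \<le> k *)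
  where "block_end lam r = length (filter (\<lambda>x. x \<in> set (take r (remdups lam))) lam)"

lemma block_end_0: "block_end lam 0 = 0"
  by (simp add: block_end_def)

type_synonym tableau = "nat \<times> nat \<rightharpoonup> nat"

definition standard_tableau :: "nat list \<Rightarrow> tableau \<Rightarrow> bool" where
  "standard_tableau lam T \<longleftrightarrow>
     young_diagram lam \<and> dom T = nodes lam \<and>
     bij_betw (\<lambda>x. the (T x)) (nodes lam) {1..sum_list lam} \<and>
     (\<forall>r c c'. (r, c) \<in> nodes lam \<and> (r, c') \<in> nodes lam \<and> c < c'
        \<longrightarrow> the (T (r, c)) < the (T (r, c'))) \<and>
     (\<forall>r r' c. (r, c) \<in> nodes lam \<and> (r', c) \<in> nodes lam \<and> r < r'
        \<longrightarrow> the (T (r, c)) < the (T (r', c)))"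

definition node_content :: "complex \<Rightarrow> nat \<times> nat \<Rightarrow> complex"
  where "node_content q x = q powi (2 * (int (snd x) - int (fst x)))"

definition content_string :: "complex \<Rightarrow> tableau \<Rightarrow> nat \<Rightarrow> complex"
  where "content_string q T i = node_content q (THE x. T x = Some i)"


section \<open>The idempotent of a tableau\<close>

definition corresponds :: "complex \<Rightarrow> tableau \<Rightarrow> free_elt set \<Rightarrow> bool" where
  "corresponds q T e \<longleftrightarrow>
     (let n = card (dom T); H = hecke q n in
        primitive_idempotent H e \<and>
        (\<forall>i\<in>{1..n}.
           jucys_murphy q n i \<otimes>\<^bsub>H\<^esub> e = hecke_scal q n (content_string q T i) \<otimes>\<^bsub>H\<^esub> e \<and>
           e \<otimes>\<^bsub>H\<^esub> jucys_murphy q n i = hecke_scal q n (content_string q T i) \<otimes>\<^bsub>H\<^esub> e))"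

definition tableau_idempotent :: "complex \<Rightarrow> tableau \<Rightarrow> free_elt set"
  where "tableau_idempotent q T = (THE e. corresponds q T e)"


section \<open>Adding a node\<close>

definition corner :: "nat list \<Rightarrow> nat \<Rightarrow> nat \<times> nat"
  where "corner lam j = (block_end lam (j - 1) + 1, block_len lam j + 1)"

definition add_corner :: "nat list \<Rightarrow> nat \<Rightarrow> nat list" where
  "add_corner lam j =
     (let i = block_end lam (j - 1)
      in if i < length lam then lam[i := lam ! i + 1] else lam @ [1])"

definition extend_tableau :: "nat list \<Rightarrow> tableau \<Rightarrow> nat \<Rightarrow> tableau"
  where "extend_tableau lam T j = T(corner lam j \<mapsto> sum_list lam + 1)"

definition corner_content :: "complex \<Rightarrow> nat list \<Rightarrow> nat \<Rightarrow> complex"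
  where "corner_content q lam r = q powi (2 * (int (block_len lam r) - int (block_end lam (r - 1))))"

text \<open>The factors belong to \<open>hecke q (\<bar>lam\<bar> + 1)\<close>.\<close>

definition jm_factor :: "complex \<Rightarrow> nat list \<Rightarrow> nat \<Rightarrow> free_elt set" where
  "jm_factor q lam r =
     (let n = sum_list lam + 1
      in jucys_murphy q n n \<ominus>\<^bsub>hecke q n\<^esub> hecke_scal q n (corner_content q lam r))"

definition annihilating_product :: "complex \<Rightarrow> nat list \<Rightarrow> free_elt set" where
  "annihilating_product q lam =
     list_prod (hecke q (sum_list lam + 1))
       (map (jm_factor q lam) [1..<num_blocks lam + 2])"

definition fusion_factor :: "complex \<Rightarrow> nat list \<Rightarrow> nat \<Rightarrow> nat \<Rightarrow> free_elt set" where
  "fusion_factor q lam j r =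
     (let n = sum_list lam + 1
      in hecke_scal q n (1 / (corner_content q lam j - corner_content q lam r))
           \<otimes>\<^bsub>hecke q n\<^esub> jm_factor q lam r)"

definition fusion_product :: "complex \<Rightarrow> nat list \<Rightarrow> nat \<Rightarrow> free_elt set" where
  "fusion_product q lam j =
     list_prod (hecke q (sum_list lam + 1))
       (map (fusion_factor q lam j) (filter (\<lambda>r. r \<noteq> j) [1..<num_blocks lam + 2]))"

text \<open>The right-hand side of the recursive formula, for \<open>e\<close> in \<open>hecke q \<bar>lam\<bar>\<close>.\<close>

definition fusion_step :: "complex \<Rightarrow> nat list \<Rightarrow> nat \<Rightarrow> free_elt set \<Rightarrow> free_elt set" where
  "fusion_step q lam j e =
     hecke_incl q (sum_list lam) e \<otimes>\<^bsub>hecke q (sum_list lam + 1)\<^esub> fusion_product q lam j"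

text \<open>
  \<open>fusion q lam T e\<close>: starting from the one-node tableau with the element \<open>1\<close>, successive
  application of the formula arrives at the tableau \<open>T\<close> of shape \<open>lam\<close> with the element \<open>e\<close>.
\<close>

inductive fusion :: "complex \<Rightarrow> nat list \<Rightarrow> tableau \<Rightarrow> free_elt set \<Rightarrow> bool" for q where
  start: "fusion q [1] [(1, 1) \<mapsto> 1] \<one>\<^bsub>hecke q 1\<^esub>"
| step: "fusion q lam T e \<Longrightarrow> j \<in> {1..num_blocks lam + 1} \<Longrightarrow>
    fusion q (add_corner lam j) (extend_tableau lam T j) (fusion_step q lam j e)"

end

theory Submission
  imports Defs "HOL-Computational_Algebra.Polynomial"
begin

text \<open>
  A standard tableau is encoded by its sequence of content exponents, and a shape by its set of
  beads \<open>\<lambda>\<^sub>i - i\<close>: adding a node of content \<open>k\<close> moves the bead at \<open>k\<close> to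
  \<open>k + 1\<close>, and two tableaux have the same shape iff they end in the same set.

  Let \<open>e\<close> belong to a tableau of shape \<open>\<lambda>\<close> with \<open>n\<close> nodes. Since
  \<open>H\<^bsub>n+1\<^esub> = H\<^sub>n + H\<^sub>n \<sigma>\<^sub>n H\<^sub>n\<close> and \<open>e\<^sub>S H\<^sub>n e\<^sub>T\<close> is one-dimensional for
  equal shapes and zero otherwise, \<open>e H\<^bsub>n+1\<^esub> e\<close> is spanned by \<open>e\<close> and elements through
  \<open>e\<^sub>T \<sigma>\<^sub>n e\<^sub>T\<close>. The relation \<open>y\<^bsub>n+1\<^esub> \<sigma>\<^sub>n = \<sigma>\<^sub>n y\<^sub>n + (q - 1/q) y\<^bsub>n+1\<^esub>\<close> shows that the
  factors \<open>y\<^bsub>n+1\<^esub> - c\<close>, with \<open>c\<close> running over the contents of the removable nodes, turn these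
  elements into polynomials in \<open>y\<^bsub>n+1\<^esub>\<close>. Applied to \<open>y\<^bsub>n+1\<^esub> e\<close> itself this gives a monic
  polynomial of degree one more than the number of removable nodes, which is the number of addable
  nodes, annihilating \<open>y\<^bsub>n+1\<^esub> e\<close>. The seminormal representation provides an eigenvector for
  every addable node, so the roots of that polynomial are exactly the addable contents. Lagrange
  interpolation then produces the idempotents of the next level, and the same relation gives the
  one-dimensionality there.
\<close>

section \<open>Sequences of contents as bead configurations\<close>

text \<open>The presentation of \<open>hecke q n\<close> only bounds things from above: spanning
  sets and polynomial relations follow from it, but nothing in it visibly prevents the elements
  \<open>E s\<close> from collapsing to 0. The missing lower bound is a linear functional for each
  standard sequence, with value 1 on the unit, under which right multiplication by every y_i is a
  scalar. It is an assumption of the locale \<open>hecke_algebra\<close>, discharged by reading off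
  one coordinate in the seminormal representation. All levels n \<le> N live inside one algebra, as
  the subalgebras \<open>A n\<close> generated by the first n - 1 generators. The candidate for the
  idempotent of a tableau is written down as a product of interpolation polynomials in the
  Jucys-Murphy elements, so the formula of the theorem holds by construction; the work lies in
  showing that these products have the characterising properties. The algebra is done in the type
  class \<open>ring\<close>, which knows neither a unit nor a carrier: the rings of cosets are
  embedded into such a type, and the scalar 1 takes the place of the unit.\<close>

definition addable :: "int set \<Rightarrow> int set"
  where "addable X = {k. k \<in> X \<and> k + 1 \<notin> X}"

text \<open>Indexed by the content of the node to be taken away: its bead sits at k + 1 and would
  return to k.\<close>

definition removable :: "int set \<Rightarrow> int set"
  where "removable X = {k. k \<notin> X \<and> k + 1 \<in> X}"

definition hop :: "int \<Rightarrow> int set \<Rightarrow> int set"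
  where "hop k X = insert (k + 1) (X - {k})"

fun grows :: "int set \<Rightarrow> int list \<Rightarrow> bool" where
  "grows X [] \<longleftrightarrow> True"
| "grows X (k # s) \<longleftrightarrow> k \<in> addable X \<and> grows (hop k X) s"

text \<open>The start \<open>{..0}\<close> is the empty diagram: with rows counted from 0, row i has
  length 0 and its bead lies at -i. The infinitely many empty rows are always present, so opening a
  new row is a move like any other.\<close>

definition maya :: "int list \<Rightarrow> int set"
  where "maya s = fold hop s {..0}"

definition std_seqs :: "nat \<Rightarrow> int list set"
  where "std_seqs n = {s. length s = n \<and> grows {..0} s}"

lemma grows_append: "grows X (s @ t) \<longleftrightarrow> grows X s \<and> grows (fold hop s X) t"
  by (induction s arbitrary: X) auto

lemma maya_Nil: "maya [] = {..0}"
  and maya_snoc: "maya (s @ [k]) = hop k (maya s)"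
  by (simp_all add: maya_def)

lemma std_seqs_0: "std_seqs 0 = {[]}"
  by (auto simp: std_seqs_def)

lemma addable_initial: "addable {..0} = {0}"
  by (auto simp: addable_def)

lemma snoc_in_std_seqs:
  "s @ [k] \<in> std_seqs (Suc n) \<longleftrightarrow> s \<in> std_seqs n \<and> k \<in> addable (maya s)"
  by (auto simp: std_seqs_def grows_append maya_def)

lemma std_seqs_SucE:
  assumes "s \<in> std_seqs (Suc n)"
  obtains t k where "s = t @ [k]" "t \<in> std_seqs n" "k \<in> addable (maya t)"
proof (cases s rule: rev_cases)
  case Nil
  with assms show ?thesis by (simp add: std_seqs_def)
next
  case (snoc t k)
  with assms that show ?thesis by (simp add: snoc_in_std_seqs)
qed

lemma std_seqs_Suc:
  "std_seqs (Suc n) = (\<Union>s\<in>std_seqs n. (\<lambda>k. s @ [k]) ` addable (maya s))"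
  by (force simp: snoc_in_std_seqs elim!: std_seqs_SucE)

lemma std_seqs_1: "std_seqs (Suc 0) = {[0]}"
  by (simp add: std_seqs_Suc std_seqs_0 maya_Nil addable_initial)

lemma length_std_seqs: "s \<in> std_seqs n \<Longrightarrow> length s = n"
  by (simp add: std_seqs_def)

text \<open>Each move extends the region of disagreement with the empty diagram by at most one
  place, so n moves stay in a window of radius n. The counting in \<open>card_addable\<close> takes
  place in this window.\<close>

lemma maya_bounded:
  assumes "s \<in> std_seqs n"
  shows "{..- int n} \<subseteq> maya s" "maya s \<subseteq> {..int n}"
proof -
  have "{..- int n} \<subseteq> maya s \<and> maya s \<subseteq> {..int n}" using assms
  proof (induction n arbitrary: s)
    case 0
    then show ?case by (simp add: std_seqs_0 maya_Nil)
  next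
    case (Suc n)
    from Suc.prems obtain t k where s: "s = t @ [k]" "t \<in> std_seqs n" "k \<in> addable (maya t)"
      by (rule std_seqs_SucE)
    have "- int n \<le> k" "k \<le> int n" using Suc.IH[OF s(2)] s(3)
      by (auto simp: addable_def subset_iff not_le[symmetric])
         (metis Suc.IH add1_zle_eq atMost_iff linorder_le_cases not_le s(2) subsetD)
    then show ?case using Suc.IH[OF s(2)]
      by (fastforce simp: s(1) maya_snoc hop_def subset_iff)
  qed
  then show "{..- int n} \<subseteq> maya s" "maya s \<subseteq> {..int n}" by auto
qed

text \<open>Addable minus removable positions count the descents minus the ascents of the indicator
  function of X, and this difference telescopes: X is full on the far left and empty on the far
  right. The surplus of one later matches the degree of the annihilating polynomial.\<close>

lemma card_addable:
  fixes X :: "int set"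
  assumes "{..- int n} \<subseteq> X" "X \<subseteq> {..int n}"
  shows "finite (addable X)" "finite (removable X)" "card (addable X) = Suc (card (removable X))"
proof -
  have sub: "addable X \<subseteq> {- int n..int n}" "removable X \<subseteq> {- int n..int n}"
    using assms by (auto simp: addable_def removable_def subset_iff)
       (metis add1_zle_eq linorder_not_le order_le_less)+
  then show fin: "finite (addable X)" "finite (removable X)"
    by (auto intro: finite_subset)
  have tele: "(\<Sum>k\<in>{a..a + int m}. of_bool (k \<in> X) - of_bool (k + 1 \<in> X) :: int)
      = of_bool (a \<in> X) - of_bool (a + int m + 1 \<in> X)" for a m
  proof (induction m)
    case (Suc m)
    have "{a..a + int (Suc m)} = insert (a + int m + 1) {a..a + int m}" by auto
    then show ?case using Suc by (simp add: ac_simps)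
  qed simp
  have "int (card (addable X)) - int (card (removable X))
      = (\<Sum>k\<in>{- int n..int n}. of_bool (k \<in> addable X)) - (\<Sum>k\<in>{- int n..int n}. of_bool (k \<in> removable X))"
    using sub by (simp add: sum.If_cases of_bool_def Int_absorb2 Int_absorb1 Collect_mem_eq)
  also have "\<dots> = (\<Sum>k\<in>{- int n..- int n + int (2 * n)}. of_bool (k \<in> X) - of_bool (k + 1 \<in> X))"
    unfolding sum_subtractf[symmetric]
    by (rule sum.cong) (auto simp: addable_def removable_def)
  also have "\<dots> = 1" unfolding tele using assms by (auto simp: subset_iff)
  finally show "card (addable X) = Suc (card (removable X))" by simp
qed

lemma finite_addable: "s \<in> std_seqs n \<Longrightarrow> finite (addable (maya s))"
  and finite_removable: "s \<in> std_seqs n \<Longrightarrow> finite (removable (maya s))"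
  and card_addable_maya: "s \<in> std_seqs n \<Longrightarrow> card (addable (maya s)) = Suc (card (removable (maya s)))"
  using card_addable[OF maya_bounded] by auto

lemma finite_std_seqs: "finite (std_seqs n)"
  by (induction n) (auto simp: std_seqs_0 std_seqs_Suc finite_addable)

lemma addable_nonempty: "s \<in> std_seqs n \<Longrightarrow> addable (maya s) \<noteq> {}"
  using card_addable_maya by force

section \<open>Commuting moves and exchanging the last nodes of a tableau\<close>

lemma hop_commute: "\<bar>k - l\<bar> > 1 \<Longrightarrow> hop k (hop l X) = hop l (hop k X)"
  by (auto simp: hop_def)

lemma addable_hop: "\<bar>k - l\<bar> > 1 \<Longrightarrow> l \<in> addable (hop k X) \<longleftrightarrow> l \<in> addable X"
  by (auto simp: addable_def hop_def)

lemma addable_distant: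
  assumes "k \<in> addable X" "l \<in> addable X" "k \<noteq> l"
  shows "\<bar>k - l\<bar> > 1"
proof -
  have "k \<noteq> l + 1" "l \<noteq> k + 1" using assms by (auto simp: addable_def)
  with assms(3) show ?thesis by linarith
qed

lemma hop_inj: "k \<in> addable X \<Longrightarrow> l \<in> addable X \<Longrightarrow> hop k X = hop l X \<Longrightarrow> k = l"
  by (auto simp: addable_def hop_def)

lemma hop_cancel: "k \<in> addable X \<Longrightarrow> k \<in> addable Y \<Longrightarrow> hop k X = hop k Y \<Longrightarrow> X = Y"
  by (auto simp: addable_def hop_def set_eq_iff) metis+

lemma removable_hop: "k \<in> addable X \<Longrightarrow> k \<in> removable (hop k X)"
  by (auto simp: addable_def removable_def hop_def)

lemma addable_removable: "k \<in> addable X \<Longrightarrow> k \<notin> removable X"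
  by (auto simp: addable_def removable_def)

lemma removable_distant:
  assumes "k \<in> removable X" "l \<in> removable X" "k \<noteq> l"
  shows "\<bar>k - l\<bar> > 1"
proof -
  have "k \<noteq> l + 1" "l \<noteq> k + 1" using assms by (auto simp: removable_def)
  with assms(3) show ?thesis by linarith
qed

text \<open>Every removable node of a diagram is the last node of some tableau of that shape. If s
  ends in another node k, then l is at distance more than 1 from k, hence was removable before k was
  added; the induction hypothesis puts it last there, and the two distant moves commute.\<close>

lemma exchange_last:
  assumes "s \<in> std_seqs n" "l \<in> removable (maya s)"
  shows "\<exists>t. t @ [l] \<in> std_seqs n \<and> maya (t @ [l]) = maya s"
  using assms
proof (induction n arbitrary: s)
  case 0
  then show ?case by (auto simp: std_seqs_0 maya_Nil removable_def)
next
  case (Suc n)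
  from Suc.prems(1) obtain r k where s: "s = r @ [k]" "r \<in> std_seqs n" "k \<in> addable (maya r)"
    by (rule std_seqs_SucE)
  show ?case
  proof (cases "k = l")
    case True
    with s Suc.prems show ?thesis by blast
  next
    case False
    have d: "\<bar>k - l\<bar> > 1"
      using False removable_distant Suc.prems(2) removable_hop s by (metis maya_snoc)
    then have "l \<in> removable (maya r)" using Suc.prems(2)
      by (auto simp: s maya_snoc removable_def hop_def)
    from Suc.IH[OF s(2) this] obtain t where t: "t @ [l] \<in> std_seqs n" "maya (t @ [l]) = maya r"
      by blast
    then obtain m where m: "n = Suc m"
      using length_std_seqs by fastforce
    have "k \<in> addable (maya t)"
      using s(3) t(2) addable_hop[of l k "maya t"] d by (simp add: maya_snoc abs_minus_commute)
    moreover have "l \<in> addable (hop k (maya t))"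
      using t(1) addable_hop[of k l "maya t"] d by (simp add: m snoc_in_std_seqs)
    ultimately have "(t @ [k]) @ [l] \<in> std_seqs (Suc n)"
      using t(1) unfolding m by (simp only: snoc_in_std_seqs maya_snoc simp_thms)
    moreover have "maya ((t @ [k]) @ [l]) = maya s"
      using t(2) hop_commute[OF d, of "maya t"] by (simp only: maya_snoc s)
    ultimately show ?thesis by blast
  qed
qed

text \<open>Diamond property: both last nodes are removable from the common shape, so they can be
  taken off in either order, leaving r. The two resulting sequences differ by an adjacent
  transposition, and each shares its last entry with one of the given tableaux.\<close>

lemma exchange_last_two:
  assumes "s @ [k] \<in> std_seqs n" "t @ [l] \<in> std_seqs n" "maya (s @ [k]) = maya (t @ [l])" "k \<noteq> l"
  obtains r where "r @ [l, k] \<in> std_seqs n" "r @ [k, l] \<in> std_seqs n"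
    "maya (r @ [l, k]) = maya (s @ [k])" "maya (r @ [k, l]) = maya (s @ [k])" "\<bar>k - l\<bar> > 1"
proof -
  obtain m where n: "n = Suc m" using assms(1) length_std_seqs by fastforce
  have k: "k \<in> addable (maya s)" and s: "s \<in> std_seqs m" and l: "l \<in> addable (maya t)"
    using assms by (auto simp: n snoc_in_std_seqs)
  have "l \<in> removable (maya (s @ [k]))" "k \<in> removable (maya (s @ [k]))"
    using removable_hop[OF k] removable_hop[OF l] assms(3) by (simp_all add: maya_snoc)
  then have d: "\<bar>k - l\<bar> > 1" and "l \<in> removable (maya s)"
    using removable_distant assms(4) by (blast, force simp: maya_snoc removable_def hop_def)
  from exchange_last[OF s this(2)] obtain r
    where r: "r @ [l] \<in> std_seqs m" "maya (r @ [l]) = maya s" by blast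
  then obtain p where m: "m = Suc p" using length_std_seqs by fastforce
  have rl: "r \<in> std_seqs p" "l \<in> addable (maya r)" using r(1) by (simp_all add: m snoc_in_std_seqs)
  have "(r @ [l]) @ [k] \<in> std_seqs n" using r k by (simp only: n snoc_in_std_seqs simp_thms)
  moreover have kr: "k \<in> addable (maya r)"
    using k r(2) addable_hop[of l k "maya r"] d by (simp add: maya_snoc abs_minus_commute)
  then have "(r @ [k]) @ [l] \<in> std_seqs n"
    using rl addable_hop[of k l "maya r"] d by (simp only: n m snoc_in_std_seqs maya_snoc simp_thms)
  moreover have "maya ((r @ [l]) @ [k]) = maya (s @ [k])" using r(2) by (simp only: maya_snoc)
  moreover have "maya ((r @ [k]) @ [l]) = maya (s @ [k])"
    using r(2) hop_commute[OF d, of "maya r"] by (simp only: maya_snoc)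
  ultimately show ?thesis using that d by simp
qed

section \<open>Lagrange polynomials and generated subalgebras\<close>

definition root_poly :: "(int \<Rightarrow> complex) \<Rightarrow> int set \<Rightarrow> complex poly"
  where "root_poly a S = (\<Prod>r\<in>S. [:- a r, 1:])"

definition lagrange_poly :: "(int \<Rightarrow> complex) \<Rightarrow> int set \<Rightarrow> int \<Rightarrow> complex poly"
  where "lagrange_poly a S k = (\<Prod>r\<in>S - {k}. smult (1 / (a k - a r)) [:- a r, 1:])"

lemma root_poly_remove:
  "finite S \<Longrightarrow> k \<in> S \<Longrightarrow> root_poly a S = [:- a k, 1:] * root_poly a (S - {k})"
  unfolding root_poly_def by (rule prod.remove)

lemma poly_root_poly: "poly (root_poly a S) x = (\<Prod>r\<in>S. x - a r)"
  by (simp add: root_poly_def poly_prod)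

lemma degree_root_poly: "degree (root_poly a S) = card S"
  unfolding root_poly_def by (subst degree_prod_eq_sum_degree) auto

lemma lead_coeff_root_poly: "lead_coeff (root_poly a S) = 1"
  unfolding root_poly_def by (simp add: lead_coeff_prod)

lemma lagrange_root_poly:
  "lagrange_poly a S k = smult (\<Prod>r\<in>S - {k}. 1 / (a k - a r)) (root_poly a (S - {k}))"
  unfolding lagrange_poly_def root_poly_def by (rule prod_smult)

lemma lagrange_mult_linear:
  assumes "finite S" "k \<in> S"
  shows "[:- a k, 1:] * lagrange_poly a S k = smult (\<Prod>r\<in>S - {k}. 1 / (a k - a r)) (root_poly a S)"
  by (simp only: lagrange_root_poly root_poly_remove[OF assms] mult_smult_right)

lemma poly_lagrange:
  assumes "inj a" "finite S" "k \<in> S" "l \<in> S"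
  shows "poly (lagrange_poly a S k) (a l) = (if k = l then 1 else 0)"
proof (cases "k = l")
  case True
  then show ?thesis using assms
    by (auto simp: lagrange_poly_def poly_prod inj_eq diff_divide_distrib[symmetric] intro!: prod.neutral)
next
  case False
  then have "(\<Prod>r\<in>S - {k}. (a l - a r)) = 0" using assms by (intro prod_zero) auto
  with False show ?thesis by (simp add: lagrange_root_poly poly_root_poly)
qed

lemma sum_lagrange:
  assumes "inj a" "finite S" "S \<noteq> {}"
  shows "(\<Sum>k\<in>S. lagrange_poly a S k) = 1"
proof (rule poly_eqI_degree)
  have "degree (lagrange_poly a S k) \<le> card (S - {k})" for k
    unfolding lagrange_root_poly using degree_smult_le degree_root_poly by metis
  then have "degree (lagrange_poly a S k) < card S" if "k \<in> S" for k
    using le_less_trans card_Diff1_less[OF assms(2) that] by blast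
  then show "degree (\<Sum>k\<in>S. lagrange_poly a S k) < card (a ` S)"
    using assms by (intro degree_sum_less) (auto simp: card_image inj_on_subset card_gt_0_iff)
  show "degree (1 :: complex poly) < card (a ` S)"
    using assms by (simp add: card_gt_0_iff)
  fix x assume "x \<in> a ` S"
  then obtain l where l: "l \<in> S" "x = a l" by blast
  have "(\<Sum>k\<in>S. poly (lagrange_poly a S k) x) = (\<Sum>k\<in>S. if k = l then 1 else 0)"
    using assms l by (intro sum.cong) (auto simp: poly_lagrange)
  then show "poly (\<Sum>k\<in>S. lagrange_poly a S k) x = poly 1 x"
    using assms l by (simp add: poly_sum)
qed

text \<open>Lets the annihilating polynomial be identified without computing its coefficients:
  degree, leading coefficient and roots suffice.\<close>

lemma monic_eq_root_poly:
  assumes "inj a" "finite S" "degree p = card S" "lead_coeff p = 1" "\<And>r. r \<in> S \<Longrightarrow> poly p (a r) = 0"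
  shows "p = root_poly a S"
proof (rule poly_eqI_degree_lead_coeff)
  show "card (a ` S) \<ge> card S" using assms by (simp add: card_image inj_on_subset)
  fix x assume "x \<in> a ` S"
  then obtain r where "r \<in> S" "x = a r" by blast
  then show "poly p x = poly (root_poly a S) x"
    using assms by (simp add: poly_root_poly) (metis cancel_comm_monoid_add_class.diff_cancel prod_zero)
qed (use assms lead_coeff_root_poly[of a S] in \<open>simp_all add: degree_root_poly\<close>)

text \<open>The class \<open>ring\<close> has no unit, so scalars enter through a map
  \<open>sc\<close>, and \<open>sc 1\<close> will act as the unit on the generated set. Negatives
  arise as multiples by \<open>sc (- 1)\<close>. At level n the generators are those with index 1,
  ..., n - 1.\<close>

inductive_set gen_alg :: "(complex \<Rightarrow> 'a::ring) \<Rightarrow> (nat \<Rightarrow> 'a) \<Rightarrow> nat \<Rightarrow> 'a set"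
  for sc g n where
  scalar: "sc c \<in> gen_alg sc g n"
| gen: "1 \<le> i \<Longrightarrow> i < n \<Longrightarrow> g i \<in> gen_alg sc g n"
| add: "x \<in> gen_alg sc g n \<Longrightarrow> y \<in> gen_alg sc g n \<Longrightarrow> x + y \<in> gen_alg sc g n"
| mult: "x \<in> gen_alg sc g n \<Longrightarrow> y \<in> gen_alg sc g n \<Longrightarrow> x * y \<in> gen_alg sc g n"

text \<open>A copy of \<open>jucys_murphy\<close> for an arbitrary ring, with the same default at
  the index 0, so that the two can be matched under homomorphisms.\<close>

fun jm :: "(complex \<Rightarrow> 'a::ring) \<Rightarrow> (nat \<Rightarrow> 'a) \<Rightarrow> nat \<Rightarrow> 'a" where
  "jm sc g 0 = sc 1"
| "jm sc g (Suc 0) = sc 1"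
| "jm sc g (Suc (Suc i)) = g (Suc i) * jm sc g (Suc i) * g (Suc i)"

text \<open>Horner evaluation at an element of a non-commutative ring, whereas \<open>poly\<close>
  evaluates in the commutative coefficient ring itself.\<close>

definition poly_at :: "(complex \<Rightarrow> 'a::ring) \<Rightarrow> 'a \<Rightarrow> complex poly \<Rightarrow> 'a"
  where "poly_at sc y p = fold_coeffs (\<lambda>c x. sc c + y * x) p 0"

definition content :: "complex \<Rightarrow> int \<Rightarrow> complex"
  where "content q k = q powi (2 * k)"

text \<open>One step is the formula of the theorem: multiply by the Lagrange polynomial for the
  addable contents of the present shape, taken at the next Jucys-Murphy element. The list is
  reversed because the recursion strips the last node.\<close>

fun rev_idem :: "complex \<Rightarrow> (complex \<Rightarrow> 'a::ring) \<Rightarrow> (nat \<Rightarrow> 'a) \<Rightarrow> int list \<Rightarrow> 'a" where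
  "rev_idem q sc g [] = sc 1"
| "rev_idem q sc g (k # s) = rev_idem q sc g s *
     poly_at sc (jm sc g (Suc (length s))) (lagrange_poly (content q) (addable (maya (rev s))) k)"

definition idem :: "complex \<Rightarrow> (complex \<Rightarrow> 'a::ring) \<Rightarrow> (nat \<Rightarrow> 'a) \<Rightarrow> int list \<Rightarrow> 'a"
  where "idem q sc g s = rev_idem q sc g (rev s)"

lemma idem_Nil: "idem q sc g [] = sc 1"
  and idem_snoc: "idem q sc g (s @ [k]) = idem q sc g s *
     poly_at sc (jm sc g (Suc (length s))) (lagrange_poly (content q) (addable (maya s)) k)"
  by (simp_all add: idem_def)

lemma poly_at_0 [simp]: "poly_at sc y 0 = 0"
  by (simp add: poly_at_def)

lemma poly_at_pCons: "sc 0 = 0 \<Longrightarrow> poly_at sc y (pCons c p) = sc c + y * poly_at sc y p"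
  by (cases "c = 0"; cases "p = 0") (simp_all add: poly_at_def)

section \<open>The abstract Hecke algebra and its Jucys-Murphy elements\<close>

locale generic_parameter =
  fixes q :: complex
  assumes not_root_of_unity: "k \<noteq> 0 \<Longrightarrow> q powi k \<noteq> 1" and q_nonzero: "q \<noteq> 0"
begin

abbreviation a :: "int \<Rightarrow> complex" where "a \<equiv> content q"
abbreviation h :: complex where "h \<equiv> q - inverse q"

lemma content_nonzero: "a k \<noteq> 0"
  by (simp add: content_def q_nonzero)

lemma content_ratio: "a l = q powi (2 * (l - k)) * a k"
  by (simp add: content_def power_int_add[symmetric] q_nonzero algebra_simps flip: power_int_diff)

lemma inj_content: "inj a"
proof (rule injI, rule ccontr)
  fix k l assume "a k = a l" "k \<noteq> l"
  then show False using content_ratio[of l k] not_root_of_unity[of "2 * (l - k)"] content_nonzero[of k]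
    by simp
qed

end

text \<open>The last assumption is the only one that is not an identity between scalars and
  generators. It is demanded at the top level N alone and reaches lower levels by extending
  sequences. Its conditions are restricted to the generated subalgebra because the ambient type
  contains unrelated elements.\<close>

locale hecke_algebra = generic_parameter q for q :: complex +
  fixes N :: nat and sc :: "complex \<Rightarrow> 'a::ring" and g :: "nat \<Rightarrow> 'a"
  assumes sc_add: "sc (c + d) = sc c + sc d"
    and sc_mult: "sc (c * d) = sc c * sc d"
    and g_sc: "1 \<le> i \<Longrightarrow> i < N \<Longrightarrow> g i * sc c = sc c * g i"
    and unit_g: "1 \<le> i \<Longrightarrow> i < N \<Longrightarrow> sc 1 * g i = g i"
    and braid: "1 \<le> i \<Longrightarrow> i + 1 < N \<Longrightarrow> g i * g (i + 1) * g i = g (i + 1) * g i * g (i + 1)"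
    and far: "1 \<le> i \<Longrightarrow> i + 1 < j \<Longrightarrow> j < N \<Longrightarrow> g i * g j = g j * g i"
    and quadratic: "1 \<le> i \<Longrightarrow> i < N \<Longrightarrow> g i * g i = sc 1 + sc (q - inverse q) * g i"
    and weight_functional: "s \<in> std_seqs N \<Longrightarrow> \<exists>\<chi> :: 'a \<Rightarrow> complex. \<chi> (sc 1) = 1 \<and>
      (\<forall>x\<in>gen_alg sc g N. \<forall>y\<in>gen_alg sc g N. \<chi> (x + y) = \<chi> x + \<chi> y) \<and>
      (\<forall>x\<in>gen_alg sc g N. \<forall>c. \<chi> (sc c * x) = c * \<chi> x) \<and>
      (\<forall>x\<in>gen_alg sc g N. \<forall>i\<in>{1..N}. \<chi> (x * jm sc g i) = content q (s ! (i - 1)) * \<chi> x)"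
begin

abbreviation A :: "nat \<Rightarrow> 'a set" where "A \<equiv> gen_alg sc g"
abbreviation Y :: "nat \<Rightarrow> 'a" where "Y \<equiv> jm sc g"
abbreviation E :: "int list \<Rightarrow> 'a" where "E \<equiv> idem q sc g"
abbreviation ev :: "nat \<Rightarrow> complex poly \<Rightarrow> 'a" where "ev i \<equiv> poly_at sc (Y i)"

lemmas A_intros = gen_alg.intros[where sc = sc and g = g]

lemma sc_0 [simp]: "sc 0 = 0"
  using sc_add[of 0 0] by simp

lemma sc_minus: "sc (- c) = - sc c"
  using sc_add[of c "- c"] by (simp add: eq_neg_iff_add_eq_0 add.commute)

lemma sc_diff: "sc (c - d) = sc c - sc d"
  using sc_add[of c "- d"] by (simp add: sc_minus)

lemma sc_central: "x \<in> A N \<Longrightarrow> x * sc c = sc c * x"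
proof (induction rule: gen_alg.induct)
  case (scalar d)
  then show ?case by (simp add: sc_mult[symmetric] mult.commute)
next
  case (mult x y)
  then show ?case by (metis mult.assoc)
qed (simp_all add: g_sc algebra_simps)

lemma unit_left: "x \<in> A N \<Longrightarrow> sc 1 * x = x"
proof (induction rule: gen_alg.induct)
  case (scalar d)
  then show ?case by (simp add: sc_mult[symmetric])
next
  case (mult x y)
  then show ?case by (simp add: mult.assoc[symmetric])
qed (simp_all add: unit_g algebra_simps)

lemma unit_right: "x \<in> A N \<Longrightarrow> x * sc 1 = x"
  by (simp add: sc_central unit_left)

lemma A_mono: "n \<le> m \<Longrightarrow> A n \<subseteq> A m"
proof
  fix x assume "n \<le> m" "x \<in> A n"
  from this(2,1) show "x \<in> A m" by (induction rule: gen_alg.induct) (auto intro: A_intros)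
qed

lemma A_0: "0 \<in> A n"
  using A_intros(1)[where c = 0 and n = n] by simp

lemma Y_in_A: "Y i \<in> A i"
proof (induction i)
  case (Suc i)
  then show ?case using A_mono[of i "Suc i"] by (cases i) (auto intro!: A_intros)
qed (auto intro: A_intros)

lemma Y_in_A': "i \<le> n \<Longrightarrow> Y i \<in> A n"
  using Y_in_A A_mono by blast

lemma ev_in_A: "i \<le> n \<Longrightarrow> ev i p \<in> A n"
  by (induction p) (auto simp: poly_at_pCons A_0 intro!: A_intros Y_in_A')

lemma E_in_A: "E s \<in> A (length s)"
proof (induction s rule: rev_induct)
  case (snoc k s)
  then show ?case using A_mono[of "length s" "Suc (length s)"]
    by (auto simp: idem_snoc intro!: A_intros ev_in_A)
qed (simp add: idem_Nil A_intros)

lemma E_in_A': "s \<in> std_seqs n \<Longrightarrow> n \<le> m \<Longrightarrow> E s \<in> A m"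
  using E_in_A[of s] A_mono[of n m] length_std_seqs[of s n] by auto

lemma A_N: "x \<in> A n \<Longrightarrow> n \<le> N \<Longrightarrow> x \<in> A N"
  using A_mono by blast

lemma g_commute:
  assumes "x \<in> A n" "n < m" "m < N"
  shows "x * g m = g m * x"
  using assms(1)
proof (induction rule: gen_alg.induct)
  case (scalar c)
  then show ?case using assms g_sc[of m c] by (cases "m = 0") auto
next
  case (gen i)
  then show ?case using assms by (intro far) auto
next
  case (mult x y)
  then show ?case by (metis mult.assoc)
qed (simp add: algebra_simps)

text \<open>The case m = i + 2 is the heart: there y_m = g_{i+1} g_i y_i g_i g_{i+1}, and two uses
  of the braid relation carry g_i from one side to the other. For larger m the new outer generator
  is far from g_i.\<close>

lemma Y_g:
  assumes "1 \<le> i" "i + 1 < m" "m \<le> N"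
  shows "Y m * g i = g i * Y m"
  using assms(2,3)
proof (induction m)
  case (Suc m)
  show ?case
  proof (cases "m = i + 1")
    case True
    have c: "Y i * g (i + 1) = g (i + 1) * Y i"
      using Suc.prems True assms(1) by (intro g_commute[of _ i]) (auto intro: Y_in_A)
    have b: "g i * g (i + 1) * g i = g (i + 1) * g i * g (i + 1)"
      using Suc.prems True assms(1) by (intro braid) auto
    have Y: "Y (Suc m) = g (i + 1) * (g i * Y i * g i) * g (i + 1)"
      using True assms(1) by (cases i) auto
    have "Y (Suc m) * g i = g (i + 1) * g i * Y i * (g i * g (i + 1) * g i)"
      by (simp add: Y mult.assoc)
    also have "\<dots> = g (i + 1) * g i * (Y i * g (i + 1)) * g i * g (i + 1)"
      by (subst b) (simp only: mult.assoc)
    also have "\<dots> = (g (i + 1) * g i * g (i + 1)) * Y i * g i * g (i + 1)"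
      by (subst c) (simp only: mult.assoc)
    also have "\<dots> = g i * Y (Suc m)"
      by (subst b[symmetric]) (simp only: Y mult.assoc)
    finally show ?thesis .
  next
    case False
    then have "Y m * g i = g i * Y m" using Suc by auto
    moreover have "g i * g m = g m * g i" using Suc.prems False assms(1) by (intro far) auto
    moreover have "Y (Suc m) = g m * Y m * g m" using Suc.prems by (cases m) auto
    ultimately show ?thesis by (metis mult.assoc)
  qed
qed simp

text \<open>Hence y_{n+1} centralises \<open>A n\<close>, so its polynomials can be moved past
  everything of level n.\<close>

lemma Y_commute:
  assumes "x \<in> A n" "n < N"
  shows "Y (Suc n) * x = x * Y (Suc n)"
  using assms(1)
proof (induction rule: gen_alg.induct)
  case (scalar c)
  then show ?case using assms(2) by (intro sc_central) (auto intro: Y_in_A')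
next
  case (gen i)
  then show ?case using assms(2) by (intro Y_g) auto
next
  case (mult x y)
  then show ?case by (metis mult.assoc)
qed (simp add: algebra_simps)

section \<open>Evaluating polynomials at Jucys-Murphy elements\<close>

lemma ev_pCons: "ev i (pCons c p) = sc c + Y i * ev i p"
  by (rule poly_at_pCons) simp

lemma ev_add: "ev i (p + r) = ev i p + ev i r"
  by (induction p r rule: poly_induct2) (simp_all add: ev_pCons sc_add algebra_simps)

lemma ev_smult: "i \<le> N \<Longrightarrow> ev i (smult c p) = sc c * ev i p"
proof (induction p)
  case (pCons d p)
  then have "Y i * (sc c * ev i p) = sc c * (Y i * ev i p)"
    using sc_central[of "Y i" c] Y_in_A' by (metis mult.assoc)
  with pCons show ?case by (simp add: ev_pCons sc_mult algebra_simps)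
qed simp

lemma ev_minus: "i \<le> N \<Longrightarrow> ev i (- p) = - ev i p"
  using ev_smult[of i "- 1" p] unit_left[of "ev i p"] ev_in_A[of i N p] by (simp add: sc_minus)

lemma ev_diff: "i \<le> N \<Longrightarrow> ev i (p - r) = ev i p - ev i r"
  using ev_add[of i p "- r"] by (simp add: ev_minus)

lemma ev_mult: "i \<le> N \<Longrightarrow> ev i (p * r) = ev i p * ev i r"
  by (induction p) (simp_all add: ev_pCons ev_add ev_smult algebra_simps)

lemma ev_const: "ev i [:c:] = sc c"
  by (simp add: ev_pCons)

lemma ev_1: "ev i 1 = sc 1"
  using ev_const[of i 1] by (simp add: one_pCons)

lemma ev_linear: "i \<le> N \<Longrightarrow> ev i [:- c, 1:] = Y i - sc c"
  using Y_in_A'[of i N] by (simp add: ev_pCons sc_minus unit_right)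

lemma ev_sum: "ev i (sum f I) = (\<Sum>j\<in>I. ev i (f j))"
  by (induction I rule: infinite_finite_induct) (auto simp: ev_add)

lemma ev_commute: "x \<in> A N \<Longrightarrow> Y i * x = x * Y i \<Longrightarrow> ev i p * x = x * ev i p"
proof (induction p)
  case (pCons c p)
  then have "Y i * ev i p * x = x * (Y i * ev i p)" by (metis mult.assoc)
  with pCons show ?case by (simp add: ev_pCons sc_central algebra_simps)
qed simp

lemma ev_commute_A: "x \<in> A n \<Longrightarrow> n < N \<Longrightarrow> ev (Suc n) p * x = x * ev (Suc n) p"
  by (intro ev_commute Y_commute) (auto intro: A_N)

lemma ev_eigen_left:
  assumes "x \<in> A N" "Y i * x = sc c * x" "i \<le> N"
  shows "ev i p * x = sc (poly p c) * x"
proof (induction p)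
  case (pCons d p)
  have "Y i * ev i p * x = sc (poly p c) * (Y i * x)"
    using pCons sc_central[of "Y i"] Y_in_A'[of i N] assms(3) by (metis mult.assoc)
  then show ?case
    by (simp add: ev_pCons sc_add assms(2) sc_mult distrib_right mult.assoc[symmetric])
       (simp add: sc_mult[symmetric] mult.commute)
qed simp

lemma ev_eigen_right:
  assumes "x \<in> A N" "x * Y i = sc c * x" "i \<le> N"
  shows "x * ev i p = sc (poly p c) * x"
proof (induction p)
  case (pCons d p)
  have "x * (Y i * ev i p) = sc c * (x * ev i p)"
    using assms(2) by (metis mult.assoc)
  then show ?case
    using pCons by (simp add: ev_pCons sc_add sc_mult algebra_simps sc_central assms(1))
qed simp

section \<open>Decomposition over the subalgebra one level below\<close>

inductive_set sandwich :: "nat \<Rightarrow> 'a set" for n where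
  base: "x \<in> A n \<Longrightarrow> x \<in> sandwich n"
| mid: "x \<in> A n \<Longrightarrow> y \<in> A n \<Longrightarrow> x * g n * y \<in> sandwich n"
| add: "x \<in> sandwich n \<Longrightarrow> y \<in> sandwich n \<Longrightarrow> x + y \<in> sandwich n"

lemma sandwich_left: "y \<in> sandwich n \<Longrightarrow> x \<in> A n \<Longrightarrow> x * y \<in> sandwich n"
proof (induction rule: sandwich.induct)
  case (mid u v)
  then show ?case using sandwich.mid[of "x * u" n v] by (simp add: mult.assoc A_intros)
qed (auto simp: distrib_left intro: sandwich.intros A_intros)

text \<open>It suffices to rewrite g_{n+1} v g_{n+1} w. With v itself written as a sandwich one
  level lower, the outer generators commute with the factors from \<open>A n\<close>, and what
  remains is g_{n+1}^2 or g_{n+1} g_n g_{n+1}; the quadratic and the braid relation leave at most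
  one g_{n+1} in each term.\<close>

lemma A_sandwich:
  assumes "x \<in> A (Suc n)" "1 \<le> n" "n < N"
  shows "x \<in> sandwich n"
  using assms
proof (induction n arbitrary: x)
  case (Suc n)
  have gg: "g (Suc n) * v * g (Suc n) * w \<in> sandwich (Suc n)" if v: "v \<in> A (Suc n)" "w \<in> A (Suc n)" for v w
  proof -
    have gen: "g (Suc n) * u * g (Suc n) * w \<in> sandwich (Suc n)" if u: "u \<in> A n" "w \<in> A (Suc n)" for u w
    proof -
      have u': "u \<in> A (Suc n)" using u(1) A_mono[of n "Suc n"] by auto
      have "g (Suc n) * u * g (Suc n) * w = u * (g (Suc n) * g (Suc n)) * w"
        using g_commute[OF u(1), of "Suc n"] Suc.prems by (metis mult.assoc lessI)
      also have "\<dots> = u * sc 1 * w + u * sc h * g (Suc n) * w"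
        using Suc.prems by (subst quadratic) (auto simp: algebra_simps)
      also have "\<dots> \<in> sandwich (Suc n)"
        using u u' by (intro sandwich.intros A_intros)
      finally show ?thesis .
    qed
    show ?thesis
    proof (cases "n = 0")
      case True
      \<comment> \<open>At the bottom \<open>A 1\<close> has no generators either: it consists of
        scalars.\<close>
      have "v \<in> A 0" using v(1) unfolding True
        by (induction rule: gen_alg.induct) (auto intro: A_intros)
      then show ?thesis using gen v True by simp
    next
      case False
      then have "v \<in> sandwich n" using Suc v by simp
      then show ?thesis
      proof (induction rule: sandwich.induct)
        case (base u)
        then show ?case using gen v(2) by blast
      next
        case (mid u t)
        have ut: "u \<in> A (Suc n)" "t \<in> A (Suc n)" using mid A_mono[of n "Suc n"] by auto
        have b: "g n * g (Suc n) * g n = g (Suc n) * g n * g (Suc n)"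
          using braid[of n] False Suc.prems by simp
        have "g (Suc n) * (u * g n * t) * g (Suc n) * w = (g (Suc n) * u) * g n * (t * g (Suc n)) * w"
          by (simp add: mult.assoc)
        also have "\<dots> = (u * g (Suc n)) * g n * (g (Suc n) * t) * w"
          using g_commute[OF mid(1), of "Suc n"] g_commute[OF mid(2), of "Suc n"] Suc.prems by simp
        also have "\<dots> = u * (g (Suc n) * g n * g (Suc n)) * t * w"
          by (simp add: mult.assoc)
        also have "\<dots> = (u * g n) * g (Suc n) * (g n * (t * w))"
          by (subst b[symmetric]) (simp only: mult.assoc)
        also have "\<dots> \<in> sandwich (Suc n)"
          using ut v(2) False by (intro sandwich.intros A_intros) auto
        finally show ?case .
      next
        case (add u t)
        then show ?case by (auto simp: algebra_simps intro: sandwich.intros)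
      qed
    qed
  qed
  have "x * z \<in> sandwich (Suc n)" if "z \<in> sandwich (Suc n)" for z
    using Suc.prems(1) that
  proof (induction arbitrary: z rule: gen_alg.induct)
    case (scalar c)
    then show ?case by (intro sandwich_left A_intros)
  next
    case (gen i)
    show ?case
    proof (cases "i = Suc n")
      case False
      then show ?thesis using gen by (intro sandwich_left A_intros) auto
    next
      case True
      from gen(3) show ?thesis unfolding True
      proof (induction rule: sandwich.induct)
        case (base u)
        have "sc 1 * g (Suc n) * u \<in> sandwich (Suc n)"
          using base by (intro sandwich.intros A_intros)
        then show ?case using unit_g[of "Suc n"] Suc.prems by simp
      next
        case (mid u v)
        then show ?case using gg[OF mid] by (simp add: mult.assoc)
      qed (auto simp: distrib_left intro: sandwich.intros)
    qed
  next
    case (add x y)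
    then show ?case by (auto simp: distrib_right intro: sandwich.intros)
  next
    case (mult x y)
    then show ?case by (simp add: mult.assoc)
  qed
  from this[of "sc 1"] show ?case
    using unit_right[of x] A_N[OF Suc.prems(1)] Suc.prems by (auto intro: sandwich.intros A_intros)
qed simp

lemma Y_Suc: "1 \<le> n \<Longrightarrow> Y (Suc n) = g n * Y n * g n"
  by (cases n) auto

text \<open>Multiply y_{n+1} = g_n y_n g_n by g_n on one side and expand g_n^2 by the quadratic
  relation.\<close>

lemma Y_g_shift:
  assumes "1 \<le> n" "n < N"
  shows "Y (Suc n) * g n = g n * Y n + sc h * Y (Suc n)"
    and "g n * Y (Suc n) = Y n * g n + sc h * Y (Suc n)"
proof -
  have Y: "Y n \<in> A N" using Y_in_A' assms by simp
  have g: "g n \<in> A N" using assms by (intro A_intros)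
  have "Y (Suc n) * g n = g n * Y n * (g n * g n)" by (simp add: Y_Suc[OF assms(1)] mult.assoc)
  also have "\<dots> = g n * (Y n * sc 1) + (g n * Y n * sc h) * g n"
    using assms by (simp add: quadratic algebra_simps)
  also have "\<dots> = g n * Y n + sc h * Y (Suc n)"
    using Y g assms by (simp add: Y_Suc[OF assms(1)] unit_left unit_right sc_central A_intros(4)) (simp add: mult.assoc)
  finally show "Y (Suc n) * g n = g n * Y n + sc h * Y (Suc n)" .
  have "g n * Y (Suc n) = (g n * g n) * Y n * g n" by (simp add: Y_Suc[OF assms(1)] mult.assoc)
  also have "\<dots> = (sc 1 * Y n) * g n + sc h * (g n * Y n * g n)"
    using assms by (simp add: quadratic algebra_simps)
  also have "\<dots> = Y n * g n + sc h * Y (Suc n)"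
    using Y by (simp add: Y_Suc[OF assms(1)] unit_left)
  finally show "g n * Y (Suc n) = Y n * g n + sc h * Y (Suc n)" .
qed

end

section \<open>The tower of Hecke algebras\<close>

text \<open>With p = 1/q and \<beta> = (q - p) A / (A - B), the left side is 1 + (q - p) \<beta> -
  \<beta>^2 cleared of denominators. The factorization shows that it vanishes only when A = q^2 B or
  A = p^2 B, that is, for neighbouring contents.\<close>

lemma quadratic_factorization:
  fixes q p A B :: complex
  assumes "q * p = 1"
  shows "(A - B)^2 + (q - p) * ((q - p) * A) * (A - B) - ((q - p) * A)^2 = (A - q^2 * B) * (A - p^2 * B)"
proof -
  have "(A - B)^2 + (q - p) * ((q - p) * A) * (A - B) - ((q - p) * A)^2
      = A^2 - 2 * A * B + B^2 - (q^2 + p^2) * A * B + 2 * (q * p) * A * B"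
    by (simp add: power2_eq_square algebra_simps)
  moreover have "(A - q^2 * B) * (A - p^2 * B) = A^2 - (q^2 + p^2) * A * B + (q * p)^2 * B^2"
    by (simp add: power2_eq_square algebra_simps)
  ultimately show ?thesis using assms by simp
qed

context hecke_algebra
begin

lemma Y_Y: "i \<le> N \<Longrightarrow> j \<le> N \<Longrightarrow> Y i * Y j = Y j * Y i"
proof (induction i j rule: linorder_wlog)
  case (le i j)
  show ?case
  proof (cases "i = j \<or> j = 0")
    case False
    then obtain m where m: "j = Suc m" "i \<le> m" using le by (cases j) auto
    then show ?thesis using le Y_commute[of "Y i" m] Y_in_A'[of i m] by simp
  qed (use le in auto)
qed simp

lemma Y_E: "i \<le> N \<Longrightarrow> length s \<le> N \<Longrightarrow> Y i * E s = E s * Y i"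
proof (induction s rule: rev_induct)
  case Nil
  then show ?case using Y_in_A'[of i N] by (simp add: idem_Nil unit_left unit_right)
next
  case (snoc k s)
  then have "ev (Suc (length s)) p * Y i = Y i * ev (Suc (length s)) p" for p
    by (intro ev_commute Y_Y) (auto intro: Y_in_A')
  with snoc show ?case by (simp add: idem_snoc mult.assoc) (simp add: mult.assoc[symmetric])
qed

lemma E_E: "length s \<le> N \<Longrightarrow> length t \<le> N \<Longrightarrow> E s * E t = E t * E s"
proof (induction s rule: rev_induct)
  case Nil
  then show ?case using A_N[OF E_in_A[of t]] by (simp add: idem_Nil unit_left unit_right)
next
  case (snoc k s)
  then have "ev (Suc (length s)) p * E t = E t * ev (Suc (length s)) p" for p
    by (intro ev_commute Y_E) (auto intro: A_N[OF E_in_A])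
  with snoc show ?case by (simp add: idem_snoc mult.assoc) (simp add: mult.assoc[symmetric])
qed

section \<open>The properties carried up the tower\<close>

definition orthogonal :: "nat \<Rightarrow> bool" where
  "orthogonal n \<longleftrightarrow> (\<forall>s\<in>std_seqs n. \<forall>t\<in>std_seqs n. E s * E t = (if s = t then E s else 0))"

definition eigen_complete :: "nat \<Rightarrow> bool" where
  "eigen_complete n \<longleftrightarrow> (\<Sum>s\<in>std_seqs n. E s) = sc 1 \<and>
     (\<forall>s\<in>std_seqs n. \<forall>i\<in>{1..n}. Y i * E s = sc (a (s ! (i - 1))) * E s)"

definition shape_blocks :: "nat \<Rightarrow> bool" where
  "shape_blocks n \<longleftrightarrow> (\<forall>s\<in>std_seqs n. \<forall>t\<in>std_seqs n. \<forall>x\<in>A n. maya s \<noteq> maya t \<longrightarrow> E s * x * E t = 0)"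

definition rank_one :: "nat \<Rightarrow> bool" where
  "rank_one n \<longleftrightarrow> (\<forall>s\<in>std_seqs n. \<forall>x\<in>A n. \<exists>c. E s * x * E s = sc c * E s)"

text \<open>\<open>E s\<close> factors through \<open>E t\<close>, so the part of the algebra
  between s and t is nonzero as soon as \<open>E s\<close> is; by \<open>rank_one\<close> it is then
  one-dimensional.\<close>

definition linked :: "nat \<Rightarrow> int list \<Rightarrow> int list \<Rightarrow> bool" where
  "linked n s t \<longleftrightarrow> (\<exists>v\<in>A n. \<exists>w\<in>A n. E s * v * E t * w * E s = E s)"

definition shape_linked :: "nat \<Rightarrow> bool" where
  "shape_linked n \<longleftrightarrow> (\<forall>s\<in>std_seqs n. \<forall>t\<in>std_seqs n. maya s = maya t \<longrightarrow> linked n s t)"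

text \<open>Orthogonality is kept for all lower levels because g_n commutes past the idempotents of
  level n - 1, which is how \<open>mid_zero\<close> uses it; the other properties enter the
  inductive step at level n.\<close>

definition good :: "nat \<Rightarrow> bool" where
  "good n \<longleftrightarrow> (\<forall>m\<le>n. orthogonal m) \<and> eigen_complete n \<and> shape_blocks n \<and> rank_one n \<and> shape_linked n"

lemma cancel_scalar:
  assumes "z \<in> A N" "sc c * z = sc d * z" "c \<noteq> d"
  shows "z = 0"
proof -
  have "sc (c - d) * z = 0" using assms(2) by (simp add: sc_diff left_diff_distrib)
  then have "sc (inverse (c - d)) * sc (c - d) * z = 0" by (simp add: mult.assoc)
  then show ?thesis using assms unit_left by (simp add: sc_mult[symmetric])
qed

lemma linked_trans:
  assumes "linked n s r" "linked n r t" "E r \<in> A n"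
  shows "linked n s t"
proof -
  obtain v w where vw: "v \<in> A n" "w \<in> A n" "E s * v * E r * w * E s = E s"
    using assms(1) by (auto simp: linked_def)
  obtain v' w' where vw': "v' \<in> A n" "w' \<in> A n" "E r * v' * E t * w' * E r = E r"
    using assms(2) by (auto simp: linked_def)
  have "E s * (v * E r * v') * E t * (w' * E r * w) * E s = E s * v * (E r * v' * E t * w' * E r) * w * E s"
    by (simp add: mult.assoc)
  also have "\<dots> = E s" by (simp only: vw' vw)
  finally show ?thesis unfolding linked_def using assms(3) vw vw' by (blast intro: A_intros)
qed

text \<open>\<open>E (take m s)\<close> is a product of Lagrange polynomials, each equal to 1 at the
  content that s has there, and the functional replaces Jucys-Murphy elements on the right by these
  contents.\<close>

lemma weight_functional_idem:
  assumes s: "s \<in> std_seqs N" and m: "m \<le> N"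
    and \<chi>: "\<chi> (sc 1) = (1 :: complex)"
      "\<And>x y. x \<in> A N \<Longrightarrow> y \<in> A N \<Longrightarrow> \<chi> (x + y) = \<chi> x + \<chi> y"
      "\<And>x c. x \<in> A N \<Longrightarrow> \<chi> (sc c * x) = c * \<chi> x"
      "\<And>x i. x \<in> A N \<Longrightarrow> 1 \<le> i \<Longrightarrow> i \<le> N \<Longrightarrow> \<chi> (x * Y i) = a (s ! (i - 1)) * \<chi> x"
  shows "\<And>x i p. x \<in> A N \<Longrightarrow> 1 \<le> i \<Longrightarrow> i \<le> N \<Longrightarrow> \<chi> (x * ev i p) = poly p (a (s ! (i - 1))) * \<chi> x"
    and "\<chi> (E (take m s)) = 1"
proof -
  show ev: "\<chi> (x * ev i p) = poly p (a (s ! (i - 1))) * \<chi> x" if "x \<in> A N" "1 \<le> i" "i \<le> N" for x i p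
    using that(1)
  proof (induction p arbitrary: x)
    case 0
    have "0 * x = (0 :: 'a)" by simp
    then show ?case using \<chi>(3)[OF 0, of 0] by simp
  next
    case (pCons c p)
    have Y: "Y i \<in> A N" using that by (intro Y_in_A')
    have "x * ev i (pCons c p) = sc c * x + x * Y i * ev i p"
      using sc_central[OF pCons.prems] by (simp add: ev_pCons algebra_simps)
    moreover have "\<chi> (x * Y i * ev i p) = poly p (a (s ! (i - 1))) * (a (s ! (i - 1)) * \<chi> x)"
      using pCons.IH[of "x * Y i"] pCons.prems Y that \<chi>(4) by (simp add: A_intros)
    ultimately show ?case using pCons.prems that Y
      by (simp add: \<chi> A_intros ev_in_A algebra_simps)
  qed
  have "\<chi> (E (take m s)) = 1" using m
  proof (induction m)
    case (Suc m)
    have len: "length s = N" using s length_std_seqs by simp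
    have "grows {..0} (take m s @ drop m s)" using s by (simp add: std_seqs_def)
    then have "grows (maya (take m s)) (s ! m # drop (Suc m) s)"
      unfolding grows_append maya_def using Suc.prems len by (simp add: Cons_nth_drop_Suc)
    then have k: "s ! m \<in> addable (maya (take m s))" by simp
    have "take m s \<in> std_seqs m"
      using \<open>grows {..0} (take m s @ drop m s)\<close> Suc.prems len
      unfolding std_seqs_def grows_append by simp
    then have fin: "finite (addable (maya (take m s)))" by (rule finite_addable)
    have "E (take m s) \<in> A N" using A_N[OF E_in_A[of "take m s"]] by (simp add: len)
    then show ?case using Suc len
      by (simp add: take_Suc_conv_app_nth idem_snoc min_def ev poly_lagrange[OF inj_content fin k k])
  qed (simp add: idem_Nil \<chi>)
  then show "\<chi> (E (take m s)) = 1" .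
qed

text \<open>Every shape has an addable node. The functionals exist for sequences of length N, and
  extension makes them available for every shorter one.\<close>

lemma extend_std_seq:
  assumes "t \<in> std_seqs m" "m \<le> n"
  shows "\<exists>s\<in>std_seqs n. take m s = t"
  using assms(2)
proof (induction n rule: dec_induct)
  case base
  then show ?case using assms(1) length_std_seqs by force
next
  case (step n)
  then obtain s where s: "s \<in> std_seqs n" "take m s = t" by blast
  then obtain k where "k \<in> addable (maya s)" using addable_nonempty by blast
  then have "s @ [k] \<in> std_seqs (Suc n)" using s by (simp add: snoc_in_std_seqs)
  moreover have "take m (s @ [k]) = t" using s step length_std_seqs by force
  ultimately show ?case by blast
qed

text \<open>The functional of an extension of \<open>s @ [k]\<close> has the value 1 at
  \<open>E s\<close> and hence sends the annihilated element to the value of p at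
  \<open>a k\<close>. This is the lower bound on annihilating polynomials.\<close>

lemma annihilator_roots:
  assumes "s \<in> std_seqs n" "n < N" "ev (Suc n) p * E s = 0" "k \<in> addable (maya s)"
  shows "poly p (a k) = 0"
proof -
  have "s @ [k] \<in> std_seqs (Suc n)" using assms by (simp add: snoc_in_std_seqs)
  then obtain t where t: "t \<in> std_seqs N" "take (Suc n) t = s @ [k]"
    using extend_std_seq[of _ "Suc n" N] assms(2) by (metis Suc_leI)
  have len: "length s = n" "length t = N" using assms t length_std_seqs by auto
  have "t ! n = k" using t(2) len assms(2)
    by (metis lessI nth_append_length nth_take)
  have "take n t = s" using t(2) len
    by (metis append_eq_conv_conj less_or_eq_imp_le lessI min_def take_take)
  obtain \<chi> where \<chi>: "\<chi> (sc 1) = (1 :: complex)"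
      "\<And>x y. x \<in> A N \<Longrightarrow> y \<in> A N \<Longrightarrow> \<chi> (x + y) = \<chi> x + \<chi> y"
      "\<And>x c. x \<in> A N \<Longrightarrow> \<chi> (sc c * x) = c * \<chi> x"
      "\<And>x i. x \<in> A N \<Longrightarrow> 1 \<le> i \<Longrightarrow> i \<le> N \<Longrightarrow> \<chi> (x * Y i) = a (t ! (i - 1)) * \<chi> x"
    using weight_functional[OF t(1)] by auto
  have E: "E s \<in> A n" using E_in_A[of s] len by simp
  have "ev (Suc n) p * E s = E s * ev (Suc n) p"
    by (rule ev_commute_A[OF E assms(2)])
  moreover have "\<chi> (E s * ev (Suc n) p) = poly p (a k) * \<chi> (E s)"
    using weight_functional_idem(1)[OF t(1) _ \<chi>, of 0 "E s" "Suc n" p] A_N[OF E] assms(2) \<open>t ! n = k\<close>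
    by simp
  moreover have "\<chi> (E s) = 1"
    using weight_functional_idem(2)[OF t(1) _ \<chi>, of n] assms(2) \<open>take n t = s\<close> by simp
  moreover have "\<chi> 0 = 0" using \<chi>(3)[of 0 0] A_0 by simp
  ultimately show ?thesis using assms(3) by simp
qed

lemma idem_butlast:
  assumes "orthogonal m" "t @ [k] \<in> std_seqs (Suc m)" "m < N"
  shows "E t * E (t @ [k]) = E (t @ [k])" "E (t @ [k]) * E t = E (t @ [k])"
proof -
  have t: "t \<in> std_seqs m" using assms(2) by (simp add: snoc_in_std_seqs)
  then have "E t * E t = E t" using assms(1) by (simp add: orthogonal_def)
  then show 1: "E t * E (t @ [k]) = E (t @ [k])" by (simp add: idem_snoc mult.assoc[symmetric])
  have "length t = m" using t length_std_seqs by simp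
  with 1 show "E (t @ [k]) * E t = E (t @ [k])" using E_E[of "t @ [k]" t] assms(3) by simp
qed

section \<open>The inductive step from level n to level n + 1\<close>

context
  fixes n assumes good: "good n" and n: "1 \<le> n" "n < N"
begin

lemma good_facts:
  shows "m \<le> n \<Longrightarrow> orthogonal m" "eigen_complete n" "shape_blocks n" "rank_one n" "shape_linked n"
  using good by (auto simp: good_def)

lemma E_idem: "s \<in> std_seqs n \<Longrightarrow> E s * E s = E s"
  using good_facts(1)[of n] by (simp add: orthogonal_def)

lemma E_An: "s \<in> std_seqs n \<Longrightarrow> E s \<in> A n"
  by (rule E_in_A') auto

lemma Yn_eigen:
  assumes "s @ [k] \<in> std_seqs n"
  shows "Y n * E (s @ [k]) = sc (a k) * E (s @ [k])" "E (s @ [k]) * Y n = sc (a k) * E (s @ [k])"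
proof -
  have "length s = n - 1" using length_std_seqs[OF assms] by simp
  then show 1: "Y n * E (s @ [k]) = sc (a k) * E (s @ [k])"
    using good_facts(2) assms n unfolding eigen_complete_def
    by (metis atLeastAtMost_iff nth_append_length order_refl)
  then show "E (s @ [k]) * Y n = sc (a k) * E (s @ [k])"
    using Y_E[of n "s @ [k]"] length_std_seqs[OF assms] n by simp
qed

lemma std_seqs_snocE:
  assumes "s \<in> std_seqs n"
  obtains t k where "s = t @ [k]"
  using assms n length_std_seqs[of s n] by (cases s rule: rev_cases) auto

text \<open>If the factor facing g_n is an eigenvector of y_n with eigenvalue c, then y_{n+1} - c
  removes the generator from x g_n z, at the price of a factor h y_{n+1}. The outer ends of x and z
  are passed by y_{n+1} unchanged.\<close>

lemma sandwich_shift: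
  assumes "x \<in> A n" "z \<in> A n"
  shows "Y n * z = sc c * z \<Longrightarrow>
      Y (Suc n) * (x * g n * z) = sc c * (x * g n * z) + sc h * (Y (Suc n) * (x * z))"
    and "x * Y n = sc c * x \<Longrightarrow>
      (x * g n * z) * Y (Suc n) = sc c * (x * g n * z) + sc h * (Y (Suc n) * (x * z))"
proof -
  have x: "Y (Suc n) * x = x * Y (Suc n)" and z: "Y (Suc n) * z = z * Y (Suc n)"
    using Y_commute assms n by auto
  have sc: "w * sc d = sc d * w" if "w \<in> A n" for w d
    using sc_central[OF A_N[OF that]] n by simp
  {
    assume c: "Y n * z = sc c * z"
    have "Y (Suc n) * (x * g n * z) = x * (Y (Suc n) * g n) * z"
      by (simp add: mult.assoc[symmetric] x)
    also have "\<dots> = x * g n * (Y n * z) + (x * sc h) * (Y (Suc n) * z)"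
      by (simp add: Y_g_shift(1)[OF n] algebra_simps)
    also have "\<dots> = (x * (g n * sc c)) * z + sc h * ((x * Y (Suc n)) * z)"
      by (simp only: c sc[OF assms(1)] mult.assoc)
    also have "\<dots> = sc c * (x * g n * z) + sc h * (Y (Suc n) * (x * z))"
      by (simp only: g_sc[OF n] x[symmetric] mult.assoc) (simp only: mult.assoc[symmetric] sc[OF assms(1)])
    finally show "Y (Suc n) * (x * g n * z) = sc c * (x * g n * z) + sc h * (Y (Suc n) * (x * z))" .
  }
  {
    assume c: "x * Y n = sc c * x"
    have "(x * g n * z) * Y (Suc n) = x * (g n * Y (Suc n)) * z"
      by (simp add: mult.assoc z)
    also have "\<dots> = (x * Y n) * g n * z + (x * sc h) * (Y (Suc n) * z)"
      by (simp add: Y_g_shift(2)[OF n] algebra_simps)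
    also have "\<dots> = sc c * x * g n * z + sc h * ((x * Y (Suc n)) * z)"
      by (simp only: c sc[OF assms(1)] mult.assoc)
    also have "\<dots> = sc c * (x * g n * z) + sc h * (Y (Suc n) * (x * z))"
      by (simp only: x[symmetric] mult.assoc)
    finally show "(x * g n * z) * Y (Suc n) = sc c * (x * g n * z) + sc h * (Y (Suc n) * (x * z))" .
  }
qed

text \<open>The idempotents of the two prefixes have level n - 1 and commute with g_n, so they can
  be brought together across it.\<close>

lemma mid_zero:
  assumes "s @ [k] \<in> std_seqs n" "t @ [l] \<in> std_seqs n" "s \<noteq> t"
  shows "E (s @ [k]) * g n * E (t @ [l]) = 0"
proof -
  obtain m where m: "n = Suc m" using n by (cases n) auto
  have s: "s \<in> std_seqs m" "t \<in> std_seqs m" using assms by (auto simp: m snoc_in_std_seqs)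
  have o: "orthogonal m" using good_facts(1) m by simp
  have "E (s @ [k]) * g n * E (t @ [l]) = (E (s @ [k]) * E s) * g n * (E t * E (t @ [l]))"
    using idem_butlast[OF o] assms n m by simp
  also have "\<dots> = E (s @ [k]) * (E s * g n) * E t * E (t @ [l])" by (simp only: mult.assoc)
  also have "\<dots> = E (s @ [k]) * (g n * E s) * E t * E (t @ [l])"
    using g_commute[of "E s" m n] E_in_A'[OF s(1), of m] n m by simp
  also have "\<dots> = E (s @ [k]) * g n * (E s * E t) * E (t @ [l])" by (simp only: mult.assoc)
  also have "\<dots> = 0" using o s assms(3) by (simp add: orthogonal_def)
  finally show ?thesis .
qed

text \<open>Inserting the resolution of the unit on both sides of g_n puts eigenvectors of y_n next
  to it, as \<open>sandwich_shift\<close> requires.\<close>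

lemma mid_expand:
  assumes "x \<in> A n" "z \<in> A n"
  shows "x * g n * z = (\<Sum>r\<in>std_seqs n. \<Sum>t\<in>std_seqs n. x * E r * g n * (E t * z))"
proof -
  have S: "(\<Sum>s\<in>std_seqs n. E s) = sc 1" using good_facts(2) by (simp add: eigen_complete_def)
  have "x * g n * z = x * (\<Sum>r\<in>std_seqs n. E r) * g n * ((\<Sum>t\<in>std_seqs n. E t) * z)"
    unfolding S using assms A_N n by (simp add: unit_left unit_right)
  also have "\<dots> = (\<Sum>r\<in>std_seqs n. \<Sum>t\<in>std_seqs n. x * E r * g n * (E t * z))"
    by (simp add: sum_distrib_left sum_distrib_right mult.assoc) (rule sum.swap)
  finally show ?thesis .
qed

text \<open>In the expansion around g_n only terms with r = t of the shape of s can survive. The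
  last content exponent l of t is removable from that shape; the factor X - a l of \<open>?Q\<close>
  eliminates g_n and leaves h c X with c from \<open>rank_one\<close>, so one linear factor replaces
  another and the degree does not grow. The terms from \<open>A n\<close> contribute multiples of
  \<open>?Q\<close>.\<close>

lemma corner_relation:
  assumes s: "s \<in> std_seqs n" and x: "x \<in> A (Suc n)"
  shows "\<exists>p. degree p \<le> card (removable (maya s)) \<and>
    ev (Suc n) (root_poly a (removable (maya s))) * (E s * x * E s) = ev (Suc n) p * E s"
    (is "?P (E s * x * E s)")
proof -
  let ?R = "removable (maya s)" and ?Q = "root_poly a (removable (maya s))"
  have fin: "finite ?R" using finite_removable[OF s] .
  have Es: "E s \<in> A n" using E_An[OF s] .
  have N: "Suc n \<le> N" using n by simp
  have P0: "?P 0" by (intro exI[of _ 0]) simp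
  have Padd: "?P (u + v)" if uv: "?P u" "?P v" for u v
  proof -
    from uv obtain p r where "degree p \<le> card ?R" "ev (Suc n) ?Q * u = ev (Suc n) p * E s"
      "degree r \<le> card ?R" "ev (Suc n) ?Q * v = ev (Suc n) r * E s" by blast
    then show ?thesis
      by (intro exI[of _ "p + r"]) (auto simp: degree_add_le ev_add algebra_simps)
  qed
  have Psum: "?P (\<Sum>i\<in>I. f i)" if "\<And>i. i \<in> I \<Longrightarrow> ?P (f i)" for f and I :: "int list set"
    using that
  proof (induction I rule: infinite_finite_induct)
    case (insert i I)
    then show ?case by (simp only: sum.insert Padd insert_iff simp_thms)
  qed (use P0 in simp_all)
  have "x \<in> sandwich n" using A_sandwich[OF x n] .
  then show ?thesis
  proof (induction rule: sandwich.induct)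
    case (base x)
    then obtain c where "E s * x * E s = sc c * E s"
      using good_facts(4) s by (auto simp: rank_one_def)
    then have "ev (Suc n) ?Q * (E s * x * E s) = ev (Suc n) (smult c ?Q) * E s"
      using sc_central[of "ev (Suc n) ?Q" c] ev_in_A[OF N] ev_smult[OF N] by (simp add: mult.assoc[symmetric])
    moreover have "degree (smult c ?Q) \<le> card ?R"
      using degree_smult_le[of c ?Q] degree_root_poly[of a ?R] by simp
    ultimately show ?case by blast
  next
    case (add x y)
    then show ?case using Padd by (simp add: algebra_simps)
  next
    case (mid x y)
    have xy: "E s * x \<in> A n" "y * E s \<in> A n" using mid Es by (auto intro: A_intros)
    have "?P (E s * x * E r * g n * (E t * (y * E s)))" if rt: "r \<in> std_seqs n" "t \<in> std_seqs n" for r t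
    proof (cases "maya r = maya s \<and> maya t = maya s")
      case False
      then have "E s * x * E r = 0 \<or> E t * y * E s = 0"
        using good_facts(3) mid s rt by (metis shape_blocks_def)
      moreover have "E s * x * E r * g n * (E t * (y * E s)) = (E s * x * E r) * g n * (E t * y * E s)"
        by (simp only: mult.assoc)
      ultimately have "E s * x * E r * g n * (E t * (y * E s)) = 0" by auto
      then show ?thesis using P0 by simp
    next
      case same: True
      obtain r0 k where r: "r = r0 @ [k]" using rt by (auto elim: std_seqs_snocE)
      obtain t0 l where t: "t = t0 @ [l]" using rt by (auto elim: std_seqs_snocE)
      obtain m where m: "n = Suc m" using n by (cases n) auto
      have k: "k \<in> addable (maya r0)" and l: "l \<in> addable (maya t0)"
        using rt by (auto simp: r t m snoc_in_std_seqs)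
      show ?thesis
      proof (cases "r0 = t0")
        case False
        then have "E r * g n * E t = 0" using mid_zero rt unfolding r t by simp
        then have "E s * x * (E r * g n * E t) * (y * E s) = 0" by simp
        then have "E s * x * E r * g n * (E t * (y * E s)) = 0" by (simp only: mult.assoc)
        then show ?thesis using P0 by simp
      next
        case True
        then have "hop k (maya r0) = hop l (maya r0)" using same by (simp add: r t maya_snoc)
        \<comment> \<open>A common predecessor and a common final shape force the same added
          node.\<close>
        then have kl: "k = l" using hop_inj k l True by auto
        then have tr: "r = t" using True by (simp add: r t)
        have lR: "l \<in> ?R" using removable_hop[OF l] same by (simp add: t maya_snoc)
        define Z where "Z = E s * x * E t * g n * (E t * (y * E s))"
        have w: "E s * x * E t \<in> A n" "E t * (y * E s) \<in> A n"
          using xy rt E_An by (auto intro: A_intros)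
        have "Y n * (E t * (y * E s)) = sc (a l) * (E t * (y * E s))"
          using Yn_eigen(1)[of t0 l] rt by (simp add: t mult.assoc[symmetric])
        then have "Y (Suc n) * Z = sc (a l) * Z + sc h * (Y (Suc n) * (E s * x * E t * (E t * (y * E s))))"
          unfolding Z_def by (rule sandwich_shift(1)[OF w])
        also have "E s * x * E t * (E t * (y * E s)) = E s * (x * E t * y) * E s"
          using E_idem[OF rt(2)] by (metis mult.assoc)
        finally have YZ: "(Y (Suc n) - sc (a l)) * Z = sc h * (Y (Suc n) * (E s * (x * E t * y) * E s))"
          by (simp add: algebra_simps)
        obtain c where c: "E s * (x * E t * y) * E s = sc c * E s"
          using good_facts(4) s mid rt E_An by (force simp: rank_one_def intro: A_intros)
        let ?Ql = "root_poly a (?R - {l})"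
        have Y: "Y (Suc n) \<in> A N" using N by (intro Y_in_A')
        \<comment> \<open>The factor belonging to l is placed next to \<open>Z\<close>, where
          \<open>YZ\<close> applies.\<close>
        have "ev (Suc n) ?Q * Z = ev (Suc n) (?Ql * [:- a l, 1:]) * Z"
          using root_poly_remove[OF fin lR, of a] by (simp only: mult.commute)
        also have "\<dots> = ev (Suc n) ?Ql * ((Y (Suc n) - sc (a l)) * Z)"
          by (simp only: ev_mult[OF N] ev_linear[OF N] mult.assoc)
        also have "\<dots> = ev (Suc n) ?Ql * (sc h * (Y (Suc n) * (sc c * E s)))"
          by (simp only: YZ c)
        also have "\<dots> = ev (Suc n) (?Ql * [:0, h * c:]) * E s"
        proof -
          have "ev (Suc n) [:0, h * c:] = sc h * (sc c * Y (Suc n))"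
            by (simp add: ev_pCons sc_central[OF Y]) (simp only: sc_mult mult.assoc)
          moreover have "Y (Suc n) * (sc c * E s) = sc c * (Y (Suc n) * E s)"
            by (simp only: mult.assoc[symmetric] sc_central[OF Y])
          ultimately show ?thesis by (simp only: ev_mult[OF N] mult.assoc)
        qed
        finally have "ev (Suc n) ?Q * Z = ev (Suc n) (?Ql * [:0, h * c:]) * E s" .
        moreover have "degree (?Ql * [:0, h * c:]) \<le> card ?R"
        proof -
          have "degree (?Ql * [:0, h * c:]) \<le> card (?R - {l}) + 1"
            using degree_mult_le[of ?Ql "[:0, h * c:]"] degree_root_poly[of a "?R - {l}"]
            by (auto split: if_splits)
          then show ?thesis using card_Suc_Diff1[OF fin lR] by simp
        qed
        ultimately show ?thesis unfolding tr Z_def by blast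
      qed
    qed
    then have "?P (\<Sum>r\<in>std_seqs n. \<Sum>t\<in>std_seqs n. E s * x * E r * g n * (E t * (y * E s)))"
      by (intro Psum)
    also have "(\<Sum>r\<in>std_seqs n. \<Sum>t\<in>std_seqs n. E s * x * E r * g n * (E t * (y * E s)))
        = E s * (x * g n * y) * E s"
      unfolding mid_expand[OF xy, symmetric] by (simp only: mult.assoc)
    finally show ?case .
  qed
qed

lemma annihilated:
  assumes s: "s \<in> std_seqs n"
  shows "ev (Suc n) (root_poly a (addable (maya s))) * E s = 0"
proof -
  let ?R = "removable (maya s)" and ?Q = "root_poly a (removable (maya s))"
  have N: "Suc n \<le> N" using n by simp
  have E: "E s \<in> A n" using E_An[OF s] .
  obtain p where p: "degree p \<le> card ?R"
    "ev (Suc n) ?Q * (E s * Y (Suc n) * E s) = ev (Suc n) p * E s"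
    using corner_relation[OF s Y_in_A] by blast
  have "E s * Y (Suc n) * E s = Y (Suc n) * E s"
    using Y_commute[OF E] n E_idem[OF s] by (metis mult.assoc)
  then have "ev (Suc n) (?Q * [:0, 1:] - p) * E s = 0"
    using p(2) Y_in_A'[OF N] unit_right[of "Y (Suc n)"]
    by (simp add: ev_diff[OF N] ev_mult[OF N] ev_pCons left_diff_distrib mult.assoc del: mult_pCons_right)
  then have roots: "poly (?Q * [:0, 1:] - p) (a k) = 0" if "k \<in> addable (maya s)" for k
    using annihilator_roots[OF s] n that by blast
  have Q: "?Q * [:0, 1:] = pCons 0 ?Q" by (simp add: mult.commute[of ?Q])
  have nz: "?Q \<noteq> 0" using lead_coeff_root_poly[of a ?R] by auto
  then have d: "degree (pCons 0 ?Q) = Suc (card ?R)" by (simp add: degree_root_poly)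
  have deg: "degree (pCons 0 ?Q - p) = Suc (card ?R)"
    using d p(1) degree_add_eq_left[of "- p" "pCons 0 ?Q"] by simp
  have "coeff p (Suc (card ?R)) = 0" using p(1) by (simp add: coeff_eq_0)
  then have "lead_coeff (pCons 0 ?Q - p) = 1"
    unfolding deg using lead_coeff_root_poly[of a ?R] by (simp add: degree_root_poly)
  then have "pCons 0 ?Q - p = root_poly a (addable (maya s))"
    using roots deg card_addable_maya[OF s] finite_addable[OF s]
    by (intro monic_eq_root_poly inj_content) (simp_all add: Q)
  then show ?thesis using \<open>ev (Suc n) (?Q * [:0, 1:] - p) * E s = 0\<close> by (simp add: Q)
qed

lemma orthogonal_n: "orthogonal n"
  using good_facts(1) by simp

lemmas idem_absorb = idem_butlast[OF orthogonal_n _ n(2)]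

lemma snocD:
  assumes "s @ [k] \<in> std_seqs (Suc n)"
  shows "s \<in> std_seqs n" "k \<in> addable (maya s)" "length s = n" "finite (addable (maya s))"
  using assms length_std_seqs finite_addable by (auto simp: snoc_in_std_seqs)

lemma idem_snoc_left:
  assumes "s @ [k] \<in> std_seqs (Suc n)"
  shows "E (s @ [k]) = ev (Suc n) (lagrange_poly a (addable (maya s)) k) * E s"
  using snocD[OF assms] ev_commute_A[OF E_An n(2)] by (simp add: idem_snoc)

lemma E_AN: "s \<in> std_seqs (Suc n) \<Longrightarrow> E s \<in> A N"
  using n by (intro E_in_A'[of s "Suc n"]) auto

text \<open>X - a k times the Lagrange polynomial of k is a multiple of the annihilating
  polynomial.\<close>

lemma top_eigen:
  assumes "s @ [k] \<in> std_seqs (Suc n)"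
  shows "Y (Suc n) * E (s @ [k]) = sc (a k) * E (s @ [k])"
    and "E (s @ [k]) * Y (Suc n) = sc (a k) * E (s @ [k])"
proof -
  let ?S = "addable (maya s)"
  note s = snocD[OF assms]
  have N: "Suc n \<le> N" using n by simp
  have "(Y (Suc n) - sc (a k)) * E (s @ [k]) = ev (Suc n) ([:- a k, 1:] * lagrange_poly a ?S k) * E s"
    by (simp only: idem_snoc_left[OF assms] ev_mult[OF N] ev_linear[OF N] mult.assoc)
  also have "\<dots> = 0"
    using annihilated[OF s(1)] ev_smult[OF N]
    by (simp add: lagrange_mult_linear[OF s(4,2)] mult.assoc del: mult_pCons_left)
  finally show 1: "Y (Suc n) * E (s @ [k]) = sc (a k) * E (s @ [k])" by (simp add: left_diff_distrib)
  then show "E (s @ [k]) * Y (Suc n) = sc (a k) * E (s @ [k])"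
    using Y_E[of "Suc n" "s @ [k]"] N s(3) by simp
qed

lemma ev_top:
  assumes "s @ [k] \<in> std_seqs (Suc n)"
  shows "ev (Suc n) p * E (s @ [k]) = sc (poly p (a k)) * E (s @ [k])"
    and "E (s @ [k]) * ev (Suc n) p = sc (poly p (a k)) * E (s @ [k])"
  using assms n top_eigen[OF assms] E_AN[OF assms]
  by (intro ev_eigen_left ev_eigen_right; simp)+

lemma orthogonal_Suc: "orthogonal (Suc n)"
  unfolding orthogonal_def
proof (intro ballI)
  fix s' t' assume "s' \<in> std_seqs (Suc n)" "t' \<in> std_seqs (Suc n)"
  then obtain s k t l where st: "s' = s @ [k]" "t' = t @ [l]"
    "s @ [k] \<in> std_seqs (Suc n)" "t @ [l] \<in> std_seqs (Suc n)"
    by (metis std_seqs_SucE)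
  note s = snocD[OF st(3)] and t = snocD[OF st(4)]
  have "E (s @ [k]) * E (t @ [l]) = (if s @ [k] = t @ [l] then E (s @ [k]) else 0)"
  proof (cases "s = t")
    case False
    have "E (s @ [k]) * E (t @ [l]) = (E (s @ [k]) * E s) * (E t * E (t @ [l]))"
      by (simp add: idem_absorb st)
    also have "\<dots> = E (s @ [k]) * (E s * E t) * E (t @ [l])" by (simp only: mult.assoc)
    also have "\<dots> = 0" using orthogonal_n s t False by (simp add: orthogonal_def)
    finally show ?thesis using False by simp
  next
    case True
    have "E (s @ [k]) * E (s @ [l]) = E (s @ [k]) * E s * ev (Suc n) (lagrange_poly a (addable (maya s)) l)"
      by (simp add: idem_snoc[of _ _ _ s l] s(3) mult.assoc[symmetric])
    also have "\<dots> = E (s @ [k]) * ev (Suc n) (lagrange_poly a (addable (maya s)) l)"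
      by (simp only: idem_absorb(2)[OF st(3)])
    also have "\<dots> = sc (if l = k then 1 else 0) * E (s @ [k])"
      unfolding ev_top(2)[OF st(3)] using poly_lagrange[OF inj_content s(4), of l k] t(2) s(2) True by simp
    finally show ?thesis using True unit_left[OF E_AN[OF st(3)]] by (cases "l = k") simp_all
  qed
  then show "E s' * E t' = (if s' = t' then E s' else 0)" by (simp only: st)
qed

text \<open>The Lagrange polynomials of one shape sum to 1, so each \<open>E s\<close> splits into
  the \<open>E (s @ [k])\<close>; the eigenvalues of y_i for i \<le> n are inherited from the
  prefix.\<close>

lemma eigen_complete_Suc: "eigen_complete (Suc n)"
proof -
  have inj: "inj_on (\<lambda>(s, k). s @ [k]) X" for X :: "(int list \<times> int) set" by (auto simp: inj_on_def)
  have "(\<Sum>s\<in>std_seqs (Suc n). E s)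
      = (\<Sum>(s, k)\<in>(SIGMA s:std_seqs n. addable (maya s)). E (s @ [k]))"
    by (rule sum.reindex_cong[OF inj]) (auto simp: std_seqs_Suc)
  also have "\<dots> = (\<Sum>s\<in>std_seqs n. \<Sum>k\<in>addable (maya s). E (s @ [k]))"
    by (rule sum.Sigma[symmetric]) (auto simp: finite_std_seqs intro: finite_addable)
  also have "\<dots> = (\<Sum>s\<in>std_seqs n. E s)"
  proof (rule sum.cong[OF refl])
    fix s assume s: "s \<in> std_seqs n"
    have "(\<Sum>k\<in>addable (maya s). E (s @ [k]))
        = E s * ev (Suc n) (\<Sum>k\<in>addable (maya s). lagrange_poly a (addable (maya s)) k)"
      using length_std_seqs[OF s] by (simp add: idem_snoc ev_sum sum_distrib_left)
    also have "\<dots> = E s"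
      using sum_lagrange[OF inj_content finite_addable addable_nonempty, OF s s] unit_right A_N E_An[OF s] n
      by (simp add: ev_1)
    finally show "(\<Sum>k\<in>addable (maya s). E (s @ [k])) = E s" .
  qed
  also have "\<dots> = sc 1" using good_facts(2) by (simp add: eigen_complete_def)
  finally have sum: "(\<Sum>s\<in>std_seqs (Suc n). E s) = sc 1" .
  have "Y i * E s = sc (a (s ! (i - 1))) * E s" if si: "s \<in> std_seqs (Suc n)" "i \<in> {1..Suc n}" for s i
  proof -
    obtain t k where s: "s = t @ [k]" "t @ [k] \<in> std_seqs (Suc n)" using si std_seqs_SucE by metis
    note t = snocD[OF s(2)]
    show ?thesis
    proof (cases "i = Suc n")
      case True
      then show ?thesis using top_eigen(1)[OF s(2)] t(3) by (simp add: s nth_append)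
    next
      case False
      then have "Y i * E t = sc (a (t ! (i - 1))) * E t"
        using good_facts(2) t si by (simp add: eigen_complete_def)
      then have "Y i * (E t * E s) = sc (a (t ! (i - 1))) * (E t * E s)" by (simp add: mult.assoc[symmetric])
      moreover have "i - 1 < n" using False si by auto
      then have "s ! (i - 1) = t ! (i - 1)" using t(3) by (simp add: s nth_append)
      ultimately show ?thesis using idem_absorb(1)[OF s(2)] by (simp add: s)
    qed
  qed
  with sum show ?thesis by (simp add: eigen_complete_def)
qed

text \<open>y_{n+1} is applied to M from the left and from the right: the outer idempotents turn it
  into \<open>a k\<close> or \<open>a l\<close>, while the shift past g_n produces c or d. Where the
  term without g_n vanishes, a nonzero M forces \<open>a k\<close> = c and \<open>a l\<close> = d,
  so the last two contents are interchanged.\<close>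

lemma top_sandwich:
  assumes s: "s @ [k] \<in> std_seqs (Suc n)" and t: "t @ [l] \<in> std_seqs (Suc n)"
    and w: "x \<in> A n" "z \<in> A n"
    and c: "Y n * z = sc c * z" "x * Y n = sc d * x"
  defines "M \<equiv> E (s @ [k]) * (x * g n * z) * E (t @ [l])"
  shows "sc (a k) * M = sc c * M + sc (h * a k) * (E (s @ [k]) * (x * z) * E (t @ [l]))"
    and "sc (a l) * M = sc d * M + sc (h * a k) * (E (s @ [k]) * (x * z) * E (t @ [l]))"
proof -
  let ?s = "E (s @ [k])" and ?t = "E (t @ [l])"
  have sA: "?s \<in> A N" using E_AN s by simp
  have xz: "x * z \<in> A n" using w by (intro A_intros)
  have gN: "x * g n * z \<in> A N" using w n A_N by (intro A_intros) auto
  have "sc (a k) * M = (?s * Y (Suc n)) * (x * g n * z) * ?t"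
    unfolding M_def top_eigen(2)[OF s] by (simp only: mult.assoc)
  also have "\<dots> = ?s * (Y (Suc n) * (x * g n * z)) * ?t" by (simp only: mult.assoc)
  also have "\<dots> = (?s * sc c) * (x * g n * z) * ?t + (?s * sc h) * (Y (Suc n) * (x * z)) * ?t"
    unfolding sandwich_shift(1)[OF w c(1)] by (simp only: distrib_left distrib_right mult.assoc)
  also have "\<dots> = sc c * M + sc h * (?s * Y (Suc n)) * (x * z) * ?t"
    unfolding M_def by (simp only: sc_central[OF sA] mult.assoc)
  also have "\<dots> = sc c * M + sc (h * a k) * (?s * (x * z) * ?t)"
    unfolding top_eigen(2)[OF s] by (simp only: sc_mult mult.assoc)
  finally show "sc (a k) * M = sc c * M + sc (h * a k) * (?s * (x * z) * ?t)" .
  have "sc (a l) * M = (?s * (x * g n * z)) * sc (a l) * ?t"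
    unfolding M_def using sc_central[of "?s * (x * g n * z)"] A_intros(4)[OF sA gN] by (simp only: mult.assoc)
  also have "\<dots> = ?s * ((x * g n * z) * Y (Suc n)) * ?t"
    using top_eigen(1)[OF t] by (simp only: mult.assoc)
  also have "\<dots> = (?s * sc d) * (x * g n * z) * ?t + (?s * sc h) * (Y (Suc n) * (x * z)) * ?t"
    unfolding sandwich_shift(2)[OF w c(2)] by (simp only: distrib_left distrib_right mult.assoc)
  also have "\<dots> = sc d * M + sc h * (?s * Y (Suc n)) * (x * z) * ?t"
    unfolding M_def by (simp only: sc_central[OF sA] mult.assoc)
  also have "\<dots> = sc d * M + sc (h * a k) * (?s * (x * z) * ?t)"
    unfolding top_eigen(2)[OF s] by (simp only: sc_mult mult.assoc)
  finally show "sc (a l) * M = sc d * M + sc (h * a k) * (?s * (x * z) * ?t)" .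
qed

text \<open>An element of \<open>A n\<close> commutes with y_{n+1} and cannot join different last
  contents. A term with g_n is nonzero only if, after the prefixes are replaced by tableaux r and r'
  of the same shapes, the last two contents are interchanged over a common predecessor, and then the
  final shapes agree.\<close>

lemma shape_blocks_Suc: "shape_blocks (Suc n)"
proof -
  have "E (s @ [k]) * x * E (t @ [l]) = 0"
    if s: "s @ [k] \<in> std_seqs (Suc n)" and t: "t @ [l] \<in> std_seqs (Suc n)" and x: "x \<in> A (Suc n)"
      and neq: "maya (s @ [k]) \<noteq> maya (t @ [l])" for s k t l x
  proof -
    let ?s = "E (s @ [k])" and ?t = "E (t @ [l])"
    note sD = snocD[OF s] and tD = snocD[OF t]
    have N: "?s \<in> A N" "?t \<in> A N" using E_AN s t by auto
    have base: "?s * x * ?t = 0" if x: "x \<in> A n" for x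
    proof (cases "maya s = maya t")
      case False
      then have "E s * x * E t = 0" using good_facts(3) sD tD x by (simp add: shape_blocks_def)
      then have "(?s * E s) * x * (E t * ?t) = 0" by (simp add: mult.assoc) (simp add: mult.assoc[symmetric])
      then show ?thesis by (simp add: idem_absorb s t)
    next
      case True
      then have "k \<noteq> l" using neq by (auto simp: maya_snoc)
      then have "a k \<noteq> a l" using inj_content by (simp add: inj_eq)
      have xN: "x \<in> A N" using x n A_N by auto
      have "sc (a k) * (?s * x * ?t) = (?s * Y (Suc n)) * x * ?t"
        by (simp only: top_eigen[OF s] mult.assoc)
      also have "\<dots> = ?s * x * (Y (Suc n) * ?t)" using Y_commute[OF x n(2)] by (metis mult.assoc)
      also have "\<dots> = (?s * x) * sc (a l) * ?t" by (simp only: top_eigen[OF t] mult.assoc)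
      also have "\<dots> = sc (a l) * (?s * x * ?t)"
        using sc_central[OF A_intros(4)[OF N(1) xN]] by (simp only: mult.assoc)
      finally show ?thesis using cancel_scalar \<open>a k \<noteq> a l\<close> N xN by (meson A_intros(4))
    qed
    have "x \<in> sandwich n" using A_sandwich[OF x n] .
    then show ?thesis
    proof (induction rule: sandwich.induct)
      case (add x y)
      then show ?case by (simp add: algebra_simps)
    next
      case (mid x y)
      have st: "E s \<in> A n" "E t \<in> A n" using E_An sD tD by auto
      have "?s * (E s * x * E r * g n * (E r' * (y * E t))) * ?t = 0"
        if r: "r \<in> std_seqs n" "r' \<in> std_seqs n" for r r'
      proof (cases "maya r = maya s \<and> maya r' = maya t")
        case False
        then have "E s * x * E r = 0 \<or> E r' * y * E t = 0"
          using good_facts(3) mid sD tD r by (metis shape_blocks_def)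
        moreover have "?s * (E s * x * E r * g n * (E r' * (y * E t))) * ?t
            = ?s * ((E s * x * E r) * g n * (E r' * y * E t)) * ?t"
          by (simp only: mult.assoc)
        ultimately show ?thesis by auto
      next
        case True
        obtain r0 u where ru: "r = r0 @ [u]" using r by (auto elim: std_seqs_snocE)
        obtain t0 v where rv: "r' = t0 @ [v]" using r by (auto elim: std_seqs_snocE)
        obtain m where m: "n = Suc m" using n by (cases n) auto
        have uv: "u \<in> addable (maya r0)" "v \<in> addable (maya t0)"
          using r by (auto simp: ru rv m snoc_in_std_seqs)
        show ?thesis
        proof (cases "r0 = t0")
          case False
          then have "E r * g n * E r' = 0" using mid_zero r unfolding ru rv by simp
          then have "?s * (E s * x * (E r * g n * E r') * (y * E t)) * ?t = 0" by simp
          then show ?thesis by (simp only: mult.assoc)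
        next
          case same: True
          define M where "M = ?s * (E s * x * E r * g n * (E r' * (y * E t))) * ?t"
          have w: "E s * x * E r \<in> A n" "E r' * (y * E t) \<in> A n"
            using st mid r E_An by (auto intro: A_intros)
          have gN: "g n \<in> A N" using n by (intro A_intros) auto
          have "E s * x * E r * g n * (E r' * (y * E t)) \<in> A N"
            using A_intros(4)[OF A_intros(4)[OF A_N[OF w(1)] gN] A_N[OF w(2)]] n by simp
          then have MN: "M \<in> A N" unfolding M_def using N A_intros(4) by blast
          have c: "Y n * (E r' * (y * E t)) = sc (a v) * (E r' * (y * E t))"
            "E s * x * E r * Y n = sc (a u) * (E s * x * E r)"
          proof -
            show "Y n * (E r' * (y * E t)) = sc (a v) * (E r' * (y * E t))"
              using Yn_eigen(1)[of t0 v] r by (simp add: rv mult.assoc[symmetric])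
            have "E s * x * E r * Y n = (E s * x) * sc (a u) * E r"
              using Yn_eigen(2)[of r0 u] r by (simp add: ru mult.assoc)
            also have "E s * x \<in> A N" using A_N[OF A_intros(4)[OF st(1) mid(1)]] n by simp
            then have "(E s * x) * sc (a u) * E r = sc (a u) * (E s * x * E r)"
              by (simp only: sc_central mult.assoc[symmetric])
            finally show "E s * x * E r * Y n = sc (a u) * (E s * x * E r)" .
          qed
          have z: "?s * (E s * x * E r * (E r' * (y * E t))) * ?t = 0"
            by (rule base[OF A_intros(4)[OF w]])
          have "sc (a k) * M = sc (a v) * M" "sc (a l) * M = sc (a u) * M"
            using top_sandwich[OF s t w c] z unfolding M_def by simp_all
          then have "M = 0 \<or> k = v \<and> l = u"
            using cancel_scalar[OF MN] inj_content by (metis injD)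
          \<comment> \<open>Otherwise the same two nodes would be added in opposite orders, which
            gives equal shapes.\<close>
          moreover have "\<not> (k = v \<and> l = u)"
          proof
            assume kl: "k = v \<and> l = u"
            have "maya (s @ [k]) = hop v (hop u (maya r0))" "maya (t @ [l]) = hop u (hop v (maya r0))"
              using True kl same by (simp_all add: ru rv maya_snoc)
            then show False
              using neq uv same addable_distant[of u "maya r0" v] hop_commute[of v u "maya r0"]
              by (cases "u = v") (auto simp: abs_minus_commute)
          qed
          ultimately show ?thesis by (simp add: M_def)
        qed
      qed
      then have "?s * (\<Sum>r\<in>std_seqs n. \<Sum>r'\<in>std_seqs n. E s * x * E r * g n * (E r' * (y * E t))) * ?t = 0"
        by (simp add: sum_distrib_left sum_distrib_right)
      then have "?s * (E s * x * g n * (y * E t)) * ?t = 0"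
        using mid_expand[of "E s * x" "y * E t"] mid st by (simp add: A_intros)
      then have "(?s * E s) * (x * g n * y) * (E t * ?t) = 0" by (simp only: mult.assoc)
      then show ?case by (simp add: idem_absorb s t)
    qed (use base in simp)
  qed
  then show ?thesis unfolding shape_blocks_def by (metis std_seqs_SucE)
qed

text \<open>Put \<open>corner_relation\<close> between two copies of the Lagrange polynomial:
  y_{n+1} becomes the scalar \<open>a k\<close> on both sides. The factor that \<open>?Q\<close>
  leaves behind is invertible because an addable content is not removable.\<close>

lemma rank_one_Suc: "rank_one (Suc n)"
proof -
  have "\<exists>c. E (s @ [k]) * x * E (s @ [k]) = sc c * E (s @ [k])"
    if s: "s @ [k] \<in> std_seqs (Suc n)" and x: "x \<in> A (Suc n)" for s k x
  proof -
    let ?s = "E (s @ [k])" and ?L = "ev (Suc n) (lagrange_poly a (addable (maya s)) k)"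
    let ?Q = "root_poly a (removable (maya s))"
    note sD = snocD[OF s]
    have N: "Suc n \<le> N" using n by simp
    have sN: "?s \<in> A N" using E_AN[OF s] .
    obtain p where p: "ev (Suc n) ?Q * (E s * x * E s) = ev (Suc n) p * E s"
      using corner_relation[OF sD(1) x] by blast
    have L1: "?s = ?L * E s" by (rule idem_snoc_left[OF s])
    have L2: "?s = E s * ?L" using sD(3) by (simp add: idem_snoc)
    have comm: "ev (Suc n) r * ?L = ?L * ev (Suc n) r" for r
      using ev_mult[OF N] by (metis mult.commute)
    have "sc (poly ?Q (a k)) * (?s * x * ?s) = (ev (Suc n) ?Q * ?s) * x * ?s"
      by (simp only: ev_top(1)[OF s] mult.assoc)
    also have "\<dots> = (ev (Suc n) ?Q * ?L) * (E s * x * ?s)" by (simp only: L1 mult.assoc)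
    also have "\<dots> = (?L * ev (Suc n) ?Q) * (E s * x * (E s * ?L))" by (simp only: comm L2)
    also have "\<dots> = ?L * (ev (Suc n) ?Q * (E s * x * E s)) * ?L" by (simp only: mult.assoc)
    also have "\<dots> = (?L * ev (Suc n) p) * (E s * ?L)" by (subst p) (simp only: mult.assoc)
    also have "\<dots> = ev (Suc n) p * (?L * (E s * E s) * ?L)"
      using E_idem[OF sD(1)] by (simp only: comm[symmetric] mult.assoc)
    also have "\<dots> = ev (Suc n) p * (?s * ?s)" by (subst L1, subst L2) (simp only: mult.assoc)
    also have "\<dots> = sc (poly p (a k)) * ?s"
      using orthogonal_Suc s by (simp add: orthogonal_def ev_top(1)[OF s])
    finally have e: "sc (poly ?Q (a k)) * (?s * x * ?s) = sc (poly p (a k)) * ?s" .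
    have "poly ?Q (a k) \<noteq> 0"
      using addable_removable[OF sD(2)] inj_content finite_removable[OF sD(1)]
      by (auto simp: poly_root_poly inj_eq)
    moreover have "?s * x * ?s \<in> A N" using sN A_N[OF x N] by (intro A_intros)
    moreover have "sc (inverse (poly ?Q (a k))) * (sc (poly ?Q (a k)) * (?s * x * ?s))
        = sc (inverse (poly ?Q (a k)) * poly p (a k)) * ?s"
      by (subst e) (simp only: sc_mult mult.assoc)
    moreover have "sc (inverse (poly ?Q (a k))) * (sc (poly ?Q (a k)) * (?s * x * ?s))
        = sc (inverse (poly ?Q (a k)) * poly ?Q (a k)) * (?s * x * ?s)"
      by (simp only: sc_mult mult.assoc)
    ultimately have "?s * x * ?s = sc (inverse (poly ?Q (a k)) * poly p (a k)) * ?s"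
      using unit_left[of "?s * x * ?s"] by simp
    then show ?thesis by blast
  qed
  then show ?thesis unfolding rank_one_def by (metis std_seqs_SucE)
qed

text \<open>Undoing the common last move gives equal shapes one level below, hence the same Lagrange
  factor for both sequences. It commutes with \<open>A n\<close>, so the witnesses of level n serve
  again.\<close>

lemma linked_same_last:
  assumes s: "s @ [k] \<in> std_seqs (Suc n)" and t: "t @ [k] \<in> std_seqs (Suc n)"
    and eq: "maya (s @ [k]) = maya (t @ [k])"
  shows "linked (Suc n) (s @ [k]) (t @ [k])"
proof -
  let ?L = "ev (Suc n) (lagrange_poly a (addable (maya s)) k)"
  note sD = snocD[OF s] and tD = snocD[OF t]
  have st: "maya s = maya t" using hop_cancel[OF sD(2) tD(2)] eq unfolding maya_snoc by blast
  then obtain v w where vw: "v \<in> A n" "w \<in> A n" "E s * v * E t * w * E s = E s"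
    using good_facts(5) sD tD by (metis shape_linked_def linked_def)
  have comm: "z * ?L = ?L * z" if "z \<in> A n" for z using ev_commute_A[OF that n(2)] by simp
  have L: "E (s @ [k]) = ?L * E s" "E (t @ [k]) = ?L * E t"
    using idem_snoc_left[OF s] idem_snoc_left[OF t] st by auto
  have z: "E s \<in> A n" "E t \<in> A n" using E_An sD tD by auto
  have left: "x * (?L * y) = ?L * (x * y)" if "x \<in> A n" for x y
    using comm[OF that] by (simp add: mult.assoc[symmetric])
  have "E (s @ [k]) * v * E (t @ [k]) * w * E (s @ [k]) = ?L * ?L * ?L * (E s * v * E t * w * E s)"
    by (simp only: L mult.assoc left[OF vw(1)] left[OF vw(2)] left[OF z(1)] left[OF z(2)])
  also have "\<dots> = ?L * ?L * ?L * (E s * E s)"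
    using E_idem[OF sD(1)] vw by simp
  also have "\<dots> = (?L * E s) * ((?L * E s) * (?L * E s))"
    using E_idem[OF sD(1)] by (simp only: mult.assoc left[OF z(1)])
  also have "\<dots> = E (s @ [k])"
    using orthogonal_Suc s by (simp add: L(1)[symmetric] orthogonal_def)
  finally show ?thesis unfolding linked_def using vw A_mono[of n "Suc n"] by auto
qed

text \<open>\<beta> is the diagonal coefficient of g_n for the contents of l, k in the last two
  places, and the quantity is the product of the two off-diagonal ones. By
  \<open>quadratic_factorization\<close> its vanishing would give a nonzero power of q equal to 1
  when k and l are not neighbours.\<close>

lemma exchange_scalar:
  assumes "\<bar>k - l\<bar> > 1"
  defines "\<beta> \<equiv> h * a k / (a k - a l)"
  shows "1 + h * \<beta> - \<beta> * \<beta> \<noteq> 0"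
proof
  assume z: "1 + h * \<beta> - \<beta> * \<beta> = 0"
  have kl: "a k - a l \<noteq> 0" using inj_content assms(1) by (auto simp: inj_eq)
  have "\<beta> * (a k - a l) = h * a k" using kl by (simp add: \<beta>_def)
  moreover have "(1 + h * \<beta> - \<beta> * \<beta>) * (a k - a l)^2
      = (a k - a l)^2 + h * (\<beta> * (a k - a l)) * (a k - a l) - (\<beta> * (a k - a l))^2"
    by (simp add: power2_eq_square algebra_simps)
  ultimately have "(1 + h * \<beta> - \<beta> * \<beta>) * (a k - a l)^2
      = (a k - a l)^2 + h * (h * a k) * (a k - a l) - (h * a k)^2"
    by (simp only:)
  also have "\<dots> = (a k - q^2 * a l) * (a k - inverse q^2 * a l)"
    using quadratic_factorization[of q "inverse q"] q_nonzero by simp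
  finally have "a k = q^2 * a l \<or> a k = inverse q^2 * a l" using z by auto
  moreover have "a k = q powi (2 * (k - l)) * a l" by (rule content_ratio)
  ultimately have "q powi (2 * (k - l)) = q^2 \<or> q powi (2 * (k - l)) = inverse q^2"
    using content_nonzero[of l] by auto
  moreover have "q powi (2 * (k - l)) = q powi (2 * (k - l) - 2) * q^2"
    using q_nonzero by (simp add: power_int_diff)
  moreover have "q powi (2 * (k - l)) = q powi (2 * (k - l) + 2) * inverse q^2"
  proof -
    have "q^2 * inverse q^2 = 1" using q_nonzero by (simp add: power_mult_distrib[symmetric])
    moreover have "q powi (2 * (k - l) + 2) = q powi (2 * (k - l)) * q^2"
      using q_nonzero by (subst power_int_add) auto
    ultimately show ?thesis by (simp only: mult.assoc mult_1_right)
  qed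
  ultimately have "q powi (2 * (k - l) - 2) = 1 \<or> q powi (2 * (k - l) + 2) = 1"
    using q_nonzero by auto
  moreover have "2 * (k - l) - 2 \<noteq> 0" "2 * (k - l) + 2 \<noteq> 0" using assms(1) by (auto simp: abs_if split: if_splits)
  ultimately show False using not_root_of_unity by blast
qed

text \<open>g_n^2 between two copies of \<open>?s\<close> is computed twice: by the quadratic
  relation, and by inserting the resolution of the unit between the generators, where only the two
  given sequences contribute. Comparison yields \<open>?s * g n * ?t * g n * ?s\<close> as a nonzero
  multiple of \<open>?s\<close>.\<close>

lemma linked_exchange:
  assumes s: "r @ [l, k] \<in> std_seqs (Suc n)" and t: "r @ [k, l] \<in> std_seqs (Suc n)" and d: "\<bar>k - l\<bar> > 1"
  shows "linked (Suc n) (r @ [l, k]) (r @ [k, l])"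
proof -
  let ?s = "E (r @ [l, k])" and ?t = "E (r @ [k, l])"
  define \<beta> where "\<beta> = h * a k / (a k - a l)"
  have kl: "a k \<noteq> a l" using inj_content d by (auto simp: inj_eq)
  have N: "Suc n \<le> N" using n by simp
  have s': "(r @ [l]) @ [k] \<in> std_seqs (Suc n)" using s by simp
  note sD = snocD[OF s']
  have sN: "?s \<in> A N" using E_AN[OF s] .
  have gA: "g n \<in> A (Suc n)" using n by (intro A_intros) auto
  have gN: "g n \<in> A N" using A_N[OF gA N] .
  have ss: "?s * ?s = ?s" using orthogonal_Suc s by (simp add: orthogonal_def)
  \<comment> \<open>One row of the matrix of g_n: the diagonal entry is \<beta>, and the only other
    entry that may be nonzero belongs to the transposed sequence.\<close>
  have eigen: "if u = r @ [l, k] then ?s * g n * E u = sc \<beta> * ?s else ?s * g n * E u = 0 \<or> u = r @ [k, l]"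
    if u: "u \<in> std_seqs (Suc n)" for u
  proof -
    obtain p j where pj: "u = p @ [j]" "p @ [j] \<in> std_seqs (Suc n)" using u std_seqs_SucE by metis
    note pD = snocD[OF pj(2)]
    obtain p0 i where p: "p = p0 @ [i]" using pD(1) by (auto elim: std_seqs_snocE)
    have ab: "?s * E (r @ [l]) = ?s" "E p * E u = E u"
      using idem_absorb(2)[OF s'] idem_absorb(1)[OF pj(2)] by (simp_all add: pj(1))
    have "?s * (E (r @ [l]) * g n * E p) * E u = (?s * E (r @ [l])) * g n * (E p * E u)"
      by (simp only: mult.assoc)
    then have M: "?s * (E (r @ [l]) * g n * E p) * E u = ?s * g n * E u" unfolding ab .
    have "?s * (E (r @ [l]) * E p) * E u = (?s * E (r @ [l])) * (E p * E u)"
      by (simp only: mult.assoc)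
    then have M2: "?s * (E (r @ [l]) * E p) * E u = ?s * E u" unfolding ab .
    show ?thesis
    proof (cases "p0 = r")
      case False
      then have "E (r @ [l]) * g n * E p = 0" using mid_zero[OF sD(1)] pD(1) by (simp add: p)
      then show ?thesis using M False by (simp add: pj(1) p)
    next
      case True
      have c: "Y n * E p = sc (a i) * E p" "E (r @ [l]) * Y n = sc (a l) * E (r @ [l])"
        using Yn_eigen pD(1) sD(1) by (simp_all add: p)
      have sh: "sc (a k) * (?s * g n * E u) = sc (a i) * (?s * g n * E u) + sc (h * a k) * (?s * E u)"
        "sc (a j) * (?s * g n * E u) = sc (a l) * (?s * g n * E u) + sc (h * a k) * (?s * E u)"
        using top_sandwich[OF s' pj(2) E_An[OF sD(1)] E_An[OF pD(1)] c] M M2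
        by (simp_all add: pj(1))
      have MN: "?s * g n * E u \<in> A N" by (intro A_intros(4) sN gN E_AN[OF u])
      show ?thesis
      proof (cases "u = r @ [l, k]")
        case False
        then have "?s * E u = 0" using orthogonal_Suc s u by (simp add: orthogonal_def)
        then have "?s * g n * E u = 0 \<or> k = i \<and> j = l"
          using sh cancel_scalar[OF MN] inj_content by simp (metis injD)
        then show ?thesis using True False by (auto simp: pj p)
      next
        case u': True
        then have "sc (a k) * (?s * g n * ?s) = sc (a l) * (?s * g n * ?s) + sc (h * a k) * ?s"
          using sh(2) ss pj(1) by simp
        then have "sc (a k - a l) * (?s * g n * ?s) = sc (h * a k) * ?s"
          by (simp add: sc_diff left_diff_distrib)
        then have "sc (inverse (a k - a l)) * (sc (a k - a l) * (?s * g n * ?s))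
            = sc (inverse (a k - a l)) * (sc (h * a k) * ?s)" by simp
        then have "sc (inverse (a k - a l) * (a k - a l)) * (?s * g n * ?s)
            = sc (inverse (a k - a l) * (h * a k)) * ?s"
          by (simp only: sc_mult mult.assoc)
        moreover have "inverse (a k - a l) * (h * a k) = \<beta>" "inverse (a k - a l) * (a k - a l) = 1"
          using kl by (simp_all add: \<beta>_def divide_inverse)
        ultimately have "?s * g n * ?s = sc \<beta> * ?s" using unit_left[OF MN] u' by simp
        then show ?thesis using u' by simp
      qed
    qed
  qed
  have st: "r @ [l, k] \<noteq> r @ [k, l]" using d by auto
  have "?s * (g n * g n) * ?s = ?s * sc 1 * ?s + ?s * sc h * g n * ?s"
    using n by (simp add: quadratic algebra_simps)
  also have "\<dots> = ?s * ?s + sc h * (?s * g n * ?s)"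
    by (subst unit_right[OF sN], subst sc_central[OF sN]) (simp only: mult.assoc)
  also have "\<dots> = sc (1 + h * \<beta>) * ?s"
    using eigen[OF s] ss unit_left[OF sN]
    by (simp add: sc_add sc_mult distrib_right mult.assoc)
  finally have 1: "?s * (g n * g n) * ?s = sc (1 + h * \<beta>) * ?s" .
  have S: "(\<Sum>u\<in>std_seqs (Suc n). E u) = sc 1" using eigen_complete_Suc by (simp add: eigen_complete_def)
  have "?s * (g n * g n) * ?s = ?s * g n * sc 1 * g n * ?s"
    using unit_right[OF gN] by (simp add: mult.assoc)
  also have "\<dots> = (\<Sum>u\<in>std_seqs (Suc n). ?s * g n * E u * g n * ?s)"
    by (simp add: S[symmetric] sum_distrib_left sum_distrib_right)
  also have "\<dots> = (\<Sum>u\<in>{r @ [l, k], r @ [k, l]}. ?s * g n * E u * g n * ?s)"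
  proof (rule sum.mono_neutral_right[OF finite_std_seqs])
    show "{r @ [l, k], r @ [k, l]} \<subseteq> std_seqs (Suc n)" using s t by simp
    show "\<forall>u\<in>std_seqs (Suc n) - {r @ [l, k], r @ [k, l]}. ?s * g n * E u * g n * ?s = 0"
    proof
      fix u assume "u \<in> std_seqs (Suc n) - {r @ [l, k], r @ [k, l]}"
      then have "?s * g n * E u = 0" using eigen[of u] by simp
      then show "?s * g n * E u * g n * ?s = 0" by simp
    qed
  qed
  also have "\<dots> = ?s * g n * ?s * g n * ?s + ?s * g n * ?t * g n * ?s"
    using st by simp
  also have "?s * g n * ?s * g n * ?s = sc (\<beta> * \<beta>) * ?s"
    using eigen[OF s] by (simp add: mult.assoc sc_mult)
  finally have 2: "?s * g n * ?t * g n * ?s = sc (1 + h * \<beta> - \<beta> * \<beta>) * ?s"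
    unfolding 1 sc_diff left_diff_distrib by (simp only: add_diff_cancel_left')
  let ?c = "1 + h * \<beta> - \<beta> * \<beta>"
  have "?c \<noteq> 0" using exchange_scalar[OF d] by (simp add: \<beta>_def)
  have tg: "?s * g n * ?t \<in> A N" by (intro A_intros(4) sN gN E_AN[OF t])
  have "?s * g n * ?t * (sc (inverse ?c) * g n) * ?s = (?s * g n * ?t) * sc (inverse ?c) * (g n * ?s)"
    by (simp only: mult.assoc)
  also have "\<dots> = sc (inverse ?c) * (?s * g n * ?t * g n * ?s)"
    by (subst sc_central[OF tg]) (simp only: mult.assoc)
  also have "\<dots> = sc (inverse ?c * ?c) * ?s" unfolding 2 by (simp only: sc_mult mult.assoc)
  also have "\<dots> = ?s" using \<open>?c \<noteq> 0\<close> unit_left[OF sN] by simp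
  finally show ?thesis unfolding linked_def using gA A_intros(1,4) by blast
qed

lemma shape_linked_Suc: "shape_linked (Suc n)"
proof -
  have "linked (Suc n) (s @ [k]) (t @ [l])"
    if s: "s @ [k] \<in> std_seqs (Suc n)" and t: "t @ [l] \<in> std_seqs (Suc n)"
      and eq: "maya (s @ [k]) = maya (t @ [l])" for s k t l
  proof (cases "k = l")
    case True
    then show ?thesis using linked_same_last s t eq by simp
  next
    case False
    then obtain r where r: "r @ [l, k] \<in> std_seqs (Suc n)" "r @ [k, l] \<in> std_seqs (Suc n)"
      "maya (r @ [l, k]) = maya (s @ [k])" "maya (r @ [k, l]) = maya (s @ [k])" "\<bar>k - l\<bar> > 1"
      using exchange_last_two[OF s t eq] by metis
    have "linked (Suc n) (s @ [k]) (r @ [l, k])"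
      using linked_same_last[of s k "r @ [l]"] s r by simp
    moreover have "linked (Suc n) (r @ [l, k]) (r @ [k, l])" using linked_exchange r by blast
    moreover have "linked (Suc n) (r @ [k, l]) (t @ [l])"
      using linked_same_last[of "r @ [k]" l t] t r eq by simp
    ultimately show ?thesis
      using linked_trans E_in_A' r(1,2) by (meson order_refl)
  qed
  then show ?thesis unfolding shape_linked_def by (metis std_seqs_SucE)
qed

lemma good_Suc: "good (Suc n)"
  unfolding good_def
  using good_facts(1) orthogonal_Suc eigen_complete_Suc shape_blocks_Suc rank_one_Suc shape_linked_Suc
  by (metis le_SucE)

end

text \<open>Level 1 is scalar: the only sequence is \<open>[0]\<close>, and the Lagrange polynomial
  for its single addable content is an empty product.\<close>

lemma good_1:
  assumes "1 \<le> N"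
  shows "good 1"
proof -
  have E: "E [0] = sc 1"
    using idem_snoc[of q sc g "[]" 0]
    by (simp add: maya_Nil addable_initial lagrange_poly_def idem_Nil ev_1 sc_mult[symmetric] del: jm.simps)
  have A: "\<exists>c. x = sc c" if "x \<in> A 1" for x
    using that by (induction rule: gen_alg.induct) (auto simp: sc_add[symmetric] sc_mult[symmetric])
  have ones: "sc 1 * sc 1 = sc 1" by (simp add: sc_mult[symmetric])
  have "a 0 = 1" by (simp add: content_def)
  have "orthogonal m" if "m \<le> 1" for m
  proof -
    consider "m = 0" | "m = 1" using \<open>m \<le> 1\<close> by linarith
    then show ?thesis
      by cases (simp_all add: orthogonal_def std_seqs_0 std_seqs_1 E idem_Nil ones)
  qed
  moreover have "eigen_complete 1"
    by (simp add: eigen_complete_def std_seqs_1 E ones \<open>a 0 = 1\<close>)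
  moreover have "shape_blocks 1" by (simp add: shape_blocks_def std_seqs_1)
  moreover have "rank_one 1"
    unfolding rank_one_def using A by (fastforce simp: std_seqs_1 E sc_mult[symmetric])
  moreover have "shape_linked 1"
    unfolding shape_linked_def linked_def
    by (auto simp: std_seqs_1 E ones intro!: bexI[of _ "sc 1"] A_intros)
  ultimately show ?thesis by (simp add: good_def)
qed

lemma good_all:
  assumes "1 \<le> n" "n \<le> N"
  shows "good n"
  using assms
proof (induction n rule: dec_induct)
  case base
  then show ?case using good_1 by simp
next
  case (step n)
  then show ?case using good_Suc by simp
qed

end

section \<open>Primitivity and uniqueness at the top level\<close>

context hecke_algebra
begin

lemma E_nonzero:
  assumes "s \<in> std_seqs N"
  shows "E s \<noteq> 0"
proof
  assume "E s = 0"
  obtain \<chi> where \<chi>: "\<chi> (sc 1) = (1 :: complex)"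
      "\<And>x y. x \<in> A N \<Longrightarrow> y \<in> A N \<Longrightarrow> \<chi> (x + y) = \<chi> x + \<chi> y"
      "\<And>x c. x \<in> A N \<Longrightarrow> \<chi> (sc c * x) = c * \<chi> x"
      "\<And>x i. x \<in> A N \<Longrightarrow> 1 \<le> i \<Longrightarrow> i \<le> N \<Longrightarrow> \<chi> (x * Y i) = a (s ! (i - 1)) * \<chi> x"
    using weight_functional[OF assms] by auto
  have "\<chi> (E s) = 1"
    using weight_functional_idem(2)[OF assms _ \<chi>, of N] length_std_seqs[OF assms] by simp
  moreover have "\<chi> 0 = 0" using \<chi>(3)[of 0 0] A_0 by simp
  ultimately show False using \<open>E s = 0\<close> by simp
qed

text \<open>Each Lagrange factor of \<open>E s\<close> takes the value 1 at the eigenvalue that f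
  has for its Jucys-Murphy element.\<close>

lemma E_absorbs_eigenvector:
  assumes s: "s \<in> std_seqs N" and f: "f \<in> A N"
  shows "(\<And>i. i \<in> {1..N} \<Longrightarrow> Y i * f = sc (a (s ! (i - 1))) * f) \<Longrightarrow> E s * f = f"
    and "(\<And>i. i \<in> {1..N} \<Longrightarrow> f * Y i = sc (a (s ! (i - 1))) * f) \<Longrightarrow> f * E s = f"
proof -
  have len: "length s = N" using s length_std_seqs by simp
  have step: "poly (lagrange_poly a (addable (maya (take m s))) (s ! m)) (a (s ! m)) = 1"
    and snoc: "E (take (Suc m) s) = E (take m s) * ev (Suc m) (lagrange_poly a (addable (maya (take m s))) (s ! m))"
    if m: "m < N" for m
  proof -
    have g: "grows {..0} (take m s @ s ! m # drop (Suc m) s)"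
      using s m len by (simp add: std_seqs_def id_take_nth_drop[symmetric])
    then have k: "s ! m \<in> addable (maya (take m s))"
      unfolding grows_append maya_def by simp
    have "take m s \<in> std_seqs m"
      using g m len unfolding std_seqs_def grows_append by simp
    from finite_addable[OF this] k
    show "poly (lagrange_poly a (addable (maya (take m s))) (s ! m)) (a (s ! m)) = 1"
      by (simp add: poly_lagrange inj_content)
    show "E (take (Suc m) s) = E (take m s) * ev (Suc m) (lagrange_poly a (addable (maya (take m s))) (s ! m))"
      using m len by (simp add: take_Suc_conv_app_nth idem_snoc min_def)
  qed
  {
    assume eig: "\<And>i. i \<in> {1..N} \<Longrightarrow> Y i * f = sc (a (s ! (i - 1))) * f"
    have "E (take m s) * f = f" if "m \<le> N" for m
      using that
    proof (induction m)
      case (Suc m)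
      then have "ev (Suc m) p * f = sc (poly p (a (s ! m))) * f" for p
        using eig[of "Suc m"] by (intro ev_eigen_left[OF f]) auto
      then have "ev (Suc m) (lagrange_poly a (addable (maya (take m s))) (s ! m)) * f = f"
        using step[of m] Suc.prems unit_left[OF f] by simp
      then show ?case using Suc snoc[of m] by (simp add: mult.assoc)
    qed (simp add: idem_Nil unit_left[OF f])
    from this[of N] show "E s * f = f" using len by simp
  }
  {
    assume eig: "\<And>i. i \<in> {1..N} \<Longrightarrow> f * Y i = sc (a (s ! (i - 1))) * f"
    have "f * E (take m s) = f" if "m \<le> N" for m
      using that
    proof (induction m)
      case (Suc m)
      then have "f * ev (Suc m) p = sc (poly p (a (s ! m))) * f" for p
        using eig[of "Suc m"] by (intro ev_eigen_right[OF f]) auto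
      then have "f * ev (Suc m) (lagrange_poly a (addable (maya (take m s))) (s ! m)) = f"
        using step[of m] Suc.prems unit_left[OF f] by simp
      then show ?case using Suc snoc[of m] by (simp add: mult.assoc[symmetric])
    qed (simp add: idem_Nil unit_right[OF f])
    from this[of N] show "f * E s = f" using len by simp
  }
qed

lemma E_eigen:
  assumes "1 \<le> N" "s \<in> std_seqs N" "i \<in> {1..N}"
  shows "Y i * E s = sc (a (s ! (i - 1))) * E s" "E s * Y i = sc (a (s ! (i - 1))) * E s"
proof -
  show "Y i * E s = sc (a (s ! (i - 1))) * E s"
    using good_all[OF assms(1) order_refl] assms by (simp add: good_def eigen_complete_def)
  then show "E s * Y i = sc (a (s ! (i - 1))) * E s"
    using Y_E[of i s] assms length_std_seqs by simp
qed

lemma E_idempotent: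
  assumes "1 \<le> N" "s \<in> std_seqs N"
  shows "E s * E s = E s"
  using good_all[OF assms(1) order_refl] assms unfolding good_def orthogonal_def by (metis order_refl)

text \<open>By \<open>rank_one\<close> such an f is a scalar multiple of \<open>E s\<close>, and the
  scalar satisfies c^2 = c. Both primitivity and uniqueness rest on this.\<close>

lemma idempotent_under_E:
  assumes "1 \<le> N" "s \<in> std_seqs N" "f \<in> A N" "f * f = f" "E s * f = f" "f * E s = f"
  shows "f = 0 \<or> f = E s"
proof -
  have "E s * f * E s = f" using assms by simp
  moreover obtain c where "E s * f * E s = sc c * E s"
    using good_all[OF assms(1) order_refl] assms unfolding good_def rank_one_def by blast
  ultimately have f: "f = sc c * E s" by simp
  have E: "E s \<in> A N" by (rule E_in_A'[OF assms(2) order_refl])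
  have "sc (c * c) * E s = sc c * (sc c * (E s * E s))"
    by (simp only: E_idempotent[OF assms(1,2)] sc_mult mult.assoc)
  also have "\<dots> = sc c * ((E s * sc c) * E s)" by (simp only: sc_central[OF E] mult.assoc)
  also have "\<dots> = sc c * E s" using assms(4) unfolding f by (simp only: mult.assoc)
  finally have "c * c = c"
    using E_nonzero[OF assms(2)] cancel_scalar[OF E] by blast
  then have "c = 0 \<or> c = 1" by simp
  then show ?thesis using f unit_left[OF E] by auto
qed

lemma E_unique:
  assumes "1 \<le> N" "s \<in> std_seqs N" "f \<in> A N" "f * f = f" "f \<noteq> 0"
    and "\<And>i. i \<in> {1..N} \<Longrightarrow> Y i * f = sc (a (s ! (i - 1))) * f"
    and "\<And>i. i \<in> {1..N} \<Longrightarrow> f * Y i = sc (a (s ! (i - 1))) * f"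
  shows "f = E s"
  using idempotent_under_E[OF assms(1-4)] E_absorbs_eigenvector[OF assms(2,3)] assms by blast

lemma E_primitive:
  assumes "1 \<le> N" "s \<in> std_seqs N" "f \<in> A N" "f' \<in> A N" "f * f = f" "f' * f' = f'"
    and "f * f' = 0" "f' * f = 0" "E s = f + f'"
  shows "f = 0 \<or> f' = 0"
proof -
  have "E s * f = f" "f * E s = f" using assms by (simp_all add: algebra_simps)
  from idempotent_under_E[OF assms(1-3) assms(5) this] show ?thesis using assms by auto
qed

lemma E_annihilated:
  assumes "1 \<le> n" "Suc n = N" "s \<in> std_seqs n"
  shows "E s * ev N (root_poly a (addable (maya s))) = 0"
proof -
  have "good n" using good_all assms by simp
  then have "ev (Suc n) (root_poly a (addable (maya s))) * E s = 0" using annihilated assms by auto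
  moreover have "E s \<in> A n" by (rule E_in_A'[OF assms(3) order_refl])
  ultimately show ?thesis using ev_commute_A[of "E s" n] assms by simp
qed

end

section \<open>The seminormal representation\<close>

text \<open>Forced by y_{i+1} \<sigma>_i = \<sigma>_i y_i + (q - 1/q) y_{i+1} when y_i and y_{i+1}
  act by the contents of x and y: comparing diagonal entries, (a_y - a_x) B = (q - 1/q) a_y.\<close>

definition diag_coeff :: "complex \<Rightarrow> int \<Rightarrow> int \<Rightarrow> complex"
  where "diag_coeff q x y = (q - inverse q) * content q y / (content q y - content q x)"

text \<open>The symmetric choice of the off-diagonal coefficient makes it vanish for neighbouring
  contents in either order, so that only standard sequences are coupled.\<close>

definition swap_coeff :: "complex \<Rightarrow> int \<Rightarrow> int \<Rightarrow> complex"
  where "swap_coeff q x y = csqrt (1 + diag_coeff q x y * diag_coeff q y x)"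

definition seminormal :: "complex \<Rightarrow> nat \<Rightarrow> (int list \<Rightarrow> complex) \<Rightarrow> int list \<Rightarrow> complex" where
  "seminormal q i \<psi> s = diag_coeff q (s ! (i - 1)) (s ! i) * \<psi> s +
     swap_coeff q (s ! (i - 1)) (s ! i) * \<psi> (s[i - 1 := s ! i, i := s ! (i - 1)])"

lemma seminormal_split:
  "seminormal q (Suc (length p)) \<psi> (p @ x # y # r) =
     diag_coeff q x y * \<psi> (p @ x # y # r) + swap_coeff q x y * \<psi> (p @ y # x # r)"
  by (simp add: seminormal_def nth_append list_update_append)

lemma swap_coeff_sym: "swap_coeff q y x = swap_coeff q x y"
  by (simp add: swap_coeff_def mult.commute)

lemma swap_coeff_square: "swap_coeff q x y * swap_coeff q x y = 1 + diag_coeff q x y * diag_coeff q y x"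
  unfolding swap_coeff_def by (metis power2_csqrt power2_eq_square)

section \<open>Young's form satisfies the Hecke relations\<close>

context generic_parameter
begin

abbreviation "B \<equiv> diag_coeff q"
abbreviation "C \<equiv> swap_coeff q"

lemma content_neq: "x \<noteq> y \<Longrightarrow> a x \<noteq> a y" "a x \<noteq> 0"
  by (simp_all add: inj_eq[OF inj_content] content_nonzero)

lemma diag_coeff_sum: "x \<noteq> y \<Longrightarrow> B y x = h - B x y"
proof -
  have "k * u / (u - v) = k - k * v / (v - u)" if "u \<noteq> v" for k u v :: complex
    using that by (simp add: divide_simps) (simp add: algebra_simps)
  then show "x \<noteq> y \<Longrightarrow> B y x = h - B x y"
    using content_neq(1)[of x y] unfolding diag_coeff_def by blast
qed

text \<open>A partial fraction identity for the differences a y - a x and a z - a y, whose sum is a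
  z - a x. The braid relation comes down to it.\<close>

lemma diag_coeff_cocycle:
  assumes "x \<noteq> y" "y \<noteq> z" "x \<noteq> z"
  shows "B x y * B y z = B x z * (B x y + B y z - h)"
proof -
  have "a x \<noteq> a y" "a y \<noteq> a z" "a x \<noteq> a z" using content_neq assms by auto
  then have n: "a y - a x \<noteq> 0" "a z - a y \<noteq> 0" "a z - a x \<noteq> 0" by auto
  have "(h * a y / (a y - a x)) * (h * a z / (a z - a y))
      = (h * a z / (a z - a x)) * (h * a y / (a y - a x) + h * a z / (a z - a y) - h)"
  proof -
    have *: "(k * Y / D1) * (k * Z / D2) = (k * Z / D3) * (k * Y / D1 + k * Z / D2 - k)"
      if "D1 \<noteq> 0" "D2 \<noteq> 0" "D3 = D1 + D2" "D3 \<noteq> 0" "Z = Y + D2" for k Y Z D1 D2 D3 :: complex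
    proof -
      have "k * Y / D1 + k * Z / D2 - k = k * Y * D3 / (D1 * D2)"
        using that(1,2) unfolding that(3,5) by (simp add: field_simps)
      then show ?thesis using that(1,2,4) by (simp add: field_simps)
    qed
    show ?thesis by (rule *) (use n in auto)
  qed
  then show ?thesis by (simp add: diag_coeff_def)
qed

text \<open>For contents with ratio q^2 the two diagonal entries are h q^2 / (q^2 - 1) = q and h /
  (1 - q^2) = -1/q, so the radicand is 0.\<close>

lemma swap_coeff_neighbour:
  assumes "\<bar>x - y\<bar> = 1"
  shows "C x y = 0"
proof -
  have up: "B z (z + 1) * B (z + 1) z = - 1" for z
  proof -
    have s: "a (z + 1) = q^2 * a z" using content_ratio[of "z + 1" z] by simp
    have "a (z + 1) \<noteq> a z" using content_neq by simp
    then have "q^2 \<noteq> 1" using s by auto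
    have "B z (z + 1) = h * q^2 / (q^2 - 1)" "B (z + 1) z = h / (1 - q^2)"
    proof -
      have "q^2 * a z - a z = (q^2 - 1) * a z" "a z - q^2 * a z = (1 - q^2) * a z"
        by (simp_all add: algebra_simps)
      then show "B z (z + 1) = h * q^2 / (q^2 - 1)" "B (z + 1) z = h / (1 - q^2)"
        using content_neq(2)[of z] by (simp_all only: diag_coeff_def s) (simp_all add: mult.assoc[symmetric])
    qed
    then have "B z (z + 1) * B (z + 1) z = (h * q) * (h * q) / ((q^2 - 1) * (1 - q^2))"
      by (simp only: times_divide_times_eq) (simp only: power2_eq_square ac_simps)
    also have "h * q = q^2 - 1" using q_nonzero by (simp add: field_simps power2_eq_square)
    also have "(q^2 - 1) * (q^2 - 1) / ((q^2 - 1) * (1 - q^2)) = - 1"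
      using \<open>q^2 \<noteq> 1\<close> by (simp add: divide_eq_eq)
    finally show ?thesis .
  qed
  have "y = x + 1 \<or> x = y + 1" using assms by linarith
  then have "B x y * B y x = - 1" using up by (auto simp: mult.commute)
  then show ?thesis by (simp add: swap_coeff_def)
qed

lemma std_seqs_adjacent:
  assumes "p @ x # y # r \<in> std_seqs N"
  shows "x \<noteq> y" and "\<bar>x - y\<bar> \<noteq> 1 \<Longrightarrow> p @ y # x # r \<in> std_seqs N"
proof -
  let ?X = "fold hop p {..0}"
  have g: "grows {..0} p" "x \<in> addable ?X" "y \<in> addable (hop x ?X)" "grows (hop y (hop x ?X)) r"
    and l: "length p + 2 + length r = N"
    using assms by (auto simp: std_seqs_def grows_append)
  show "x \<noteq> y" using g(2,3) by (auto simp: addable_def hop_def)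
  assume "\<bar>x - y\<bar> \<noteq> 1"
  with \<open>x \<noteq> y\<close> have d: "\<bar>x - y\<bar> > 1" "\<bar>y - x\<bar> > 1" by linarith+
  then show "p @ y # x # r \<in> std_seqs N"
    using g l addable_hop[OF d(1)] addable_hop[OF d(2)] hop_commute[OF d(1)]
    by (simp add: std_seqs_def grows_append)
qed

text \<open>The content x can recur only after a bead has come back to x and the one at x + 1 has
  left; that takes the two moves x - 1 and x + 1, but only y lies in between.\<close>

lemma std_seqs_triple:
  assumes "p @ x # y # z # r \<in> std_seqs N"
  shows "x \<noteq> y" "y \<noteq> z" "x \<noteq> z"
proof -
  show "x \<noteq> y" using std_seqs_adjacent(1)[OF assms] .
  show "y \<noteq> z" using std_seqs_adjacent(1)[of "p @ [x]" y z r N] assms by simp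
  let ?X = "fold hop p {..0}"
  have g: "x \<in> addable ?X" "y \<in> addable (hop x ?X)" "z \<in> addable (hop y (hop x ?X))"
    using assms by (auto simp: std_seqs_def grows_append)
  show "x \<noteq> z"
  proof
    assume "x = z"
    with g have "x \<in> hop y (hop x ?X)" "x + 1 \<notin> hop y (hop x ?X)" by (auto simp: addable_def)
    then show False by (auto simp: hop_def)
  qed
qed

lemma seminormal_quadratic:
  assumes "p @ x # y # r \<in> std_seqs N"
  defines "s \<equiv> p @ x # y # r" and "i \<equiv> Suc (length p)"
  shows "seminormal q i (seminormal q i \<psi>) s = \<psi> s + h * seminormal q i \<psi> s"
proof -
  have xy: "x \<noteq> y" using std_seqs_adjacent(1) assms(1) .
  have "seminormal q i (seminormal q i \<psi>) s
      = (B x y * B x y + C x y * C x y) * \<psi> s + C x y * (B x y + B y x) * \<psi> (p @ y # x # r)"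
    unfolding s_def i_def by (simp add: seminormal_split swap_coeff_sym[of q x y] algebra_simps)
  also have "\<dots> = \<psi> s + h * seminormal q i \<psi> s"
    unfolding s_def i_def swap_coeff_square
    by (simp add: seminormal_split diag_coeff_sum[OF xy] algebra_simps)
  finally show ?thesis .
qed

text \<open>Expanded over the six orders of x, y, z, the two sides visibly agree in the three orders
  that need two or three transpositions. The other three coefficients are forms of the cocycle
  identity, the one of the given order also using that the square of C is 1 + B (h - B).\<close>

lemma seminormal_braid:
  assumes "p @ x # y # z # r \<in> std_seqs N"
  defines "s \<equiv> p @ x # y # z # r" and "i \<equiv> Suc (length p)"
  shows "seminormal q i (seminormal q (i + 1) (seminormal q i \<psi>)) s
    = seminormal q (i + 1) (seminormal q i (seminormal q (i + 1) \<psi>)) s"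
proof -
  note d = std_seqs_triple[OF assms(1)]
  have s1: "seminormal q i \<psi> (p @ u # v # w # r) = B u v * \<psi> (p @ u # v # w # r) + C u v * \<psi> (p @ v # u # w # r)"
    for u v w \<psi> unfolding i_def by (rule seminormal_split)
  have s2: "seminormal q (i + 1) \<psi> (p @ u # v # w # r) = B v w * \<psi> (p @ u # v # w # r) + C v w * \<psi> (p @ u # w # v # r)"
    for u v w \<psi> unfolding i_def using seminormal_split[of q "p @ [u]" \<psi> v w r] by simp
  note cs = swap_coeff_sym[of q x y] swap_coeff_sym[of q y z] swap_coeff_sym[of q x z]
  let ?P = "\<lambda>u v w. \<psi> (p @ u # v # w # r)"
  have L: "seminormal q i (seminormal q (i + 1) (seminormal q i \<psi>)) s
    = (B x y * B y z * B x y + (C x y * C x y) * B x z) * ?P x y z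
      + C x y * (B x y * B y z + B x z * B y x) * ?P y x z
      + C y z * (B x y * B x z) * ?P x z y
      + C y z * C x z * B x y * ?P z x y
      + C x y * C x z * B y z * ?P y z x
      + C x y * C x z * C y z * ?P z y x"
    unfolding s_def s1 s2 cs by (simp add: algebra_simps)
  have R: "seminormal q (i + 1) (seminormal q i (seminormal q (i + 1) \<psi>)) s
    = (B y z * B x y * B y z + (C y z * C y z) * B x z) * ?P x y z
      + C x y * (B y z * B x z) * ?P y x z
      + C y z * (B y z * B x y + B x z * B z y) * ?P x z y
      + C y z * C x z * B x y * ?P z x y
      + C x y * C x z * B y z * ?P y z x
      + C x y * C x z * C y z * ?P z y x"
    unfolding s_def s1 s2 cs by (simp add: algebra_simps)
  define b c e where "b = B x y" and "c = B y z" and "e = B x z"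
  have co: "b * c = e * (b + c - h)" unfolding b_def c_def e_def by (rule diag_coeff_cocycle[OF d])
  have 1: "b * c * b + (1 + b * (h - b)) * e = c * b * c + (1 + c * (h - c)) * e"
  proof -
    have "b * c * b + (1 + b * (h - b)) * e - (c * b * c + (1 + c * (h - c)) * e)
        = (b - c) * (b * c) - (b - c) * (e * (b + c - h))" by (simp add: algebra_simps)
    then show ?thesis unfolding co by simp
  qed
  have 2: "b * c + e * (h - b) = c * e" and 3: "b * e = c * b + e * (h - c)"
    using co by (simp_all add: algebra_simps)
  show ?thesis unfolding L R swap_coeff_square diag_coeff_sum[OF d(1)] diag_coeff_sum[OF d(2)]
    b_def[symmetric] c_def[symmetric] e_def[symmetric] 1 2 3 by (rule refl)
qed

lemma seminormal_far:
  assumes "1 \<le> i" "i + 1 < j" "j < length s"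
  shows "seminormal q i (seminormal q j \<psi>) s = seminormal q j (seminormal q i \<psi>) s"
proof -
  let ?i = "\<lambda>s. s[i - 1 := s ! i, i := s ! (i - 1)]" and ?j = "\<lambda>s. s[j - 1 := s ! j, j := s ! (j - 1)]"
  have "?i (?j s) = ?j (?i s)"
    using assms by (intro nth_equalityI) (auto simp: nth_list_update)
  moreover have "?i s ! j = s ! j" "?i s ! (j - 1) = s ! (j - 1)" "?j s ! i = s ! i" "?j s ! (i - 1) = s ! (i - 1)"
    using assms by (auto simp: nth_list_update)
  ultimately show ?thesis by (simp add: seminormal_def algebra_simps)
qed

text \<open>Multiplication by the content of the entry \<open>i\<close> represents \<open>y\<^sub>i\<close>; this is the recursion
  \<open>y\<^sub>i\<^sub>+\<^sub>1 = \<sigma>\<^sub>i y\<^sub>i \<sigma>\<^sub>i\<close>.\<close>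

lemma seminormal_jm:
  assumes "p @ x # y # r \<in> std_seqs N"
  defines "s \<equiv> p @ x # y # r" and "i \<equiv> Suc (length p)"
  shows "seminormal q i (\<lambda>t. a (t ! (i - 1)) * seminormal q i \<psi> t) s = a y * \<psi> s"
proof -
  have xy: "x \<noteq> y" using std_seqs_adjacent(1) assms(1) .
  have n: "a y - a x \<noteq> 0" using content_neq(1)[of x y] xy by simp
  have B: "B x y * (a y - a x) = h * a y" using n by (simp add: diag_coeff_def)
  have "seminormal q i (\<lambda>t. a (t ! (i - 1)) * seminormal q i \<psi> t) s
      = (a x * (B x y * B x y) + a y * (C x y * C x y)) * \<psi> s
        + C x y * (a x * B x y + a y * B y x) * \<psi> (p @ y # x # r)"
    unfolding s_def i_def by (simp add: seminormal_split swap_coeff_sym[of q x y] algebra_simps)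
  also have "a x * B x y + a y * B y x = h * a y - B x y * (a y - a x)"
    unfolding diag_coeff_sum[OF xy] by (simp add: algebra_simps)
  also have "a x * (B x y * B x y) + a y * (C x y * C x y) = a y + B x y * (h * a y - B x y * (a y - a x))"
    unfolding swap_coeff_square diag_coeff_sum[OF xy] by (simp add: algebra_simps)
  finally show ?thesis unfolding B by simp
qed

end

section \<open>The quotient algebra\<close>

text \<open>The product of all rings carried by subsets of a type is a type of class \<^class>\<open>ring\<close> into
  which each of these rings embeds. This gives access to the arithmetic of the type class.\<close>

typedef 'b ring_family =
  "{F :: 'b ring \<Rightarrow> 'b. \<forall>R. if Ring.ring R then F R \<in> carrier R else F R = undefined}"
  by (rule exI[where x = "\<lambda>R. if Ring.ring R then \<zero>\<^bsub>R\<^esub> else undefined"])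
     (simp add: ring.ring_simprules)

setup_lifting type_definition_ring_family

instantiation ring_family :: (type) ring
begin

lift_definition zero_ring_family :: "'a ring_family"
  is "\<lambda>R. if Ring.ring R then \<zero>\<^bsub>R\<^esub> else undefined"
  by (simp add: ring.ring_simprules)

lift_definition plus_ring_family :: "'a ring_family \<Rightarrow> 'a ring_family \<Rightarrow> 'a ring_family"
  is "\<lambda>F G R. if Ring.ring R then F R \<oplus>\<^bsub>R\<^esub> G R else undefined"
  by (auto simp: ring.ring_simprules split: if_splits)

lift_definition uminus_ring_family :: "'a ring_family \<Rightarrow> 'a ring_family"
  is "\<lambda>F R. if Ring.ring R then \<ominus>\<^bsub>R\<^esub> F R else undefined"
  by (auto simp: ring.ring_simprules split: if_splits)

lift_definition times_ring_family :: "'a ring_family \<Rightarrow> 'a ring_family \<Rightarrow> 'a ring_family"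
  is "\<lambda>F G R. if Ring.ring R then F R \<otimes>\<^bsub>R\<^esub> G R else undefined"
  by (auto simp: ring.ring_simprules split: if_splits)

definition minus_ring_family :: "'a ring_family \<Rightarrow> 'a ring_family \<Rightarrow> 'a ring_family"
  where "minus_ring_family F G = F + - G"

instance
proof
  fix a b c :: "'a ring_family"
  show "a + b + c = a + (b + c)" by transfer (auto simp: fun_eq_iff ring.ring_simprules split: if_splits)
  show "a + b = b + a" by transfer (auto simp: fun_eq_iff ring.ring_simprules split: if_splits)
  show "0 + a = a" by transfer (auto simp: fun_eq_iff ring.ring_simprules split: if_splits)
  show "- a + a = 0" by transfer (auto simp: fun_eq_iff ring.ring_simprules split: if_splits)
  show "a - b = a + - b" by (rule minus_ring_family_def)
  show "a * b * c = a * (b * c)" by transfer (auto simp: fun_eq_iff ring.ring_simprules split: if_splits)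
  show "(a + b) * c = a * c + b * c" by transfer (auto simp: fun_eq_iff ring.ring_simprules split: if_splits)
  show "a * (b + c) = a * b + a * c" by transfer (auto simp: fun_eq_iff ring.ring_simprules split: if_splits)
qed

end

lift_definition component :: "'b ring \<Rightarrow> 'b ring_family \<Rightarrow> 'b" is "\<lambda>R F. F R" .

text \<open>Zero at every other ring, so that sums and products stay in one component. The unit of R
  becomes only an idempotent of the family, which is why the abstract algebra works with
  \<open>sc 1\<close>.\<close>

definition embed :: "'b ring \<Rightarrow> 'b \<Rightarrow> 'b ring_family" where
  "embed R x = Abs_ring_family (\<lambda>S. if S = R then x else if Ring.ring S then \<zero>\<^bsub>S\<^esub> else undefined)"

context
  fixes R :: "'b ring" assumes R: "Ring.ring R"
begin

lemma Rep_embed: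
  assumes "x \<in> carrier R"
  shows "Rep_ring_family (embed R x) = (\<lambda>S. if S = R then x else if Ring.ring S then \<zero>\<^bsub>S\<^esub> else undefined)"
  unfolding embed_def using assms R by (intro Abs_ring_family_inverse) (auto simp: ring.ring_simprules)

lemma component_embed: "x \<in> carrier R \<Longrightarrow> component R (embed R x) = x"
  by (simp add: component.rep_eq Rep_embed)

lemma embed_inj: "x \<in> carrier R \<Longrightarrow> y \<in> carrier R \<Longrightarrow> embed R x = embed R y \<longleftrightarrow> x = y"
  using component_embed by metis

lemma embed_add:
  assumes "x \<in> carrier R" "y \<in> carrier R"
  shows "embed R (x \<oplus>\<^bsub>R\<^esub> y) = embed R x + embed R y"
  using assms R
  by (auto simp: Rep_ring_family_inject[symmetric] plus_ring_family.rep_eq Rep_embed fun_eq_iff ring.ring_simprules)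

lemma embed_mult:
  assumes "x \<in> carrier R" "y \<in> carrier R"
  shows "embed R (x \<otimes>\<^bsub>R\<^esub> y) = embed R x * embed R y"
  using assms R
  by (auto simp: Rep_ring_family_inject[symmetric] times_ring_family.rep_eq Rep_embed fun_eq_iff ring.ring_simprules)

lemma embed_zero: "embed R \<zero>\<^bsub>R\<^esub> = 0"
  using R
  by (auto simp: Rep_ring_family_inject[symmetric] zero_ring_family.rep_eq Rep_embed fun_eq_iff ring.ring_simprules)

end

section \<open>The free algebra and its action on functions of sequences\<close>

lemma poly_mapping_single_induct:
  fixes f :: "'k \<Rightarrow>\<^sub>0 'c::comm_monoid_add"
  assumes "\<And>k c. k \<in> Poly_Mapping.keys f \<Longrightarrow> P (Poly_Mapping.single k c)" and "P 0"
    and "\<And>f g. P f \<Longrightarrow> P g \<Longrightarrow> P (f + g)"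
  shows "P f"
proof -
  have f: "f = (\<Sum>k\<in>Poly_Mapping.keys f. Poly_Mapping.single k (Poly_Mapping.lookup f k))"
    by (rule poly_mapping_eqI)
       (auto simp: lookup_sum lookup_single when_def in_keys_iff sum.If_cases Int_def intro!: sum.neutral)
  have "P (\<Sum>k\<in>K. Poly_Mapping.single k (Poly_Mapping.lookup f k))" if "K \<subseteq> Poly_Mapping.keys f" for K
    using finite_subset[OF that finite_keys] that
    by (induction K rule: finite_induct) (auto simp: assms)
  then show ?thesis using f by (metis order_refl)
qed

text \<open>The linear extension of words acting as composed operators; with \<open>foldr\<close>
  the last letter acts first, so products act as compositions.\<close>

definition free_act :: "complex \<Rightarrow> free_elt \<Rightarrow> (int list \<Rightarrow> complex) \<Rightarrow> int list \<Rightarrow> complex" where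
  "free_act q f \<psi> s = (\<Sum>w\<in>Poly_Mapping.keys f.
     Poly_Mapping.lookup f w * foldr (seminormal q) (letters w) \<psi> s)"

lemma free_act_superset:
  assumes "finite K" "Poly_Mapping.keys f \<subseteq> K"
  shows "free_act q f \<psi> s = (\<Sum>w\<in>K. Poly_Mapping.lookup f w * foldr (seminormal q) (letters w) \<psi> s)"
  unfolding free_act_def using assms by (intro sum.mono_neutral_left) (auto simp: in_keys_iff)

lemma free_act_add: "free_act q (f + g) \<psi> s = free_act q f \<psi> s + free_act q g \<psi> s"
proof -
  let ?K = "Poly_Mapping.keys f \<union> Poly_Mapping.keys g"
  have "finite ?K" by simp
  then show ?thesis using keys_add[of f g]
    by (simp add: free_act_superset[of ?K] lookup_add distrib_right sum.distrib)
qed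

lemma free_act_single:
  "free_act q (Poly_Mapping.single w c) \<psi> s = c * foldr (seminormal q) (letters w) \<psi> s"
  by (simp add: free_act_superset[of "{w}"])

lemma free_act_zero: "free_act q 0 \<psi> s = 0"
  by (simp add: free_act_def)

lemma free_act_minus: "free_act q (f - g) \<psi> s = free_act q f \<psi> s - free_act q g \<psi> s"
  using free_act_add[of q "f - g" g \<psi> s] by simp

lemma foldr_seminormal_linear:
  "foldr (seminormal q) w (\<lambda>s. c * \<psi> s + \<psi>' s) =
    (\<lambda>s. c * foldr (seminormal q) w \<psi> s + foldr (seminormal q) w \<psi>' s)"
  by (induction w) (auto simp: seminormal_def fun_eq_iff algebra_simps)

lemma foldr_seminormal_zero: "foldr (seminormal q) w (\<lambda>s. 0) = (\<lambda>s. 0)"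
  by (induction w) (auto simp: seminormal_def fun_eq_iff)

lemma free_act_mult: "free_act q (f * g) \<psi> s = free_act q f (free_act q g \<psi>) s"
proof (induction f rule: poly_mapping_single_induct)
  case (1 w c)
  show ?case
  proof (induction g rule: poly_mapping_single_induct)
    case (1 v d)
    have "foldr (seminormal q) (letters w) (\<lambda>s. d * foldr (seminormal q) (letters v) \<psi> s + 0) s
        = d * foldr (seminormal q) (letters w) (foldr (seminormal q) (letters v) \<psi>) s"
      unfolding foldr_seminormal_linear foldr_seminormal_zero by simp
    then show ?case
      by (simp add: mult_single free_act_single plus_hword_def free_act_single[abs_def])
  next
    case (3 f g)
    have "foldr (seminormal q) (letters w) (\<lambda>s. 1 * free_act q f \<psi> s + free_act q g \<psi> s) s
        = foldr (seminormal q) (letters w) (free_act q f \<psi>) s + foldr (seminormal q) (letters w) (free_act q g \<psi>) s"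
      unfolding foldr_seminormal_linear by simp
    with 3 show ?case
      by (simp add: distrib_left free_act_add free_act_single free_act_add[abs_def])
  qed (simp add: free_act_zero[abs_def] free_act_zero free_act_single foldr_seminormal_zero)
next
  case (3 f g)
  then show ?case by (simp add: distrib_right free_act_add)
qed (simp add: free_act_zero)

lemma free_act_fgen: "free_act q (fgen i) = seminormal q i"
  by (intro ext) (simp add: fgen_def free_act_single)

lemma free_act_fscal: "free_act q (fscal c) = (\<lambda>\<psi> s. c * \<psi> s)"
  by (intro ext) (simp add: fscal_def free_act_single zero_hword_def)

lemma one_free_elt: "(1 :: free_elt) = fscal 1"
  by (simp add: fscal_def)

lemma fscal_add: "fscal (c + d) = fscal c + fscal d"
  and fscal_mult: "fscal (c * d) = fscal c * fscal d"
  by (simp_all add: fscal_def single_add mult_single)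

lemma fscal_central: "f * fscal c = fscal c * f"
  by (induction f rule: poly_mapping_single_induct) (simp_all add: fscal_def mult_single mult.commute algebra_simps)

text \<open>The annihilator of the coordinates at standard sequences. Elsewhere the Hecke relations
  may fail, for instance at lists with two equal adjacent entries.\<close>

definition vanishing :: "complex \<Rightarrow> nat \<Rightarrow> free_elt set" where
  "vanishing q N = {f \<in> carrier (free_alg N). \<forall>\<psi>. \<forall>s\<in>std_seqs N. free_act q f \<psi> s = 0}"

lemma in_free_alg: "f \<in> carrier (free_alg n) \<longleftrightarrow> (\<forall>w\<in>Poly_Mapping.keys f. set (letters w) \<subseteq> {1..<n})"
  by (simp add: free_alg_def)

lemma free_alg_ops:
  "monoid.mult (free_alg n) = (*)" "one (free_alg n) = 1" "ring.zero (free_alg n) = 0" "add (free_alg n) = (+)"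
  by (simp_all add: free_alg_def)

lemma free_alg_closed:
  shows "fscal c \<in> carrier (free_alg n)"
    and "i \<in> {1..<n} \<Longrightarrow> fgen i \<in> carrier (free_alg n)"
    and "f \<in> carrier (free_alg n) \<Longrightarrow> g \<in> carrier (free_alg n) \<Longrightarrow> f + g \<in> carrier (free_alg n)"
    and "f \<in> carrier (free_alg n) \<Longrightarrow> g \<in> carrier (free_alg n) \<Longrightarrow> f * g \<in> carrier (free_alg n)"
    and "f \<in> carrier (free_alg n) \<Longrightarrow> - f \<in> carrier (free_alg n)"
    and "f \<in> carrier (free_alg n) \<Longrightarrow> g \<in> carrier (free_alg n) \<Longrightarrow> f - g \<in> carrier (free_alg n)"
    and "0 \<in> carrier (free_alg n)" "1 \<in> carrier (free_alg n)"
proof -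
  show "fscal c \<in> carrier (free_alg n)" by (auto simp: in_free_alg fscal_def zero_hword_def)
  show "i \<in> {1..<n} \<Longrightarrow> fgen i \<in> carrier (free_alg n)" by (auto simp: in_free_alg fgen_def)
  show "f \<in> carrier (free_alg n) \<Longrightarrow> g \<in> carrier (free_alg n) \<Longrightarrow> f + g \<in> carrier (free_alg n)"
    using keys_add[of f g] unfolding in_free_alg by blast
  show "f \<in> carrier (free_alg n) \<Longrightarrow> g \<in> carrier (free_alg n) \<Longrightarrow> f * g \<in> carrier (free_alg n)"
    using keys_mult[of f g] unfolding in_free_alg by (fastforce simp: plus_hword_def)
  show m: "f \<in> carrier (free_alg n) \<Longrightarrow> - f \<in> carrier (free_alg n)" for f
    unfolding in_free_alg by simp
  show "f \<in> carrier (free_alg n) \<Longrightarrow> g \<in> carrier (free_alg n) \<Longrightarrow> f - g \<in> carrier (free_alg n)"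
    using keys_diff[of f g] unfolding in_free_alg by blast
  show "0 \<in> carrier (free_alg n)" "1 \<in> carrier (free_alg n)"
    by (auto simp: in_free_alg zero_hword_def)
qed

lemma free_alg_ring: "Ring.ring (free_alg n)"
proof (rule ringI)
  show "abelian_group (free_alg n)"
    by (rule abelian_groupI) (auto simp: free_alg_ops free_alg_closed algebra_simps
        intro: bexI[of _ "- x" for x])
  show "monoid (free_alg n)"
    by (rule monoidI) (auto simp: free_alg_ops free_alg_closed algebra_simps)
qed (auto simp: free_alg_ops algebra_simps)

lemma free_alg_neg:
  assumes "f \<in> carrier (free_alg n)"
  shows "\<ominus>\<^bsub>free_alg n\<^esub> f = - f"
proof (rule abelian_group.minus_equality)
  show "abelian_group (free_alg n)" using free_alg_ring by (rule ring.is_abelian_group)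
  show "- f \<oplus>\<^bsub>free_alg n\<^esub> f = \<zero>\<^bsub>free_alg n\<^esub>" by (simp add: free_alg_ops)
qed (use assms in \<open>simp_all add: free_alg_closed\<close>)

lemma free_alg_mono: "n \<le> m \<Longrightarrow> carrier (free_alg n) \<subseteq> carrier (free_alg m)"
  by (fastforce simp: in_free_alg)

lemma free_alg_generated: "carrier (free_alg n) = gen_alg fscal fgen n"
proof
  show "gen_alg fscal fgen n \<subseteq> carrier (free_alg n)"
  proof
    fix f assume "f \<in> gen_alg fscal fgen n"
    then show "f \<in> carrier (free_alg n)"
      by (induction rule: gen_alg.induct) (auto intro: free_alg_closed)
  qed
  show "carrier (free_alg n) \<subseteq> gen_alg fscal fgen n"
  proof
    fix f assume f: "f \<in> carrier (free_alg n)"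
    show "f \<in> gen_alg fscal fgen n"
    proof (induction f rule: poly_mapping_single_induct)
      case (1 w c)
      have word: "Poly_Mapping.single (Word u) 1 \<in> gen_alg fscal fgen n" if "set u \<subseteq> {1..<n}" for u
        using that
      proof (induction u)
        case Nil
        have "Poly_Mapping.single (Word []) (1 :: complex) = fscal 1"
          by (simp add: fscal_def zero_hword_def)
        then show ?case using gen_alg.scalar by metis
      next
        case (Cons i u)
        have "Poly_Mapping.single (Word (i # u)) (1 :: complex) = fgen i * Poly_Mapping.single (Word u) 1"
          by (simp add: fgen_def mult_single plus_hword_def)
        moreover have "fgen i \<in> gen_alg fscal fgen n" using Cons by (intro gen_alg.gen) auto
        ultimately show ?case using Cons by (auto intro: gen_alg.mult)
      qed
      have "Poly_Mapping.single w c = fscal c * Poly_Mapping.single (Word (letters w)) 1"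
        by (simp add: fscal_def mult_single)
      moreover have "Poly_Mapping.single (Word (letters w)) 1 \<in> gen_alg fscal fgen n"
        using word 1 f unfolding in_free_alg by blast
      ultimately show ?case using gen_alg.mult gen_alg.scalar by metis
    next
      case 2
      have "(0 :: free_elt) = fscal 0" by (simp add: fscal_def)
      then show ?case using gen_alg.scalar by metis
    qed (rule gen_alg.add)
  qed
qed

context generic_parameter
begin

lemma split_at_pair:
  assumes "s \<in> std_seqs N" "1 \<le> i" "i < N"
  obtains p x y r where "s = p @ x # y # r" "i = Suc (length p)"
proof -
  have len: "length s = N" using assms(1) by (rule length_std_seqs)
  obtain m where m: "i = Suc m" using assms(2) by (cases i) auto
  have "s = take m s @ s ! m # drop (Suc m) s"
    using id_take_nth_drop[of m s] assms(3) len m by simp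
  moreover have "drop (Suc m) s = s ! Suc m # drop (Suc (Suc m)) s"
    using Cons_nth_drop_Suc[of "Suc m" s] assms(3) len m by simp
  ultimately have "s = take m s @ s ! m # s ! Suc m # drop (Suc (Suc m)) s" by simp
  then show thesis using that[of "take m s"] assms(3) len m by simp
qed

text \<open>Exchanging two entries leaves the standard sequences only if they are neighbours, and
  then the coefficient is 0. So the functions that vanish on standard sequences form an invariant
  subspace, the quotient by it is the seminormal module proper, and \<open>vanishing\<close> is
  closed under multiplication from the left.\<close>

lemma seminormal_vanish:
  assumes "\<And>s. s \<in> std_seqs N \<Longrightarrow> \<psi> s = 0" "1 \<le> i" "i < N" "s \<in> std_seqs N"
  shows "seminormal q i \<psi> s = 0"
proof -
  obtain p x y r where s: "s = p @ x # y # r" "i = Suc (length p)"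
    using split_at_pair assms(2-4) by metis
  have "C x y = 0 \<or> p @ y # x # r \<in> std_seqs N"
    using std_seqs_adjacent(2)[of p x y r N] swap_coeff_neighbour assms(4) s by blast
  then show ?thesis using assms(1,4) unfolding s seminormal_split by auto
qed

lemma foldr_vanish:
  assumes "\<And>s. s \<in> std_seqs N \<Longrightarrow> \<psi> s = 0" "set w \<subseteq> {1..<N}" "s \<in> std_seqs N"
  shows "foldr (seminormal q) w \<psi> s = 0"
  using assms(2,3)
proof (induction w arbitrary: s)
  case (Cons i w)
  then show ?case using seminormal_vanish[of N "foldr (seminormal q) w \<psi>" i s] by simp
qed (simp add: assms)

lemma free_act_vanish:
  assumes "f \<in> carrier (free_alg N)" "\<And>s. s \<in> std_seqs N \<Longrightarrow> \<psi> s = 0" "s \<in> std_seqs N"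
  shows "free_act q f \<psi> s = 0"
  unfolding free_act_def using assms foldr_vanish[of N \<psi>] by (intro sum.neutral) (auto simp: in_free_alg)

lemma free_act_cong:
  assumes "f \<in> carrier (free_alg N)" "\<And>s. s \<in> std_seqs N \<Longrightarrow> \<psi> s = \<psi>' s" "s \<in> std_seqs N"
  shows "free_act q f \<psi> s = free_act q f \<psi>' s"
proof -
  have "free_act q f (\<lambda>s. (- 1) * \<psi>' s + \<psi> s) s = 0"
    using assms by (intro free_act_vanish) auto
  moreover have "free_act q f (\<lambda>s. (- 1) * \<psi>' s + \<psi> s) s = free_act q f \<psi> s - free_act q f \<psi>' s"
    unfolding free_act_def foldr_seminormal_linear by (simp add: sum_subtractf right_diff_distrib)
  ultimately show ?thesis by simp
qed

lemma hecke_rels_vanishing: "hecke_rels q N \<subseteq> vanishing q N"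
proof
  fix f assume f: "f \<in> hecke_rels q N"
  have act: "free_act q f \<psi> s = 0" if s: "s \<in> std_seqs N" for \<psi> s
  proof -
    have len: "length s = N" using length_std_seqs[OF s] .
    consider (b) i where "1 \<le> i" "i + 1 < N"
        "f = fgen i * fgen (i + 1) * fgen i - fgen (i + 1) * fgen i * fgen (i + 1)"
      | (c) i j where "i \<in> {1..<N}" "j \<in> {1..<N}" "\<bar>int i - int j\<bar> > 1" "f = fgen i * fgen j - fgen j * fgen i"
      | (d) i where "i \<in> {1..<N}" "f = fgen i * fgen i - 1 - fscal (q - inverse q) * fgen i"
      using f unfolding hecke_rels_def by blast
    then show ?thesis
    proof cases
      case b
      have "i < N" using b by simp
      obtain p x y r where pxy: "s = p @ x # y # r" "i = Suc (length p)"
        by (rule split_at_pair[OF s b(1) \<open>i < N\<close>])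
      with b len obtain z r' where "r = z # r'" by (cases r) auto
      then have "seminormal q i (seminormal q (i + 1) (seminormal q i \<psi>)) s
          = seminormal q (i + 1) (seminormal q i (seminormal q (i + 1) \<psi>)) s"
        using seminormal_braid[of p x y z r' N \<psi>] s pxy by simp
      then show ?thesis unfolding b by (simp add: free_act_minus free_act_mult free_act_fgen)
    next
      case c
      then consider "i + 1 < j" | "j + 1 < i" by linarith
      then have "seminormal q i (seminormal q j \<psi>) s = seminormal q j (seminormal q i \<psi>) s"
        using seminormal_far[of i j s \<psi>] seminormal_far[of j i s \<psi>] c len by cases auto
      then show ?thesis unfolding c by (simp add: free_act_minus free_act_mult free_act_fgen)
    next
      case d
      have "1 \<le> i" "i < N" using d by auto
      obtain p x y r where "s = p @ x # y # r" "i = Suc (length p)"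
        by (rule split_at_pair[OF s \<open>1 \<le> i\<close> \<open>i < N\<close>])
      then have "seminormal q i (seminormal q i \<psi>) s = \<psi> s + h * seminormal q i \<psi> s"
        using seminormal_quadratic s by simp
      then show ?thesis unfolding d
        by (simp add: free_act_minus free_act_mult free_act_fgen free_act_fscal one_free_elt)
    qed
  qed
  have "f \<in> carrier (free_alg N)"
    using f unfolding hecke_rels_def by (auto intro!: free_alg_closed)
  then show "f \<in> vanishing q N" using act by (simp add: vanishing_def)
qed

lemma vanishing_ideal: "ideal (vanishing q N) (free_alg N)"
proof (rule idealI[OF free_alg_ring])
  show "subgroup (vanishing q N) (add_monoid (free_alg N))"
  proof
    fix f assume f: "f \<in> vanishing q N"
    then have "inv\<^bsub>add_monoid (free_alg N)\<^esub> f = - f"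
      using free_alg_neg[of f N] by (simp add: a_inv_def vanishing_def)
    moreover have "0 - f \<in> vanishing q N"
      using f free_alg_closed(5)[of f N] free_act_minus[of q 0 f] by (simp add: vanishing_def free_act_zero)
    ultimately show "inv\<^bsub>add_monoid (free_alg N)\<^esub> f \<in> vanishing q N" by simp
  qed (auto simp: vanishing_def free_alg_ops free_alg_closed free_act_add free_act_zero)
  fix f g assume fg: "f \<in> vanishing q N" "g \<in> carrier (free_alg N)"
  show "g \<otimes>\<^bsub>free_alg N\<^esub> f \<in> vanishing q N" "f \<otimes>\<^bsub>free_alg N\<^esub> g \<in> vanishing q N"
    using fg by (auto simp: vanishing_def free_alg_ops free_alg_closed free_act_mult intro: free_act_vanish)
qed

lemma hecke_ideal_vanishing: "hecke_ideal q N \<subseteq> vanishing q N"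
  unfolding hecke_ideal_def
  by (rule ring.genideal_minimal[OF free_alg_ring vanishing_ideal hecke_rels_vanishing])

lemma free_act_jm:
  assumes "1 \<le> i" "i \<le> N" "s \<in> std_seqs N"
  shows "free_act q (jm fscal fgen i) \<psi> s = a (s ! (i - 1)) * \<psi> s"
  using assms
proof (induction i arbitrary: \<psi> s rule: dec_induct)
  case base
  then have "s \<noteq> []" using length_std_seqs[OF base(2)] by auto
  then obtain k r where "s = k # r" by (cases s) auto
  then have "s ! 0 = 0" using base(2) by (simp add: std_seqs_def addable_initial)
  then show ?case by (simp add: free_act_fscal content_def)
next
  case (step i)
  obtain p x y r where s: "s = p @ x # y # r" "i = Suc (length p)"
    by (rule split_at_pair[of s N i]) (use step in auto)
  have "free_act q (jm fscal fgen (Suc i)) \<psi> s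
      = seminormal q i (free_act q (jm fscal fgen i) (seminormal q i \<psi>)) s"
    using step(1) by (cases i) (auto simp: free_act_mult free_act_fgen)
  also have "\<dots> = free_act q (fgen i) (free_act q (jm fscal fgen i) (seminormal q i \<psi>)) s"
    by (simp add: free_act_fgen)
  \<comment> \<open>The induction hypothesis speaks of standard sequences only;
    \<open>free_act_cong\<close> allows its use under the outer generator.\<close>
  also have "\<dots> = free_act q (fgen i) (\<lambda>t. a (t ! (i - 1)) * seminormal q i \<psi> t) s"
    using step by (intro free_act_cong[of _ N] free_alg_closed) auto
  also have "\<dots> = a (s ! i) * \<psi> s"
    using seminormal_jm[of p x y r N \<psi>] step.prems s by (simp add: free_act_fgen nth_append)
  finally show ?case by simp
qed

end

section \<open>Transport along homomorphisms of generated algebras\<close>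

context
  fixes \<phi> :: "'a::ring \<Rightarrow> 'b::ring" and sc :: "complex \<Rightarrow> 'a" and g :: "nat \<Rightarrow> 'a" and n :: nat
  assumes hom_add: "x \<in> gen_alg sc g n \<Longrightarrow> y \<in> gen_alg sc g n \<Longrightarrow> \<phi> (x + y) = \<phi> x + \<phi> y"
    and hom_mult: "x \<in> gen_alg sc g n \<Longrightarrow> y \<in> gen_alg sc g n \<Longrightarrow> \<phi> (x * y) = \<phi> x * \<phi> y"
    and hom_0: "sc 0 = 0" "\<phi> 0 = 0"
begin

lemma gen_alg_image: "gen_alg (\<lambda>c. \<phi> (sc c)) (\<lambda>i. \<phi> (g i)) n = \<phi> ` gen_alg sc g n"
proof
  show "gen_alg (\<lambda>c. \<phi> (sc c)) (\<lambda>i. \<phi> (g i)) n \<subseteq> \<phi> ` gen_alg sc g n"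
  proof
    fix x assume "x \<in> gen_alg (\<lambda>c. \<phi> (sc c)) (\<lambda>i. \<phi> (g i)) n"
    then show "x \<in> \<phi> ` gen_alg sc g n"
    proof (induction rule: gen_alg.induct)
      case (gen i)
      then show ?case by (intro imageI gen_alg.gen)
    next
      case (add x y)
      then show ?case using hom_add by (auto simp: image_iff) (metis gen_alg.add)
    next
      case (mult x y)
      then show ?case using hom_mult by (auto simp: image_iff) (metis gen_alg.mult)
    qed (auto intro: gen_alg.intros)
  qed
  show "\<phi> ` gen_alg sc g n \<subseteq> gen_alg (\<lambda>c. \<phi> (sc c)) (\<lambda>i. \<phi> (g i)) n"
  proof
    fix z assume "z \<in> \<phi> ` gen_alg sc g n"
    then obtain x where "x \<in> gen_alg sc g n" "z = \<phi> x" by blast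
    then show "z \<in> gen_alg (\<lambda>c. \<phi> (sc c)) (\<lambda>i. \<phi> (g i)) n"
    proof (induction arbitrary: z rule: gen_alg.induct)
      case (scalar c)
      then show ?case using gen_alg.scalar[of "\<lambda>c. \<phi> (sc c)"] by simp
    next
      case (gen i)
      then show ?case using gen_alg.gen[of i n "\<lambda>i. \<phi> (g i)" "\<lambda>c. \<phi> (sc c)"] by simp
    qed (auto simp: hom_add hom_mult intro: gen_alg.intros)
  qed
qed

lemma jm_hom:
  assumes "i \<le> n"
  shows "jm sc g i \<in> gen_alg sc g n \<and> \<phi> (jm sc g i) = jm (\<lambda>c. \<phi> (sc c)) (\<lambda>i. \<phi> (g i)) i"
  using assms
proof (induction i)
  case (Suc i)
  then show ?case
    by (cases i) (auto simp: hom_mult gen_alg.intros)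
qed (simp add: gen_alg.scalar)

lemma poly_at_hom:
  assumes "y \<in> gen_alg sc g n"
  shows "poly_at sc y p \<in> gen_alg sc g n \<and> \<phi> (poly_at sc y p) = poly_at (\<lambda>c. \<phi> (sc c)) (\<phi> y) p"
proof (induction p)
  case 0
  then show ?case using gen_alg.scalar[of sc 0 g n] hom_0 by simp
next
  case (pCons c p)
  then show ?case using assms hom_0
    by (auto simp: poly_at_pCons hom_add hom_mult gen_alg.intros)
qed

lemma idem_hom:
  assumes "length s \<le> n"
  shows "idem q sc g s \<in> gen_alg sc g n \<and> \<phi> (idem q sc g s) = idem q (\<lambda>c. \<phi> (sc c)) (\<lambda>i. \<phi> (g i)) s"
  using assms
proof (induction s rule: rev_induct)
  case (snoc k s)
  then show ?case using jm_hom[of "Suc (length s)"] poly_at_hom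
    by (auto simp: idem_snoc hom_mult gen_alg.intros)
qed (simp add: idem_Nil gen_alg.scalar)

end

section \<open>Cosets as elements of the abstract algebra\<close>

definition proj :: "complex \<Rightarrow> nat \<Rightarrow> free_elt \<Rightarrow> free_elt set"
  where "proj q n f = hecke_ideal q n +>\<^bsub>free_alg n\<^esub> f"

lemma proj_alt: "proj q n f = (\<lambda>i. i + f) ` hecke_ideal q n"
  by (auto simp: proj_def a_r_coset_def' free_alg_ops)

definition quot :: "complex \<Rightarrow> nat \<Rightarrow> free_elt \<Rightarrow> free_elt set ring_family"
  where "quot q n f = embed (hecke q n) (proj q n f)"

context generic_parameter
begin

lemma hecke_ideal_is_ideal: "ideal (hecke_ideal q n) (free_alg n)"
  unfolding hecke_ideal_def using hecke_rels_vanishing[of n]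
  by (intro ring.genideal_ideal free_alg_ring) (auto simp: vanishing_def)

lemma hecke_ideal_facts:
  shows "hecke_ideal q n \<subseteq> carrier (free_alg n)" "0 \<in> hecke_ideal q n"
    and "f \<in> hecke_ideal q n \<Longrightarrow> g \<in> hecke_ideal q n \<Longrightarrow> f + g \<in> hecke_ideal q n"
    and "f \<in> hecke_ideal q n \<Longrightarrow> - f \<in> hecke_ideal q n"
    and "hecke_rels q n \<subseteq> hecke_ideal q n"
proof -
  interpret ideal "hecke_ideal q n" "free_alg n" by (rule hecke_ideal_is_ideal)
  show sub: "hecke_ideal q n \<subseteq> carrier (free_alg n)" using a_subset .
  show "0 \<in> hecke_ideal q n" using additive_subgroup.zero_closed[OF is_additive_subgroup] by (simp add: free_alg_ops)
  show "f \<in> hecke_ideal q n \<Longrightarrow> g \<in> hecke_ideal q n \<Longrightarrow> f + g \<in> hecke_ideal q n"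
    using additive_subgroup.a_closed[OF is_additive_subgroup] by (simp add: free_alg_ops)
  show "f \<in> hecke_ideal q n \<Longrightarrow> - f \<in> hecke_ideal q n"
    using additive_subgroup.a_inv_closed[OF is_additive_subgroup, of f] free_alg_neg sub by auto
  show "hecke_rels q n \<subseteq> hecke_ideal q n"
    unfolding hecke_ideal_def using hecke_rels_vanishing[of n]
    by (intro ring.genideal_self free_alg_ring) (auto simp: vanishing_def)
qed

lemma hecke_ring: "Ring.ring (hecke q n)"
  unfolding hecke_def using hecke_ideal_is_ideal by (rule ideal.quotient_is_ring)

lemma proj_eq_iff: "proj q n f = proj q n g \<longleftrightarrow> f - g \<in> hecke_ideal q n"
proof
  assume eq: "proj q n f = proj q n g"
  have "0 + f \<in> proj q n f" unfolding proj_alt using hecke_ideal_facts(2) by blast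
  then obtain i where "i \<in> hecke_ideal q n" "f = i + g" unfolding eq by (auto simp: proj_alt)
  then show "f - g \<in> hecke_ideal q n" by simp
next
  have sub: "proj q n f \<subseteq> proj q n g" if d: "f - g \<in> hecke_ideal q n" for f g
  proof
    fix z assume "z \<in> proj q n f"
    then obtain i where "i \<in> hecke_ideal q n" "z = i + f" by (auto simp: proj_alt)
    then have "z = (i + (f - g)) + g" "i + (f - g) \<in> hecke_ideal q n"
      using hecke_ideal_facts(3) d by auto
    then show "z \<in> proj q n g" unfolding proj_alt by blast
  qed
  assume d: "f - g \<in> hecke_ideal q n"
  then have "g - f \<in> hecke_ideal q n" using hecke_ideal_facts(4)[of "f - g"] by simp
  with d show "proj q n f = proj q n g" using sub by blast
qed

lemma proj_ring_hom: "proj q n \<in> ring_hom (free_alg n) (hecke q n)"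
  unfolding hecke_def proj_def[abs_def] using hecke_ideal_is_ideal by (rule ideal.rcos_ring_hom)

lemma proj_ops:
  shows "f \<in> carrier (free_alg n) \<Longrightarrow> proj q n f \<in> carrier (hecke q n)"
    and "f \<in> carrier (free_alg n) \<Longrightarrow> g \<in> carrier (free_alg n) \<Longrightarrow>
      proj q n f \<oplus>\<^bsub>hecke q n\<^esub> proj q n g = proj q n (f + g)"
    and "f \<in> carrier (free_alg n) \<Longrightarrow> g \<in> carrier (free_alg n) \<Longrightarrow>
      proj q n f \<otimes>\<^bsub>hecke q n\<^esub> proj q n g = proj q n (f * g)"
    and "\<one>\<^bsub>hecke q n\<^esub> = proj q n 1" "\<zero>\<^bsub>hecke q n\<^esub> = proj q n 0"
proof -
  note h = proj_ring_hom[of n]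
  show "f \<in> carrier (free_alg n) \<Longrightarrow> proj q n f \<in> carrier (hecke q n)" by (rule ring_hom_closed[OF h])
  show "f \<in> carrier (free_alg n) \<Longrightarrow> g \<in> carrier (free_alg n) \<Longrightarrow>
      proj q n f \<oplus>\<^bsub>hecke q n\<^esub> proj q n g = proj q n (f + g)"
    using ring_hom_add[OF h] by (simp add: free_alg_ops)
  show "f \<in> carrier (free_alg n) \<Longrightarrow> g \<in> carrier (free_alg n) \<Longrightarrow>
      proj q n f \<otimes>\<^bsub>hecke q n\<^esub> proj q n g = proj q n (f * g)"
    using ring_hom_mult[OF h] by (simp add: free_alg_ops)
  show "\<one>\<^bsub>hecke q n\<^esub> = proj q n 1" using ring_hom_one[OF h] by (simp add: free_alg_ops)
  show "\<zero>\<^bsub>hecke q n\<^esub> = proj q n 0"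
    using ring_hom_zero[OF h free_alg_ring hecke_ring] by (simp add: free_alg_ops)
qed

lemma proj_diff:
  assumes "f \<in> carrier (free_alg n)" "g \<in> carrier (free_alg n)"
  shows "proj q n f \<ominus>\<^bsub>hecke q n\<^esub> proj q n g = proj q n (f - g)"
proof -
  interpret R: Ring.ring "hecke q n" by (rule hecke_ring)
  have "proj q n (- g) \<oplus>\<^bsub>hecke q n\<^esub> proj q n g = \<zero>\<^bsub>hecke q n\<^esub>"
    using assms by (simp add: proj_ops free_alg_closed)
  then have "\<ominus>\<^bsub>hecke q n\<^esub> proj q n g = proj q n (- g)"
    using assms by (intro R.minus_equality) (auto simp: proj_ops free_alg_closed)
  then show ?thesis using assms by (simp add: a_minus_def proj_ops free_alg_closed)
qed

lemma hecke_carrier: "carrier (hecke q n) = proj q n ` carrier (free_alg n)"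
  by (auto simp: hecke_def FactRing_def A_RCOSETS_def' proj_def)

lemma quot_ops:
  shows "f \<in> carrier (free_alg n) \<Longrightarrow> g \<in> carrier (free_alg n) \<Longrightarrow> quot q n (f + g) = quot q n f + quot q n g"
    and "f \<in> carrier (free_alg n) \<Longrightarrow> g \<in> carrier (free_alg n) \<Longrightarrow> quot q n (f * g) = quot q n f * quot q n g"
    and "quot q n 0 = 0"
    and "f \<in> carrier (free_alg n) \<Longrightarrow> g \<in> carrier (free_alg n) \<Longrightarrow>
      quot q n f = quot q n g \<longleftrightarrow> proj q n f = proj q n g"
  using embed_add[OF hecke_ring] embed_mult[OF hecke_ring] embed_zero[OF hecke_ring]
    embed_inj[OF hecke_ring]
  by (simp_all add: quot_def proj_ops(2,3,5)[symmetric] proj_ops(1))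

lemma quot_eq_iff:
  "f \<in> carrier (free_alg n) \<Longrightarrow> g \<in> carrier (free_alg n) \<Longrightarrow>
    quot q n f = quot q n g \<longleftrightarrow> f - g \<in> hecke_ideal q n"
  by (simp add: quot_ops(4) proj_eq_iff)

lemma quot_hom:
  shows "x \<in> gen_alg fscal fgen n \<Longrightarrow> y \<in> gen_alg fscal fgen n \<Longrightarrow> quot q n (x + y) = quot q n x + quot q n y"
    and "x \<in> gen_alg fscal fgen n \<Longrightarrow> y \<in> gen_alg fscal fgen n \<Longrightarrow> quot q n (x * y) = quot q n x * quot q n y"
    and "fscal 0 = 0" "quot q n 0 = 0"
  by (simp_all add: free_alg_generated[symmetric] quot_ops) (simp add: fscal_def)

lemma quot_jm:
  assumes "i \<le> n"
  shows "jm fscal fgen i \<in> gen_alg fscal fgen n \<and>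
    quot q n (jm fscal fgen i) = jm (\<lambda>c. quot q n (fscal c)) (\<lambda>i. quot q n (fgen i)) i"
  by (rule jm_hom[where \<phi> = "quot q n" and sc = fscal and g = fgen and n = n]) (use assms in \<open>auto simp: quot_hom\<close>)

lemma quot_poly_at:
  assumes "y \<in> gen_alg fscal fgen n"
  shows "poly_at fscal y p \<in> gen_alg fscal fgen n \<and>
    quot q n (poly_at fscal y p) = poly_at (\<lambda>c. quot q n (fscal c)) (quot q n y) p"
  by (rule poly_at_hom[where \<phi> = "quot q n" and sc = fscal and g = fgen and n = n]) (use assms in \<open>auto simp: quot_hom\<close>)

lemma quot_idem:
  assumes "length s \<le> n"
  shows "idem q fscal fgen s \<in> gen_alg fscal fgen n \<and>
    quot q n (idem q fscal fgen s) = idem q (\<lambda>c. quot q n (fscal c)) (\<lambda>i. quot q n (fgen i)) s"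
  by (rule idem_hom[where \<phi> = "quot q n" and sc = fscal and g = fgen and n = n]) (use assms in \<open>auto simp: quot_hom\<close>)

lemma quot_image:
  "gen_alg (\<lambda>c. quot q n (fscal c)) (\<lambda>i. quot q n (fgen i)) n = quot q n ` gen_alg fscal fgen n"
  by (rule gen_alg_image[where \<phi> = "quot q n" and sc = fscal and g = fgen and n = n]) (auto simp: quot_hom)

text \<open>The functional is the coefficient at s of x applied to the basis vector at s. It is well
  defined because the ideal of relations acts by zero, equals 1 at the unit, and scales correctly
  because y_i only rescales that basis vector.\<close>

lemma quot_weight_functional:
  assumes s: "s \<in> std_seqs N"
  defines "sc \<equiv> \<lambda>c. quot q N (fscal c)" and "g \<equiv> \<lambda>i. quot q N (fgen i)"
  shows "\<exists>\<chi> :: free_elt set ring_family \<Rightarrow> complex. \<chi> (sc 1) = 1 \<and>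
      (\<forall>x\<in>gen_alg sc g N. \<forall>y\<in>gen_alg sc g N. \<chi> (x + y) = \<chi> x + \<chi> y) \<and>
      (\<forall>x\<in>gen_alg sc g N. \<forall>c. \<chi> (sc c * x) = c * \<chi> x) \<and>
      (\<forall>x\<in>gen_alg sc g N. \<forall>i\<in>{1..N}. \<chi> (x * jm sc g i) = content q (s ! (i - 1)) * \<chi> x)"
proof -
  define \<delta> :: "int list \<Rightarrow> complex" where "\<delta> = (\<lambda>t. if t = s then 1 else 0)"
  \<comment> \<open>Any representative serves; elements outside the image receive an arbitrary
    value, but the conditions concern the generated subalgebra only.\<close>
  define \<chi> where "\<chi> t = free_act q (SOME f. f \<in> carrier (free_alg N) \<and> quot q N f = t) \<delta> s" for t
  have \<chi>: "\<chi> (quot q N f) = free_act q f \<delta> s" if f: "f \<in> carrier (free_alg N)" for f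
  proof -
    define f' where "f' = (SOME f'. f' \<in> carrier (free_alg N) \<and> quot q N f' = quot q N f)"
    have f': "f' \<in> carrier (free_alg N) \<and> quot q N f' = quot q N f"
      unfolding f'_def by (rule someI[where x = f]) (use f in simp)
    then have "f' - f \<in> vanishing q N" using f quot_eq_iff hecke_ideal_vanishing by blast
    then have "free_act q f' \<delta> s = free_act q f \<delta> s"
      using s by (simp add: vanishing_def free_act_minus)
    then show ?thesis by (simp add: \<chi>_def f'_def)
  qed
  have image: "gen_alg sc g N = quot q N ` carrier (free_alg N)"
    unfolding sc_def g_def free_alg_generated by (rule quot_image)
  have jm: "jm sc g i = quot q N (jm fscal fgen i)" "jm fscal fgen i \<in> carrier (free_alg N)" if "i \<le> N" for i
    using quot_jm[OF that] unfolding sc_def g_def free_alg_generated by simp_all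
  have "\<chi> (sc 1) = 1" unfolding sc_def using \<chi> free_alg_closed(1) by (simp add: free_act_fscal \<delta>_def)
  moreover have "\<chi> (quot q N f + quot q N f') = \<chi> (quot q N f) + \<chi> (quot q N f')"
    if "f \<in> carrier (free_alg N)" "f' \<in> carrier (free_alg N)" for f f'
    using that by (simp add: quot_ops(1)[symmetric] \<chi> free_alg_closed free_act_add)
  moreover have "\<chi> (sc c * quot q N f) = c * \<chi> (quot q N f)" if "f \<in> carrier (free_alg N)" for c f
    unfolding sc_def using that
    by (simp add: quot_ops(2)[symmetric] \<chi> free_alg_closed free_act_mult free_act_fscal)
  moreover have "\<chi> (quot q N f * jm sc g i) = content q (s ! (i - 1)) * \<chi> (quot q N f)"
    if f: "f \<in> carrier (free_alg N)" and i: "i \<in> {1..N}" for f i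
  proof -
    have iN: "i \<le> N" using i by simp
    have "\<chi> (quot q N f * jm sc g i) = free_act q f (free_act q (jm fscal fgen i) \<delta>) s"
      using f jm[OF iN] by (simp add: quot_ops(2)[symmetric] \<chi> free_alg_closed free_act_mult)
    also have "\<dots> = free_act q f (free_act q (fscal (content q (s ! (i - 1)))) \<delta>) s"
      using i by (intro free_act_cong[OF f _ s]) (simp add: free_act_jm[of i N] free_act_fscal \<delta>_def)
    also have "\<dots> = free_act q (fscal (content q (s ! (i - 1))) * f) \<delta> s"
      by (simp only: free_act_mult[symmetric] fscal_central)
    also have "\<dots> = content q (s ! (i - 1)) * \<chi> (quot q N f)"
      using f by (simp add: free_act_mult free_act_fscal \<chi>)
    finally show ?thesis .
  qed
  ultimately show ?thesis unfolding image by (intro exI[of _ \<chi>]) blast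
qed

lemma hecke_algebra_quot: "hecke_algebra q N (\<lambda>c. quot q N (fscal c)) (\<lambda>i. quot q N (fgen i))"
proof unfold_locales
  fix c d
  show "quot q N (fscal (c + d)) = quot q N (fscal c) + quot q N (fscal d)"
    by (simp add: fscal_add quot_ops free_alg_closed)
  show "quot q N (fscal (c * d)) = quot q N (fscal c) * quot q N (fscal d)"
    by (simp add: fscal_mult quot_ops free_alg_closed)
next
  fix i c assume "1 \<le> i" "i < N"
  then have g: "fgen i \<in> carrier (free_alg N)" by (simp add: free_alg_closed)
  show "quot q N (fgen i) * quot q N (fscal c) = quot q N (fscal c) * quot q N (fgen i)"
    using g by (simp add: quot_ops(2)[symmetric] free_alg_closed fscal_central)
  show "quot q N (fscal 1) * quot q N (fgen i) = quot q N (fgen i)"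
    using g by (simp add: quot_ops(2)[symmetric] free_alg_closed one_free_elt[symmetric])
  have "fgen i * fgen i - 1 - fscal h * fgen i \<in> hecke_rels q N"
    using \<open>1 \<le> i\<close> \<open>i < N\<close> unfolding hecke_rels_def by auto
  then have "fgen i * fgen i - (fscal 1 + fscal h * fgen i) \<in> hecke_ideal q N"
    using hecke_ideal_facts(5) by (auto simp: one_free_elt[symmetric] algebra_simps)
  then have "quot q N (fgen i * fgen i) = quot q N (fscal 1 + fscal h * fgen i)"
    using g by (simp add: quot_eq_iff free_alg_closed)
  then show "quot q N (fgen i) * quot q N (fgen i) = quot q N (fscal 1) + quot q N (fscal h) * quot q N (fgen i)"
    using g by (simp add: quot_ops free_alg_closed)
next
  fix i assume i: "1 \<le> i" "i + 1 < N"
  then have g: "fgen i \<in> carrier (free_alg N)" "fgen (i + 1) \<in> carrier (free_alg N)"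
    by (simp_all add: free_alg_closed)
  have "fgen i * fgen (i + 1) * fgen i - fgen (i + 1) * fgen i * fgen (i + 1) \<in> hecke_rels q N"
    using i unfolding hecke_rels_def by blast
  then have "quot q N (fgen i * fgen (i + 1) * fgen i) = quot q N (fgen (i + 1) * fgen i * fgen (i + 1))"
    using g hecke_ideal_facts(5) by (subst quot_eq_iff) (auto simp: free_alg_closed)
  then show "quot q N (fgen i) * quot q N (fgen (i + 1)) * quot q N (fgen i)
      = quot q N (fgen (i + 1)) * quot q N (fgen i) * quot q N (fgen (i + 1))"
    using g by (simp add: quot_ops free_alg_closed)
next
  fix i j assume ij: "1 \<le> i" "i + 1 < j" "j < N"
  then have g: "fgen i \<in> carrier (free_alg N)" "fgen j \<in> carrier (free_alg N)"
    by (simp_all add: free_alg_closed)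
  have "i \<in> {1..<N} \<and> j \<in> {1..<N} \<and> \<bar>int i - int j\<bar> > 1" using ij by auto
  then have "fgen i * fgen j - fgen j * fgen i \<in> hecke_rels q N" unfolding hecke_rels_def by blast
  then have "quot q N (fgen i * fgen j) = quot q N (fgen j * fgen i)"
    using g hecke_ideal_facts(5) by (subst quot_eq_iff) (auto simp: free_alg_closed)
  then show "quot q N (fgen i) * quot q N (fgen j) = quot q N (fgen j) * quot q N (fgen i)"
    using g by (simp add: quot_ops free_alg_closed)
qed (rule quot_weight_functional)

text \<open>The larger ideal lives in a larger free algebra, so minimality is applied to its trace
  on the smaller one, an ideal there that contains the smaller set of relations.\<close>

lemma hecke_ideal_mono: "hecke_ideal q n \<subseteq> hecke_ideal q (Suc n)"
proof -
  have "hecke_rels q n \<subseteq> hecke_rels q (Suc n)" unfolding hecke_rels_def by force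
  moreover have "ideal (hecke_ideal q (Suc n) \<inter> carrier (free_alg n)) (free_alg n)"
  proof (rule idealI[OF free_alg_ring])
    show "subgroup (hecke_ideal q (Suc n) \<inter> carrier (free_alg n)) (add_monoid (free_alg n))"
    proof
      fix f assume f: "f \<in> hecke_ideal q (Suc n) \<inter> carrier (free_alg n)"
      then have "inv\<^bsub>add_monoid (free_alg n)\<^esub> f = - f"
        using free_alg_neg[of f n] by (simp add: a_inv_def)
      then show "inv\<^bsub>add_monoid (free_alg n)\<^esub> f \<in> hecke_ideal q (Suc n) \<inter> carrier (free_alg n)"
        using f hecke_ideal_facts(4) free_alg_closed(5) by simp
    qed (auto simp: free_alg_ops free_alg_closed hecke_ideal_facts)
    fix f g assume fg: "f \<in> hecke_ideal q (Suc n) \<inter> carrier (free_alg n)" "g \<in> carrier (free_alg n)"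
    then have "g \<in> carrier (free_alg (Suc n))" using free_alg_mono[of n "Suc n"] by auto
    with fg show "g \<otimes>\<^bsub>free_alg n\<^esub> f \<in> hecke_ideal q (Suc n) \<inter> carrier (free_alg n)"
      "f \<otimes>\<^bsub>free_alg n\<^esub> g \<in> hecke_ideal q (Suc n) \<inter> carrier (free_alg n)"
      using ideal.I_l_closed[OF hecke_ideal_is_ideal[of "Suc n"], of f g]
        ideal.I_r_closed[OF hecke_ideal_is_ideal[of "Suc n"], of f g]
      by (simp_all add: free_alg_ops free_alg_closed)
  qed
  moreover have "hecke_rels q n \<subseteq> carrier (free_alg n)"
    using hecke_ideal_facts(1,5) by blast
  ultimately have "hecke_ideal q n \<subseteq> hecke_ideal q (Suc n) \<inter> carrier (free_alg n)"
    unfolding hecke_ideal_def[of q n] using hecke_ideal_facts(5)[of "Suc n"]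
    by (intro ring.genideal_minimal[OF free_alg_ring]) auto
  then show ?thesis by blast
qed

lemma hecke_incl_proj:
  assumes "f \<in> carrier (free_alg n)"
  shows "hecke_incl q n (proj q n f) = proj q (n + 1) f"
proof -
  have "hecke_incl q n (proj q n f) = (\<Union>i\<in>hecke_ideal q (n + 1). \<Union>j\<in>hecke_ideal q n. {i + (j + f)})"
    by (auto simp: hecke_incl_def set_add_def' proj_alt free_alg_ops)
  also have "\<dots> = proj q (n + 1) f"
  proof
    show "(\<Union>i\<in>hecke_ideal q (n + 1). \<Union>j\<in>hecke_ideal q n. {i + (j + f)}) \<subseteq> proj q (n + 1) f"
      using hecke_ideal_mono[of n] hecke_ideal_facts(3)[of _ "n + 1"]
      by (force simp: proj_alt add.assoc[symmetric])
    show "proj q (n + 1) f \<subseteq> (\<Union>i\<in>hecke_ideal q (n + 1). \<Union>j\<in>hecke_ideal q n. {i + (j + f)})"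
      using hecke_ideal_facts(2)[of n] by (force simp: proj_alt)
  qed
  finally show ?thesis .
qed

lemma jucys_murphy_proj: "i \<le> n \<Longrightarrow> jucys_murphy q n i = proj q n (jm fscal fgen i)"
proof (induction i)
  case (Suc i)
  show ?case
  proof (cases i)
    case (Suc j)
    have "jm fscal fgen i \<in> carrier (free_alg n)"
      using quot_jm[where i = i and n = n] Suc.prems by (simp add: free_alg_generated)
    then show ?thesis using Suc.IH Suc.prems Suc
      by (simp add: hecke_gen_def proj_def[symmetric] proj_ops free_alg_closed)
  qed (simp add: proj_ops one_free_elt)
qed (simp add: proj_ops one_free_elt)

lemma hecke_scal_proj: "hecke_scal q n c = proj q n (fscal c)"
  by (simp add: hecke_scal_def proj_def)

definition seq_idempotent :: "int list \<Rightarrow> free_elt set"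
  where "seq_idempotent s = proj q (length s) (idem q fscal fgen s)"

text \<open>Carries uniqueness, idempotence and primitivity from the abstract algebra to the ring of
  cosets. Every condition is an equation between cosets, which \<open>quot\<close> translates in
  both directions by injectivity of the embedding.\<close>

lemma seq_idempotent_characterization:
  assumes s: "s \<in> std_seqs n" and n: "1 \<le> n"
  shows "primitive_idempotent (hecke q n) e \<and>
      (\<forall>i\<in>{1..n}. jucys_murphy q n i \<otimes>\<^bsub>hecke q n\<^esub> e = hecke_scal q n (a (s ! (i - 1))) \<otimes>\<^bsub>hecke q n\<^esub> e \<and>
         e \<otimes>\<^bsub>hecke q n\<^esub> jucys_murphy q n i = hecke_scal q n (a (s ! (i - 1))) \<otimes>\<^bsub>hecke q n\<^esub> e)
    \<longleftrightarrow> e = seq_idempotent s"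
    (is "?L \<longleftrightarrow> ?R")
proof -
  interpret H: hecke_algebra q n "\<lambda>c. quot q n (fscal c)" "\<lambda>i. quot q n (fgen i)"
    by (rule hecke_algebra_quot)
  let ?F = "carrier (free_alg n)" and ?\<epsilon> = "idem q fscal fgen s"
  have A: "H.A n = quot q n ` ?F" using quot_image by (simp add: free_alg_generated)
  have \<epsilon>: "?\<epsilon> \<in> ?F" "quot q n ?\<epsilon> = H.E s"
    using quot_idem[of s n] length_std_seqs[OF s] by (simp_all add: free_alg_generated)
  have jm: "jm fscal fgen i \<in> ?F" "quot q n (jm fscal fgen i) = H.Y i" if "i \<in> {1..n}" for i
    using quot_jm[where i = i and n = n] that by (simp_all add: free_alg_generated)
  have prod: "proj q n f \<otimes>\<^bsub>hecke q n\<^esub> proj q n f' = proj q n f'' \<longleftrightarrow> quot q n f * quot q n f' = quot q n f''"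
    if "f \<in> ?F" "f' \<in> ?F" "f'' \<in> ?F" for f f' f''
    using that by (simp add: proj_ops quot_ops(2)[symmetric] quot_ops(4) free_alg_closed)
  have zero: "proj q n f = \<zero>\<^bsub>hecke q n\<^esub> \<longleftrightarrow> quot q n f = 0" if "f \<in> ?F" for f
    using that quot_ops(4)[of f n 0] by (simp add: proj_ops quot_ops(3) free_alg_closed)
  have idm: "idempotent_in (hecke q n) (proj q n f) \<longleftrightarrow> quot q n f * quot q n f = quot q n f" if "f \<in> ?F" for f
    using that by (simp add: idempotent_in_def proj_ops(1) prod)
  have eig: "jucys_murphy q n i \<otimes>\<^bsub>hecke q n\<^esub> proj q n f = hecke_scal q n c \<otimes>\<^bsub>hecke q n\<^esub> proj q n f
      \<longleftrightarrow> H.Y i * quot q n f = quot q n (fscal c) * quot q n f"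
    "proj q n f \<otimes>\<^bsub>hecke q n\<^esub> jucys_murphy q n i = hecke_scal q n c \<otimes>\<^bsub>hecke q n\<^esub> proj q n f
      \<longleftrightarrow> quot q n f * H.Y i = quot q n (fscal c) * quot q n f"
    if "f \<in> ?F" "i \<in> {1..n}" for f i c
    using that jm[OF that(2)]
    by (simp_all add: jucys_murphy_proj hecke_scal_proj proj_ops quot_ops(2)[symmetric] quot_ops(4)[symmetric] free_alg_closed)
       (simp_all add: quot_ops free_alg_closed)
  have R: "seq_idempotent s = proj q n ?\<epsilon>" by (simp add: seq_idempotent_def length_std_seqs[OF s])
  show ?thesis
  proof
    assume L: ?L
    then obtain f where f: "f \<in> ?F" "e = proj q n f"
      using hecke_carrier by (auto simp: primitive_idempotent_def idempotent_in_def)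
    have "quot q n f = H.E s"
    proof (rule H.E_unique[OF n s])
      show "quot q n f \<in> H.A n" using A f by blast
      show "quot q n f * quot q n f = quot q n f" "quot q n f \<noteq> 0"
        using L f by (simp_all add: primitive_idempotent_def idm zero)
      fix i assume i: "i \<in> {1..n}"
      show "H.Y i * quot q n f = quot q n (fscal (a (s ! (i - 1)))) * quot q n f"
        "quot q n f * H.Y i = quot q n (fscal (a (s ! (i - 1)))) * quot q n f"
        using L eig[OF f(1) i] i unfolding f(2) by blast+
    qed
    then show ?R using quot_ops(4)[of f n ?\<epsilon>] f \<epsilon> R by simp
  next
    assume ?R
    then have e: "e = proj q n ?\<epsilon>" using R by simp
    have "primitive_idempotent (hecke q n) e"
      unfolding primitive_idempotent_def
    proof (intro conjI allI impI)
      show "idempotent_in (hecke q n) e" using idm[OF \<epsilon>(1)] H.E_idempotent[OF n s] \<epsilon> e by simp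
      show "e \<noteq> \<zero>\<^bsub>hecke q n\<^esub>" using zero[OF \<epsilon>(1)] H.E_nonzero[OF s] \<epsilon> e by simp
      fix u v
      assume uv: "idempotent_in (hecke q n) u \<and> idempotent_in (hecke q n) v \<and>
        u \<otimes>\<^bsub>hecke q n\<^esub> v = \<zero>\<^bsub>hecke q n\<^esub> \<and> v \<otimes>\<^bsub>hecke q n\<^esub> u = \<zero>\<^bsub>hecke q n\<^esub> \<and> e = u \<oplus>\<^bsub>hecke q n\<^esub> v"
      obtain f f' where f: "f \<in> ?F" "u = proj q n f" "f' \<in> ?F" "v = proj q n f'"
        using uv hecke_carrier by (auto simp: idempotent_in_def)
      have "quot q n f = 0 \<or> quot q n f' = 0"
      proof (rule H.E_primitive[OF n s])
        show "quot q n f \<in> H.A n" "quot q n f' \<in> H.A n" using A f by blast+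
        show "quot q n f * quot q n f = quot q n f" "quot q n f' * quot q n f' = quot q n f'"
          using uv f idm by auto
        show "quot q n f * quot q n f' = 0" "quot q n f' * quot q n f = 0"
          using uv f zero[of "f * f'"] zero[of "f' * f"]
          by (simp_all add: proj_ops quot_ops(2) free_alg_closed)
        have "proj q n ?\<epsilon> = proj q n (f + f')" using uv f e by (simp add: proj_ops)
        then show "H.E s = quot q n f + quot q n f'"
          using quot_ops(4)[of ?\<epsilon> n "f + f'"] \<epsilon> f by (simp add: free_alg_closed quot_ops(1))
      qed
      then show "u = \<zero>\<^bsub>hecke q n\<^esub> \<or> v = \<zero>\<^bsub>hecke q n\<^esub>" using zero f by simp
    qed
    moreover have "jucys_murphy q n i \<otimes>\<^bsub>hecke q n\<^esub> e = hecke_scal q n (a (s ! (i - 1))) \<otimes>\<^bsub>hecke q n\<^esub> e \<and>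
         e \<otimes>\<^bsub>hecke q n\<^esub> jucys_murphy q n i = hecke_scal q n (a (s ! (i - 1))) \<otimes>\<^bsub>hecke q n\<^esub> e"
      if i: "i \<in> {1..n}" for i
      unfolding e eig[OF \<epsilon>(1) i] \<epsilon>(2) using H.E_eigen[OF n s i] by blast
    ultimately show ?L by blast
  qed
qed

end

section \<open>Tableaux and content sequences\<close>

definition row :: "nat list \<Rightarrow> nat \<Rightarrow> nat"
  where "row lam i = (if i < length lam then lam ! i else 0)"

text \<open>Rows are counted from 0 here, so the bead of row i is the content exponent of the node
  that would extend this row, namely the node in column \<open>row lam i + 1\<close> and, counted
  from 1, row i + 1.\<close>

definition beads :: "nat list \<Rightarrow> int set"
  where "beads lam = range (\<lambda>i. int (row lam i) - int i)"

definition corner_index :: "nat list \<Rightarrow> nat \<Rightarrow> int"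
  where "corner_index lam j = int (block_len lam j) - int (block_end lam (j - 1))"

lemma young_diagram_row:
  "young_diagram lam \<longleftrightarrow> lam \<noteq> [] \<and> (\<forall>i j. i \<le> j \<longrightarrow> row lam j \<le> row lam i) \<and> (\<forall>i<length lam. 0 < row lam i)"
proof -
  have "sorted_wrt (\<ge>) lam \<longleftrightarrow> (\<forall>i j. i \<le> j \<longrightarrow> row lam j \<le> row lam i)"
    unfolding sorted_wrt_iff_nth_less row_def
    by (auto simp: le_less) (metis order_less_trans)
  then show ?thesis by (auto simp: young_diagram_def row_def all_set_conv_all_nth)
qed

lemma young_diagramD:
  assumes "young_diagram lam"
  shows "i \<le> j \<Longrightarrow> row lam j \<le> row lam i" and "0 < row lam i \<longleftrightarrow> i < length lam"
  using assms unfolding young_diagram_row by (blast, auto simp: row_def)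

lemma young_diagram_eqI:
  assumes "young_diagram lam" "young_diagram mu" "row lam = row mu"
  shows "lam = mu"
proof (rule nth_equalityI)
  have "i < length lam \<longleftrightarrow> i < length mu" for i
    using young_diagramD(2)[OF assms(1), of i] young_diagramD(2)[OF assms(2), of i] assms(3) by simp
  from this[of "length lam"] this[of "length mu"] show "length lam = length mu" by linarith
  then show "lam ! i = mu ! i" if "i < length lam" for i
    using that fun_cong[OF assms(3), of i] by (simp add: row_def)
qed

lemma filter_eq_takeWhile_decreasing:
  "sorted_wrt (\<ge>) lam \<Longrightarrow> filter (\<lambda>x. v < x) lam = takeWhile (\<lambda>x. v < x) (lam :: nat list)"
proof (induction lam)
  case (Cons x lam)
  then show ?case by (cases lam) (auto simp: filter_empty_conv)
qed simp

lemma remdups_decreasing: "sorted_wrt (\<ge>) lam \<Longrightarrow> sorted_wrt (>) (remdups lam :: nat list)"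
  by (induction lam) (auto simp: le_less)

text \<open>The first j - 1 distinct lengths are those exceeding the j-th one, as
  \<open>remdups\<close> keeps the decreasing order and the appended 0 lies below all of them. So
  n_{j-1} counts the rows longer than the j-th length.\<close>

lemma block_end_count:
  assumes "young_diagram lam" "j \<in> {1..num_blocks lam + 1}"
  shows "block_end lam (j - 1) = length (takeWhile (\<lambda>x. block_len lam j < x) lam)"
proof -
  let ?D = "remdups lam"
  have len: "length ?D = num_blocks lam" by (simp add: num_blocks_def length_remdups_card_conv)
  have s: "sorted_wrt (\<ge>) lam" and pos: "\<forall>x\<in>set lam. 0 < x" using assms by (auto simp: young_diagram_def)
  have D: "sorted_wrt (>) (?D @ [0])"
    using remdups_decreasing[OF s] pos by (auto simp: sorted_wrt_append)
  have "x \<in> set (take (j - 1) ?D) \<longleftrightarrow> block_len lam j < x" if "x \<in> set lam" for x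
  proof -
    from that obtain m where m: "m < length ?D" "x = ?D ! m" by (metis in_set_conv_nth set_remdups)
    have j: "j - 1 < length (?D @ [0])" using assms(2) len by auto
    have "x \<in> set (take (j - 1) ?D) \<longleftrightarrow> m < j - 1"
      using m by (auto simp: in_set_conv_nth nth_eq_iff_index_eq)
    also have "\<dots> \<longleftrightarrow> block_len lam j < x"
    proof
      assume "m < j - 1"
      then show "block_len lam j < x"
        using sorted_wrt_nth_less[OF D _ j, of m] m by (simp add: block_len_def nth_append)
    next
      assume lt: "block_len lam j < x"
      show "m < j - 1"
      proof (rule ccontr)
        assume "\<not> m < j - 1"
        then consider "m = j - 1" | "j - 1 < m" by linarith
        then show False
        proof cases
          case 1
          then show False using lt m by (simp add: block_len_def nth_append)
        next
          case 2
          then show False using sorted_wrt_nth_less[OF D 2] m lt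
            by (simp add: block_len_def nth_append split: if_splits)
        qed
      qed
    qed
    finally show ?thesis .
  qed
  then have "block_end lam (j - 1) = length (filter (\<lambda>x. block_len lam j < x) lam)"
    unfolding block_end_def by (metis (no_types, lifting) filter_cong)
  then show ?thesis using filter_eq_takeWhile_decreasing[OF s] by simp
qed

lemma longer_rows:
  fixes v :: nat
  assumes "young_diagram lam"
  defines "i \<equiv> length (takeWhile (\<lambda>x. v < x) lam)"
  shows "i \<le> length lam" "m < i \<Longrightarrow> v < row lam m" "row lam i \<le> v"
    and "v \<in> set lam \<or> v = 0 \<Longrightarrow> row lam i = v"
proof -
  show i: "i \<le> length lam" unfolding i_def by (rule length_takeWhile_le)
  show longer: "m < i \<Longrightarrow> v < row lam m" for m
  proof -
    assume m: "m < i"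
    then have "takeWhile (\<lambda>x. v < x) lam ! m \<in> set (takeWhile (\<lambda>x. v < x) lam)"
      unfolding i_def by (rule nth_mem)
    then have "v < takeWhile (\<lambda>x. v < x) lam ! m" using set_takeWhileD by metis
    then show "v < row lam m" using m i by (simp add: i_def takeWhile_nth row_def)
  qed
  show le: "row lam i \<le> v"
    unfolding i_def row_def using nth_length_takeWhile[of "\<lambda>x. v < x" lam] by auto
  assume "v \<in> set lam \<or> v = 0"
  then show "row lam i = v"
  proof
    assume "v \<in> set lam"
    then obtain m where m: "m < length lam" "v = row lam m" by (auto simp: in_set_conv_nth row_def)
    then have "i \<le> m" using longer not_le by blast
    then show ?thesis using young_diagramD(1)[OF assms(1)] m(2) le by (metis le_antisym)
  qed (use le in simp)
qed

lemma block_len_mem: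
  assumes "j \<in> {1..num_blocks lam + 1}"
  shows "block_len lam j \<in> set lam \<or> block_len lam j = 0"
proof -
  have "j - 1 < length (remdups lam @ [0])"
    using assms by (auto simp: num_blocks_def length_remdups_card_conv)
  then have "block_len lam j \<in> set (remdups lam @ [0])" unfolding block_len_def by (rule nth_mem)
  then show ?thesis by auto
qed

text \<open>Counted from 0, row n_{j-1} is the top row of block j, or the first empty row when j = k
  + 1. A node fits there because the row above, if any, is strictly longer.\<close>

lemma corner_row:
  assumes "young_diagram lam" "j \<in> {1..num_blocks lam + 1}"
  defines "i \<equiv> block_end lam (j - 1)"
  shows "i \<le> length lam" "row lam i = block_len lam j" "i = 0 \<or> row lam i < row lam (i - 1)"
proof -
  note c = longer_rows[OF assms(1), where v = "block_len lam j", folded block_end_count[OF assms(1,2)] i_def]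
  show "i \<le> length lam" "row lam i = block_len lam j" using c(1,4) block_len_mem[OF assms(2)] by auto
  then show "i = 0 \<or> row lam i < row lam (i - 1)" using c(2)[of "i - 1"] by (cases i) auto
qed

text \<open>The block is found from the length of row i: the rows longer than it are precisely those
  above.\<close>

lemma corner_of_row:
  assumes y: "young_diagram lam" and i: "i \<le> length lam" "i = 0 \<or> row lam i < row lam (i - 1)"
  shows "\<exists>j\<in>{1..num_blocks lam + 1}. block_end lam (j - 1) = i"
proof -
  let ?D = "remdups lam @ [0]"
  have "row lam i \<in> set ?D" using i(1) by (auto simp: row_def)
  then obtain m where m: "m < length ?D" "?D ! m = row lam i" unfolding in_set_conv_nth by blast
  define j where "j = Suc m"
  have j: "j \<in> {1..num_blocks lam + 1}"
    using m by (auto simp: j_def num_blocks_def length_remdups_card_conv)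
  have v: "block_len lam j = row lam i" using m by (simp add: j_def block_len_def)
  note c = longer_rows[OF y, where v = "block_len lam j", folded block_end_count[OF y j]]
  have "block_end lam (j - 1) \<le> i" using c(2)[of i] v not_le by auto
  moreover have "\<not> block_end lam (j - 1) < i"
  proof
    assume lt: "block_end lam (j - 1) < i"
    then have "row lam (i - 1) \<le> row lam (block_end lam (j - 1))"
      by (intro young_diagramD(1)[OF y]) auto
    then show False using corner_row(2)[OF y j] v i(2) lt by auto
  qed
  ultimately show ?thesis using j by force
qed

lemma beads_strict: "young_diagram lam \<Longrightarrow> i < m \<Longrightarrow> int (row lam m) - int m < int (row lam i) - int i"
  using young_diagramD(1)[of lam i m] by simp

lemma corner_index_row:
  assumes "young_diagram lam" "j \<in> {1..num_blocks lam + 1}"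
  shows "corner_index lam j = int (row lam (block_end lam (j - 1))) - int (block_end lam (j - 1))"
  using corner_row(2)[OF assms] by (simp add: corner_index_def)

text \<open>A bead is blocked exactly when the row above has the same length, since that row's bead
  then sits one place to the right. The free beads belong to the top rows of the blocks and to the
  first empty row; this joins the index r of the theorem to the positions used in the
  algebra.\<close>

lemma addable_beads:
  assumes y: "young_diagram lam"
  shows "addable (beads lam) = corner_index lam ` {1..num_blocks lam + 1}"
proof
  show "addable (beads lam) \<subseteq> corner_index lam ` {1..num_blocks lam + 1}"
  proof
    fix k assume "k \<in> addable (beads lam)"
    then obtain i where i: "k = int (row lam i) - int i" "k + 1 \<notin> beads lam"
      by (auto simp: addable_def beads_def)
    have pred: "i = 0 \<or> row lam i < row lam (i - 1)"
    proof (rule ccontr)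
      assume "\<not> (i = 0 \<or> row lam i < row lam (i - 1))"
      then have "0 < i" "row lam (i - 1) = row lam i"
        using young_diagramD(1)[OF y, of "i - 1" i] by auto
      then have "k + 1 = int (row lam (i - 1)) - int (i - 1)" using i(1) by auto
      then show False using i(2) by (auto simp: beads_def)
    qed
    have "i \<le> length lam"
    proof (rule ccontr)
      assume "\<not> i \<le> length lam"
      then show False using pred by (auto simp: row_def split: if_splits)
    qed
    then obtain j where "j \<in> {1..num_blocks lam + 1}" "block_end lam (j - 1) = i"
      using corner_of_row[OF y _ pred] by blast
    then show "k \<in> corner_index lam ` {1..num_blocks lam + 1}"
      using corner_index_row[OF y] i(1) by force
  qed
  show "corner_index lam ` {1..num_blocks lam + 1} \<subseteq> addable (beads lam)"
  proof
    fix k assume "k \<in> corner_index lam ` {1..num_blocks lam + 1}"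
    then obtain j where j: "j \<in> {1..num_blocks lam + 1}" "k = corner_index lam j" by blast
    define i where "i = block_end lam (j - 1)"
    have k: "k = int (row lam i) - int i" using corner_index_row[OF y] j by (simp add: i_def)
    have pred: "i = 0 \<or> row lam i < row lam (i - 1)" using corner_row(3)[OF y j(1)] by (simp add: i_def)
    have "k + 1 \<notin> beads lam"
    proof
      assume "k + 1 \<in> beads lam"
      then obtain m where m: "k + 1 = int (row lam m) - int m" by (auto simp: beads_def)
      have "m < i"
      proof (rule ccontr)
        assume "\<not> m < i"
        then have "m = i \<or> i < m" by auto
        then show False using beads_strict[OF y, of i m] k m by auto
      qed
      then have "row lam (i - 1) \<le> row lam m" by (intro young_diagramD(1)[OF y]) auto
      then show False using pred \<open>m < i\<close> k m by auto
    qed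
    then show "k \<in> addable (beads lam)" using k by (auto simp: addable_def beads_def)
  qed
qed

lemma corner_index_inj: "young_diagram lam \<Longrightarrow> inj_on (corner_index lam) {1..num_blocks lam + 1}"
proof (rule inj_onI)
  fix j j' assume y: "young_diagram lam" and j: "j \<in> {1..num_blocks lam + 1}" "j' \<in> {1..num_blocks lam + 1}"
    and eq: "corner_index lam j = corner_index lam j'"
  have "block_end lam (j - 1) = block_end lam (j' - 1)"
    using eq corner_index_row[OF y j(1)] corner_index_row[OF y j(2)] beads_strict[OF y]
    by (metis less_irrefl linorder_neqE_nat)
  then have "block_len lam j = block_len lam j'" using eq by (simp add: corner_index_def)
  moreover have "distinct (remdups lam @ [0])" using y by (auto simp: young_diagram_def)
  ultimately have "j - 1 = j' - 1"
    using j unfolding block_len_def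
    by (subst (asm) nth_eq_iff_index_eq) (auto simp: num_blocks_def length_remdups_card_conv)
  then show "j = j'" using j by auto
qed

lemma row_add_corner:
  assumes "young_diagram lam" "j \<in> {1..num_blocks lam + 1}"
  shows "row (add_corner lam j) = (row lam)(block_end lam (j - 1) := block_len lam j + 1)"
  using corner_row[OF assms]
  by (auto simp: add_corner_def Let_def row_def fun_eq_iff nth_append)

lemma young_diagram_add_corner:
  assumes y: "young_diagram lam" and j: "j \<in> {1..num_blocks lam + 1}"
  shows "young_diagram (add_corner lam j)"
proof -
  define i where "i = block_end lam (j - 1)"
  note c = corner_row[OF y j, folded i_def]
  have row: "row (add_corner lam j) = (row lam)(i := row lam i + 1)"
    using row_add_corner[OF y j] c by (simp add: i_def)
  have "row (add_corner lam j) n \<le> row (add_corner lam j) m" if "m \<le> n" for m n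
  proof -
    have "row lam n \<le> row lam m" using young_diagramD(1)[OF y that] .
    moreover have "row lam i + 1 \<le> row lam m" if "m < i"
      using c(3) young_diagramD(1)[OF y, of m "i - 1"] that by (cases i) auto
    ultimately show ?thesis unfolding row using that by auto
  qed
  moreover have "add_corner lam j \<noteq> []" using y by (auto simp: add_corner_def Let_def young_diagram_def)
  moreover have "0 < row (add_corner lam j) m" if "m < length (add_corner lam j)" for m
    using that young_diagramD(2)[OF y, of m] c(1) unfolding row
    by (auto simp: add_corner_def Let_def i_def split: if_splits)
  ultimately show ?thesis unfolding young_diagram_row by blast
qed

lemma sum_list_add_corner:
  assumes "young_diagram lam" "j \<in> {1..num_blocks lam + 1}"
  shows "sum_list (add_corner lam j) = sum_list lam + 1"
proof -
  have "lam ! i \<le> sum_list lam" if "i < length lam" for i using that by (simp add: elem_le_sum_list)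
  then show ?thesis by (auto simp: add_corner_def Let_def sum_list_update)
qed

lemma beads_update:
  assumes "young_diagram lam" "row mu = (row lam)(i := row lam i + 1)"
  shows "beads mu = hop (int (row lam i) - int i) (beads lam)"
proof -
  define x where "x = (\<lambda>m. int (row lam m) - int m)"
  have inj: "x m = x i \<longleftrightarrow> m = i" for m
    using beads_strict[OF assms(1), of m i] beads_strict[OF assms(1), of i m]
    unfolding x_def by (cases m i rule: linorder_cases) auto
  have b: "beads lam = range x" "int (row lam i) - int i = x i" by (simp_all add: beads_def x_def)
  have mu: "int (row mu m) - int m = (if m = i then x i + 1 else x m)" for m
    by (simp add: assms(2) x_def)
  show ?thesis
  proof (intro equalityI subsetI)
    fix z assume "z \<in> beads mu"
    then obtain m where "z = int (row mu m) - int m" unfolding beads_def by blast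
    then have "z = (if m = i then x i + 1 else x m)" unfolding mu .
    then show "z \<in> hop (int (row lam i) - int i) (beads lam)"
      using inj[of m] unfolding b hop_def by (auto split: if_splits)
  next
    fix z assume "z \<in> hop (int (row lam i) - int i) (beads lam)"
    then have "z = x i + 1 \<or> (\<exists>m. z = x m \<and> z \<noteq> x i)"
      unfolding b hop_def by auto
    then obtain m where "z = (if m = i then x i + 1 else x m)" by metis
    then show "z \<in> beads mu" unfolding beads_def mu[symmetric] by blast
  qed
qed

lemma beads_add_corner:
  assumes "young_diagram lam" "j \<in> {1..num_blocks lam + 1}"
  shows "beads (add_corner lam j) = hop (corner_index lam j) (beads lam)"
  using beads_update[OF assms(1), of "add_corner lam j" "block_end lam (j - 1)"]
    row_add_corner[OF assms] corner_row(2)[OF assms]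
  by (simp add: corner_index_row[OF assms])

section \<open>Standard tableaux built node by node\<close>

lemma nodes_row: "nodes lam = {(r, c). 1 \<le> r \<and> 1 \<le> c \<and> c \<le> row lam (r - 1)}"
  by (auto simp: nodes_def row_def split: if_splits)

lemma nodes_add_corner:
  assumes "young_diagram lam" "j \<in> {1..num_blocks lam + 1}"
  shows "nodes (add_corner lam j) = insert (corner lam j) (nodes lam)" "corner lam j \<notin> nodes lam"
  using corner_row(2)[OF assms]
  by (auto simp: nodes_row row_add_corner[OF assms] corner_def split: if_splits)

lemma standard_tableauD:
  assumes "standard_tableau lam T"
  shows "young_diagram lam" "dom T = nodes lam"
    and "T x = Some i \<Longrightarrow> i \<in> {1..sum_list lam}"
    and "i \<in> {1..sum_list lam} \<Longrightarrow> \<exists>x. T x = Some i"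
    and "T x = Some i \<Longrightarrow> T y = Some i \<Longrightarrow> x = y"
    and "card (dom T) = sum_list lam"
proof -
  show y: "young_diagram lam" and d: "dom T = nodes lam" using assms by (auto simp: standard_tableau_def)
  have b: "bij_betw (\<lambda>x. the (T x)) (nodes lam) {1..sum_list lam}" using assms by (simp add: standard_tableau_def)
  show "T x = Some i \<Longrightarrow> i \<in> {1..sum_list lam}"
    using bij_betwE[OF b] d by (metis domI option.sel)
  show "i \<in> {1..sum_list lam} \<Longrightarrow> \<exists>x. T x = Some i"
  proof -
    assume "i \<in> {1..sum_list lam}"
    then have "i \<in> (\<lambda>x. the (T x)) ` nodes lam" using bij_betw_imp_surj_on[OF b] by simp
    then obtain x where x: "x \<in> dom T" "i = the (T x)" using d by auto
    then have "T x = Some i" by auto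
    then show "\<exists>x. T x = Some i" by blast
  qed
  show "T x = Some i \<Longrightarrow> T y = Some i \<Longrightarrow> x = y"
  proof -
    assume "T x = Some i" "T y = Some i"
    then have "x \<in> nodes lam" "y \<in> nodes lam" "the (T x) = the (T y)" using d by auto
    then show "x = y" using bij_betw_imp_inj_on[OF b] by (auto dest: inj_onD)
  qed
  show "card (dom T) = sum_list lam" using bij_betw_same_card[OF b] d by simp
qed

text \<open>Exponents instead of complex contents, so that the combinatorics happens in the
  integers, independently of q.\<close>

definition content_seq :: "tableau \<Rightarrow> nat \<Rightarrow> int list" where
  "content_seq T n = map (\<lambda>i. let x = (THE x. T x = Some i) in int (snd x) - int (fst x)) [1..<n + 1]"

lemma length_content_seq: "length (content_seq T n) = n"
  by (simp add: content_seq_def)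

lemma content_string_seq: "i \<in> {1..n} \<Longrightarrow> content_string q T i = content q (content_seq T n ! (i - 1))"
  by (cases i) (auto simp: content_string_def node_content_def content_def content_seq_def Let_def
    simp del: upt_Suc)

text \<open>The new entry exceeds all others, and no old node lies to the right of the corner or
  below it.\<close>

lemma standard_extend:
  assumes T: "standard_tableau lam T" and j: "j \<in> {1..num_blocks lam + 1}"
  shows "standard_tableau (add_corner lam j) (extend_tableau lam T j)"
proof -
  let ?z = "corner lam j" and ?T = "extend_tableau lam T j" and ?n = "sum_list lam"
  note D = standard_tableauD[OF T]
  note y = D(1)
  note N = nodes_add_corner[OF y j]
  have b: "bij_betw (\<lambda>x. the (T x)) (nodes lam) {1..?n}" using T by (simp add: standard_tableau_def)
  have old: "the (?T x) = the (T x)" if "x \<in> nodes lam" for x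
    using that N(2) by (auto simp: extend_tableau_def)
  have new: "the (?T ?z) = ?n + 1" by (simp add: extend_tableau_def)
  have le: "the (T x) \<le> ?n" if "x \<in> nodes lam" for x using bij_betwE[OF b] that by auto
  have "bij_betw (\<lambda>x. the (?T x)) (nodes lam) {1..?n}"
    using b by (rule bij_betw_cong[THEN iffD1, rotated]) (simp add: old)
  then have "bij_betw (\<lambda>x. the (?T x)) (nodes lam \<union> {?z}) ({1..?n} \<union> {the (?T ?z)})"
    using N(2) new by (intro notIn_Un_bij_betw) auto
  then have bij: "bij_betw (\<lambda>x. the (?T x)) (nodes (add_corner lam j)) {1..sum_list (add_corner lam j)}"
    using N(1) new by (simp add: sum_list_add_corner[OF y j] atLeastAtMostSuc_conv)
  have z: "?z = (Suc (block_end lam (j - 1)), Suc (row lam (block_end lam (j - 1))))"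
    using corner_row(2)[OF y j] by (simp add: corner_def)
  have rows: "the (?T (r, c)) < the (?T (r, c'))"
    if "(r, c) \<in> nodes (add_corner lam j)" "(r, c') \<in> nodes (add_corner lam j)" "c < c'" for r c c'
  proof -
    have c: "(r, c) \<in> nodes lam"
      using that z unfolding N(1) by (auto simp: nodes_row)
    show ?thesis
    proof (cases "(r, c') = ?z")
      case True
      then show ?thesis using old[OF c] new le[OF c] by simp
    next
      case False
      then have c': "(r, c') \<in> nodes lam" using that N(1) by simp
      then show ?thesis using T c that(3) old[OF c] old[OF c'] by (simp add: standard_tableau_def)
    qed
  qed
  have cols: "the (?T (r, c)) < the (?T (r', c))"
    if "(r, c) \<in> nodes (add_corner lam j)" "(r', c) \<in> nodes (add_corner lam j)" "r < r'" for r r' c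
  proof -
    have c: "(r, c) \<in> nodes lam"
    proof (rule ccontr)
      assume "(r, c) \<notin> nodes lam"
      then have rz: "(r, c) = ?z" using that N(1) by auto
      then have "(r', c) \<in> nodes lam" using that N(1) by (metis insert_iff less_irrefl prod.inject)
      then have "c \<le> row lam (r' - 1)" by (simp add: nodes_row)
      also have "\<dots> \<le> row lam (r - 1)" using that by (intro young_diagramD(1)[OF y]) auto
      finally show False using rz z by simp
    qed
    show ?thesis
    proof (cases "(r', c) = ?z")
      case True
      then show ?thesis using old[OF c] new le[OF c] by simp
    next
      case False
      then have c': "(r', c) \<in> nodes lam" using that N(1) by simp
      then show ?thesis using T c that(3) old[OF c] old[OF c'] by (simp add: standard_tableau_def)
    qed
  qed
  have "dom ?T = nodes (add_corner lam j)" using D(2) N(1) by (simp add: extend_tableau_def)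
  then show ?thesis
    unfolding standard_tableau_def
    using young_diagram_add_corner[OF y j] bij rows cols by blast
qed

lemma content_seq_extend:
  assumes T: "standard_tableau lam T" and j: "j \<in> {1..num_blocks lam + 1}"
  shows "content_seq (extend_tableau lam T j) (sum_list lam + 1)
    = content_seq T (sum_list lam) @ [corner_index lam j]"
proof -
  let ?z = "corner lam j" and ?T = "extend_tableau lam T j" and ?n = "sum_list lam"
  note D = standard_tableauD[OF T]
  have z: "T ?z = None" using nodes_add_corner(2)[OF D(1) j] D(2) by auto
  have old: "?T x = Some i \<longleftrightarrow> T x = Some i" if "i \<in> {1..?n}" for x i
    using that z by (auto simp: extend_tableau_def)
  have new: "?T x = Some (?n + 1) \<longleftrightarrow> x = ?z" for x
    using D(3)[of x "?n + 1"] by (auto simp: extend_tableau_def)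
  let ?f = "\<lambda>T i. let x = (THE x. T x = Some i) in int (snd x) - int (fst x)"
  have "[1..<?n + 1 + 1] = [1..<?n + 1] @ [?n + 1]" by simp
  moreover have "map (?f ?T) [1..<?n + 1] = map (?f T) [1..<?n + 1]"
    by (rule map_cong) (auto simp: old)
  moreover have "?f ?T (?n + 1) = corner_index lam j"
    unfolding new by (simp add: corner_index_def corner_def)
  ultimately show ?thesis unfolding content_seq_def by (simp only: map_append list.map)
qed

text \<open>The largest entry has nothing to its right and nothing below it, hence ends a row that
  is longer than the next. With a single node its removal would leave the empty list, which is not a
  \<open>young_diagram\<close>.\<close>

lemma remove_last_node:
  assumes T: "standard_tableau lam T" and n: "sum_list lam \<noteq> 1"
  obtains mu S j where "standard_tableau mu S" "j \<in> {1..num_blocks mu + 1}"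
    "lam = add_corner mu j" "T = extend_tableau mu S j"
proof -
  let ?n = "sum_list lam"
  note D = standard_tableauD[OF T]
  note y = D(1)
  have b: "bij_betw (\<lambda>x. the (T x)) (nodes lam) {1..?n}" using T by (simp add: standard_tableau_def)
  have "lam \<noteq> []" "0 < lam ! 0" using y by (auto simp: young_diagram_def)
  then have "?n \<noteq> 0" by (metis elem_le_sum_list le_zero_eq length_greater_0_conv less_irrefl)
  then obtain r c where rc: "T (r, c) = Some ?n" using D(4)[of ?n] by (metis One_nat_def Suc_leI atLeastAtMost_iff gr0I order_refl surj_pair)
  then have node: "(r, c) \<in> nodes lam" using D(2) by auto
  have max: "the (T x) \<le> ?n" if "x \<in> nodes lam" for x using bij_betwE[OF b] that by auto
  define i where "i = r - 1"
  have r: "r = Suc i" "1 \<le> c" "c \<le> row lam i" using node by (auto simp: nodes_row i_def)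
  have c: "c = row lam i"
  proof (rule ccontr)
    assume "c \<noteq> row lam i"
    then have "(r, Suc c) \<in> nodes lam" using r by (auto simp: nodes_row)
    then have "the (T (r, c)) < the (T (r, Suc c))" using T node by (simp add: standard_tableau_def)
    then show False using max \<open>(r, Suc c) \<in> nodes lam\<close> rc by fastforce
  qed
  have below: "row lam (Suc i) < c"
  proof (rule ccontr)
    assume "\<not> row lam (Suc i) < c"
    then have s: "(Suc r, c) \<in> nodes lam" using r by (auto simp: nodes_row)
    then have "the (T (r, c)) < the (T (Suc r, c))" using T node by (simp add: standard_tableau_def)
    then show False using max[OF s] rc by simp
  qed
  have il: "i < length lam" using young_diagramD(2)[OF y, of i] r by auto
  \<comment> \<open>A row of length 1 disappears from the list, since rows of length 0 are not
    recorded.\<close>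
  define mu where "mu = (if c = 1 then butlast lam else lam[i := c - 1])"
  have last: "length lam = Suc i" if "c = 1"
    using below that young_diagramD(2)[OF y, of "Suc i"] il by auto
  have row: "row mu = (row lam)(i := c - 1)"
  proof (rule ext)
    fix m
    show "row mu m = ((row lam)(i := c - 1)) m"
    proof (cases "c = 1")
      case True
      then have "length lam = Suc i" by (rule last)
      with True show ?thesis by (auto simp: mu_def row_def nth_butlast)
    next
      case False
      then have "mu = lam[i := c - 1]" by (simp add: mu_def)
      then show ?thesis using il by (auto simp: row_def nth_list_update)
    qed
  qed
  have ymu: "young_diagram mu"
  proof -
    have "row mu m' \<le> row mu m" if "m \<le> m'" for m m'
    proof -
      have "row lam m' \<le> row lam m" using young_diagramD(1)[OF y that] .
      moreover have "row lam m' \<le> c - 1" if "i < m'"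
        using below young_diagramD(1)[OF y, of "Suc i" m'] that by auto
      ultimately show ?thesis unfolding row using c that by auto
    qed
    moreover have "mu \<noteq> []"
    proof
      assume "mu = []"
      then have "length mu = 0" by simp
      moreover have "length mu = length lam" if "c \<noteq> 1" using that by (simp add: mu_def)
      ultimately have "c = 1" using il by fastforce
      then have len: "length lam = Suc i" by (rule last)
      have "length lam - 1 = 0" using \<open>length mu = 0\<close> \<open>c = 1\<close> by (simp add: mu_def)
      then have "i = 0" using len by simp
      then have "lam ! 0 = 1" using c \<open>c = 1\<close> il by (simp add: row_def)
      then have "lam = [1]" using len \<open>i = 0\<close> by (cases lam) auto
      then show False using n by simp
    qed
    moreover have "0 < row mu m" if "m < length mu" for m
      using that young_diagramD(2)[OF y, of m] last r unfolding row
      by (auto simp: mu_def split: if_splits)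
    ultimately show ?thesis unfolding young_diagram_row by blast
  qed
  have "i \<le> length mu" using il last by (auto simp: mu_def)
  moreover have "i = 0 \<or> row mu i < row mu (i - 1)"
    using young_diagramD(1)[OF y, of "i - 1" i] r c by (auto simp: row)
  ultimately obtain j where j: "j \<in> {1..num_blocks mu + 1}" "block_end mu (j - 1) = i"
    using corner_of_row[OF ymu] by blast
  have bl: "block_len mu j = c - 1" using corner_row(2)[OF ymu j(1)] j(2) row by simp
  have lam: "lam = add_corner mu j"
    using young_diagram_add_corner[OF ymu j(1)] row_add_corner[OF ymu j(1)] y j(2) bl r c row
    by (intro young_diagram_eqI) (auto simp: fun_eq_iff)
  have z: "corner mu j = (r, c)" using j(2) bl r by (simp add: corner_def)
  have sum: "?n = sum_list mu + 1" using sum_list_add_corner[OF ymu j(1)] lam by simp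
  define S where "S = T((r, c) := None)"
  have TS: "T = extend_tableau mu S j"
    using rc sum by (auto simp: extend_tableau_def S_def z)
  have N: "nodes lam = insert (r, c) (nodes mu)" "(r, c) \<notin> nodes mu"
    using nodes_add_corner[OF ymu j(1)] z lam by auto
  have old: "the (S x) = the (T x)" if "x \<in> nodes mu" for x
    using that N(2) by (auto simp: S_def)
  have "bij_betw (\<lambda>x. the (T x)) (nodes lam - {(r, c)}) ({1..?n} - {?n})"
    using bij_betw_DiffI[OF b, of "{(r, c)}" "{?n}"] node rc \<open>?n \<noteq> 0\<close> by (auto simp: bij_betw_def)
  moreover have "nodes lam - {(r, c)} = nodes mu" "{1..?n} - {?n} = {1..sum_list mu}" using N sum by auto
  ultimately have "bij_betw (\<lambda>x. the (T x)) (nodes mu) {1..sum_list mu}" by simp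
  then have "bij_betw (\<lambda>x. the (S x)) (nodes mu) {1..sum_list mu}"
    by (rule bij_betw_cong[THEN iffD1, rotated]) (simp add: old)
  moreover have "dom S = nodes mu" using D(2) N by (auto simp: S_def)
  ultimately have "standard_tableau mu S"
    using T ymu N old by (simp add: standard_tableau_def)
  then show thesis using that j(1) lam TS by blast
qed

lemma one_node:
  assumes "standard_tableau lam T" "sum_list lam = 1"
  shows "lam = [1]" "T = [(1, 1) \<mapsto> 1]"
proof -
  note D = standard_tableauD[OF assms(1)]
  show lam: "lam = [1]"
    using D(1) assms(2) by (cases lam; cases "tl lam") (auto simp: young_diagram_def)
  have dom: "dom T = {(1, 1)}" using D(2) lam by (auto simp: nodes_def)
  obtain x where "T x = Some 1" using D(4)[of 1] assms(2) by auto
  then have "T (1, 1) = Some 1" using dom by (metis domI singletonD)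
  then show "T = [(1, 1) \<mapsto> 1]" using dom by (auto simp: fun_eq_iff dom_def)
qed

lemma standard_one_node: "standard_tableau [1] [(1, 1) \<mapsto> 1]"
proof -
  have "nodes [1] = {(1, 1)}" by (auto simp: nodes_def)
  then show ?thesis by (auto simp: standard_tableau_def young_diagram_def bij_betw_def)
qed

text \<open>Every standard tableau arises by inserting its entries in order. The steps are those of
  \<open>fusion\<close>, which is why all tableaux are reached.\<close>

lemma tableau_induct [consumes 1, case_names one extend]:
  assumes "standard_tableau lam T"
    and "P [1] [(1, 1) \<mapsto> 1]"
    and "\<And>lam T j. standard_tableau lam T \<Longrightarrow> j \<in> {1..num_blocks lam + 1} \<Longrightarrow> P lam T \<Longrightarrow>
      P (add_corner lam j) (extend_tableau lam T j)"
  shows "P lam T"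
  using assms(1)
proof (induction "sum_list lam" arbitrary: lam T rule: less_induct)
  case less
  show ?case
  proof (cases "sum_list lam = 1")
    case True
    then show ?thesis using one_node[OF less.prems] assms(2) by simp
  next
    case False
    then obtain mu S j where m: "standard_tableau mu S" "j \<in> {1..num_blocks mu + 1}"
      "lam = add_corner mu j" "T = extend_tableau mu S j"
      using remove_last_node[OF less.prems] by metis
    then have "sum_list mu < sum_list lam"
      using sum_list_add_corner standard_tableauD(1) by simp
    then show ?thesis using less.hyps m assms(3) by blast
  qed
qed

text \<open>Ties the tableaux of the statement to the sequences of the algebra: adding corner j
  appends its exponent and moves the bead of that row.\<close>

lemma content_seq_standard:
  assumes "standard_tableau lam T"
  shows "content_seq T (sum_list lam) \<in> std_seqs (sum_list lam)"
    and "maya (content_seq T (sum_list lam)) = beads lam"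
proof -
  have "content_seq T (sum_list lam) \<in> std_seqs (sum_list lam) \<and> maya (content_seq T (sum_list lam)) = beads lam"
    using assms
  proof (induction rule: tableau_induct)
    case one
    have "(THE x. (if x = (1, 1) then Some 1 else None) = Some (1 :: nat)) = (1 :: nat, 1 :: nat)" by (rule the_equality) (auto split: if_splits)
    then have s: "content_seq [(1, 1) \<mapsto> 1] 1 = [0]" by (simp add: content_seq_def fun_upd_def)
    have "beads [1] = hop 0 {..0}"
    proof
      have r: "row [Suc 0] m = (if m = 0 then 1 else 0)" for m by (auto simp: row_def)
      show "beads [1] \<subseteq> hop 0 {..0}" by (auto simp: beads_def r hop_def split: if_splits)
      show "hop 0 {..0} \<subseteq> beads [1]"
      proof
        fix k assume "k \<in> hop 0 {..0}"
        then have "k = int (row [1] 0) - int 0 \<or> k = int (row [1] (nat (- k))) - int (nat (- k))"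
          by (auto simp: hop_def r)
        then show "k \<in> beads [1]" unfolding beads_def by blast
      qed
    qed
    then show ?case using s maya_snoc[of "[]" 0] by (simp add: std_seqs_1 maya_Nil fun_upd_def)
  next
    case (extend lam T j)
    note y = standard_tableauD(1)[OF extend.hyps(1)]
    have "corner_index lam j \<in> addable (maya (content_seq T (sum_list lam)))"
      using extend.IH addable_beads[OF y] extend.hyps by simp
    then show ?case
      using extend content_seq_extend[OF extend.hyps(1,2)] sum_list_add_corner[OF y extend.hyps(2)]
        beads_add_corner[OF y extend.hyps(2)]
      by (simp add: snoc_in_std_seqs maya_snoc)
  qed
  then show "content_seq T (sum_list lam) \<in> std_seqs (sum_list lam)"
    "maya (content_seq T (sum_list lam)) = beads lam" by auto
qed

section \<open>The fusion formula\<close>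

lemma fscal_0 [simp]: "fscal 0 = 0"
  and fscal_uminus: "fscal (- c) = - fscal c"
  by (simp_all add: fscal_def single_uminus)

text \<open>The exponential form excluded by \<open>generic\<close> runs through all roots of unity;
  a negative exponent is first replaced by its absolute value.\<close>

lemma generic_not_root_of_unity:
  assumes "generic q" "k \<noteq> 0"
  shows "q powi k \<noteq> 1"
proof
  assume k: "q powi k = 1"
  have "q \<noteq> 0" using assms(1) by (simp add: generic_def)
  define m where "m = nat \<bar>k\<bar>"
  have m: "int m \<noteq> 0" "m > 0" using assms(2) by (simp_all add: m_def)
  have "q ^ m = 1"
  proof (cases "k \<ge> 0")
    case True
    then show ?thesis using k by (simp add: power_int_def m_def)
  next
    case False
    then have "inverse q ^ nat (- k) = 1" using k by (simp add: power_int_def)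
    then show ?thesis using False by (simp add: power_inverse m_def)
  qed
  then obtain j where "q = cis (2 * pi * real j / real m)"
    using bij_betw_roots_unity[OF m(2)] unfolding bij_betw_def by blast
  then have "q = exp (2 * complex_of_real pi * \<i> * of_int (int j) / of_int (int m))"
    by (simp add: cis_conv_exp field_simps)
  then show False using assms(1) m(1) unfolding generic_def by blast
qed

section \<open>The factors of the theorem as polynomials in the last Jucys-Murphy element\<close>

context generic_parameter
begin

abbreviation free_ev :: "nat \<Rightarrow> complex poly \<Rightarrow> free_elt"
  where "free_ev n \<equiv> poly_at fscal (jm fscal fgen n)"

lemma jm_in_free_alg: "i \<le> n \<Longrightarrow> jm fscal fgen i \<in> carrier (free_alg n)"
  using quot_jm by (simp add: free_alg_generated)

lemma free_ev_in_free_alg: "free_ev n p \<in> carrier (free_alg n)"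
  using quot_poly_at jm_in_free_alg[of n n] by (simp add: free_alg_generated)

lemma idem_in_free_alg: "length s \<le> n \<Longrightarrow> idem q fscal fgen s \<in> carrier (free_alg n)"
  using quot_idem by (simp add: free_alg_generated)

text \<open>All factors are polynomials in one element, so ordered products in the non-commutative
  ring reduce to products of polynomials, where the order of the list is irrelevant.\<close>

lemma proj_free_ev_mult:
  "proj q n (free_ev n p) \<otimes>\<^bsub>hecke q n\<^esub> proj q n (free_ev n r) = proj q n (free_ev n (p * r))"
proof -
  interpret H: hecke_algebra q n "\<lambda>c. quot q n (fscal c)" "\<lambda>i. quot q n (fgen i)"
    by (rule hecke_algebra_quot)
  have ev: "quot q n (free_ev n p) = H.ev n p" for p
    using quot_poly_at[of "jm fscal fgen n" n p] quot_jm[of n n] by simp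
  have "quot q n (free_ev n p * free_ev n r) = quot q n (free_ev n (p * r))"
    by (simp add: quot_ops(2) free_ev_in_free_alg ev H.ev_mult)
  then have "proj q n (free_ev n p * free_ev n r) = proj q n (free_ev n (p * r))"
    by (simp add: quot_ops(4) free_ev_in_free_alg free_alg_closed)
  then show ?thesis by (simp add: proj_ops free_ev_in_free_alg)
qed

lemma free_ev_1: "free_ev n 1 = 1"
  by (simp add: one_pCons poly_at_pCons one_free_elt)

lemma list_prod_free_ev:
  assumes "\<And>r. r \<in> set rs \<Longrightarrow> X r = proj q n (free_ev n (p r))"
  shows "list_prod (hecke q n) (map X rs) = proj q n (free_ev n (\<Prod>r\<leftarrow>rs. p r))"
  using assms
  by (induction rs) (simp_all add: list_prod_def proj_ops(4) free_ev_1 proj_free_ev_mult)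

lemma jm_factor_proj:
  assumes "n = sum_list lam + 1"
  shows "jm_factor q lam r = proj q n (free_ev n [:- a (corner_index lam r), 1:])"
proof -
  have c: "corner_content q lam r = a (corner_index lam r)"
    by (simp add: corner_content_def content_def corner_index_def)
  have "free_ev n [:- a (corner_index lam r), 1:] = jm fscal fgen n - fscal (a (corner_index lam r))"
    by (simp add: poly_at_pCons fscal_uminus one_free_elt[symmetric])
  then show ?thesis
    unfolding jm_factor_def Let_def assms[symmetric] c
    by (simp add: jucys_murphy_proj hecke_scal_proj proj_diff jm_in_free_alg free_alg_closed)
qed

lemma fusion_factor_proj:
  assumes "n = sum_list lam + 1"
  shows "fusion_factor q lam j r = proj q n (free_ev n
    (smult (1 / (a (corner_index lam j) - a (corner_index lam r))) [:- a (corner_index lam r), 1:]))"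
proof -
  have c: "corner_content q lam r = a (corner_index lam r)" for r
    by (simp add: corner_content_def content_def corner_index_def)
  define d where "d = 1 / (a (corner_index lam j) - a (corner_index lam r))"
  have e: "free_ev n (smult d [:- b, 1:]) = fscal d * free_ev n [:- b, 1:]" for b
    using fscal_central[of "jm fscal fgen n" d]
    by (simp add: poly_at_pCons one_free_elt[symmetric] fscal_uminus fscal_mult right_diff_distrib)
  show ?thesis
    unfolding fusion_factor_def Let_def assms[symmetric] c jm_factor_proj[OF assms] d_def[symmetric] e
    by (simp add: hecke_scal_proj proj_ops(3) free_ev_in_free_alg free_alg_closed)
qed

lemma root_poly_corners:
  assumes "young_diagram lam" "maya s = beads lam"
  shows "(\<Prod>r\<leftarrow>[1..<num_blocks lam + 2]. [:- a (corner_index lam r), 1:]) = root_poly a (addable (maya s))"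
proof -
  have set: "set [1..<num_blocks lam + 2] = {1..num_blocks lam + 1}" by auto
  have "(\<Prod>r\<leftarrow>[1..<num_blocks lam + 2]. [:- a (corner_index lam r), 1:])
      = (\<Prod>r\<in>{1..num_blocks lam + 1}. [:- a (corner_index lam r), 1:])"
    unfolding set[symmetric] by (rule prod.distinct_set_conv_list[symmetric]) (rule distinct_upt)
  also have "\<dots> = root_poly a (addable (maya s))"
    unfolding assms(2) addable_beads[OF assms(1)] root_poly_def
    using prod.reindex[OF corner_index_inj[OF assms(1)], of "\<lambda>k. [:- a k, 1:]"] by (simp only: o_def)
  finally show ?thesis .
qed

text \<open>Re-indexing from blocks to addable contents along the injective
  \<open>corner_index\<close>; leaving out j corresponds to leaving out its own content.\<close>

lemma lagrange_poly_corners: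
  assumes "young_diagram lam" "maya s = beads lam" "j \<in> {1..num_blocks lam + 1}"
  shows "(\<Prod>r\<leftarrow>filter (\<lambda>r. r \<noteq> j) [1..<num_blocks lam + 2].
      smult (1 / (a (corner_index lam j) - a (corner_index lam r))) [:- a (corner_index lam r), 1:])
    = lagrange_poly a (addable (maya s)) (corner_index lam j)"
    (is "(\<Prod>r\<leftarrow>_. ?f (corner_index lam r)) = _")
proof -
  let ?J = "{1..num_blocks lam + 1}"
  have set: "set (filter (\<lambda>r. r \<noteq> j) [1..<num_blocks lam + 2]) = ?J - {j}" by auto
  note inj = corner_index_inj[OF assms(1)]
  have "(\<Prod>r\<leftarrow>filter (\<lambda>r. r \<noteq> j) [1..<num_blocks lam + 2]. ?f (corner_index lam r))
      = (\<Prod>r\<in>?J - {j}. ?f (corner_index lam r))"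
    unfolding set[symmetric]
    by (rule prod.distinct_set_conv_list[symmetric]) (intro distinct_filter distinct_upt)
  also have "\<dots> = (\<Prod>k\<in>corner_index lam ` (?J - {j}). ?f k)"
    by (rule prod.reindex_cong[symmetric, where l = "corner_index lam"])
       (auto intro: inj_on_subset[OF inj])
  also have "corner_index lam ` (?J - {j}) = addable (maya s) - {corner_index lam j}"
    unfolding assms(2) addable_beads[OF assms(1)]
    using inj_on_image_set_diff[OF inj, of ?J "{j}"] assms(3) by auto
  finally show ?thesis by (simp only: lagrange_poly_def)
qed

lemma standard_pos: "standard_tableau lam T \<Longrightarrow> 1 \<le> sum_list lam"
  by (induction rule: tableau_induct) (auto simp: sum_list_add_corner standard_tableauD(1))

lemma corresponds_iff:
  assumes "standard_tableau lam T"
  shows "corresponds q T e \<longleftrightarrow> e = seq_idempotent (content_seq T (sum_list lam))"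
  unfolding seq_idempotent_characterization[OF content_seq_standard(1)[OF assms] standard_pos[OF assms], symmetric]
    corresponds_def Let_def standard_tableauD(6)[OF assms]
  by (rule conj_cong[OF refl], rule ball_cong[OF refl])
     (simp only: content_string_seq[where n = "sum_list lam"])

lemma tableau_idempotent_seq:
  assumes "standard_tableau lam T"
  shows "tableau_idempotent q T = seq_idempotent (content_seq T (sum_list lam))"
  unfolding tableau_idempotent_def corresponds_iff[OF assms] by simp

lemma incl_seq_idempotent:
  assumes "standard_tableau lam T"
  shows "hecke_incl q (sum_list lam) (seq_idempotent (content_seq T (sum_list lam)))
    = proj q (sum_list lam + 1) (idem q fscal fgen (content_seq T (sum_list lam)))"
  unfolding seq_idempotent_def length_content_seq
  by (rule hecke_incl_proj) (simp add: idem_in_free_alg length_content_seq)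

lemma annihilating_product_zero:
  assumes "standard_tableau lam T"
  shows "hecke_incl q (sum_list lam) (seq_idempotent (content_seq T (sum_list lam)))
    \<otimes>\<^bsub>hecke q (sum_list lam + 1)\<^esub> annihilating_product q lam = \<zero>\<^bsub>hecke q (sum_list lam + 1)\<^esub>"
proof -
  define n where "n = sum_list lam + 1"
  define s where "s = content_seq T (sum_list lam)"
  let ?p = "root_poly a (addable (maya s))"
  interpret H: hecke_algebra q n "\<lambda>c. quot q n (fscal c)" "\<lambda>i. quot q n (fgen i)"
    by (rule hecke_algebra_quot)
  have s: "s \<in> std_seqs (sum_list lam)" "maya s = beads lam"
    using content_seq_standard[OF assms] by (simp_all add: s_def)
  have len: "length s \<le> n" using length_std_seqs[OF s(1)] by (simp add: n_def)
  have "annihilating_product q lam = proj q n (free_ev n ?p)"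
    unfolding annihilating_product_def n_def[symmetric]
      root_poly_corners[OF standard_tableauD(1)[OF assms] s(2), symmetric]
    by (rule list_prod_free_ev) (rule jm_factor_proj, simp add: n_def)
  then have "hecke_incl q (sum_list lam) (seq_idempotent s) \<otimes>\<^bsub>hecke q n\<^esub> annihilating_product q lam
      = proj q n (idem q fscal fgen s * free_ev n ?p)"
    using incl_seq_idempotent[OF assms] len
    by (simp add: n_def s_def proj_ops(3) idem_in_free_alg free_ev_in_free_alg)
  moreover have "quot q n (idem q fscal fgen s * free_ev n ?p) = H.E s * H.ev n ?p"
    using quot_idem[OF len] quot_poly_at[of "jm fscal fgen n" n ?p] quot_jm[of n n]
    by (simp add: quot_ops(2) idem_in_free_alg[OF len] free_ev_in_free_alg)
  moreover have "H.E s * H.ev n ?p = 0"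
    using H.E_annihilated[OF standard_pos[OF assms] _ s(1)] by (simp add: n_def)
  ultimately show ?thesis
    using quot_ops(4)[of "idem q fscal fgen s * free_ev n ?p" n 0] quot_ops(3)[of n]
    by (simp add: n_def s_def proj_ops(5) free_alg_closed idem_in_free_alg length_content_seq free_ev_in_free_alg)
qed

text \<open>After re-indexing, the step is the defining recursion of \<open>idem\<close> for the
  appended content.\<close>

lemma fusion_step_seq:
  assumes "standard_tableau lam T" "j \<in> {1..num_blocks lam + 1}"
  shows "fusion_step q lam j (seq_idempotent (content_seq T (sum_list lam)))
    = seq_idempotent (content_seq (extend_tableau lam T j) (sum_list lam + 1))"
proof -
  define n where "n = sum_list lam + 1"
  define s where "s = content_seq T (sum_list lam)"
  let ?k = "corner_index lam j" and ?p = "lagrange_poly a (addable (maya s)) (corner_index lam j)"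
  have s: "s \<in> std_seqs (sum_list lam)" "maya s = beads lam"
    using content_seq_standard[OF assms(1)] by (simp_all add: s_def)
  have len: "length s = sum_list lam" using length_std_seqs[OF s(1)] .
  have "fusion_product q lam j = proj q n (free_ev n ?p)"
    unfolding fusion_product_def n_def[symmetric]
      lagrange_poly_corners[OF standard_tableauD(1)[OF assms(1)] s(2) assms(2), symmetric]
    by (rule list_prod_free_ev) (rule fusion_factor_proj, simp add: n_def)
  then have "fusion_step q lam j (seq_idempotent s) = proj q n (idem q fscal fgen s * free_ev n ?p)"
    unfolding fusion_step_def using incl_seq_idempotent[OF assms(1)] len
    by (simp add: n_def s_def proj_ops(3) idem_in_free_alg free_ev_in_free_alg)
  also have "idem q fscal fgen s * free_ev n ?p = idem q fscal fgen (s @ [?k])"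
    by (simp add: idem_snoc len n_def)
  finally show ?thesis
    unfolding content_seq_extend[OF assms] seq_idempotent_def s_def[symmetric] by (simp add: len n_def)
qed

lemma fusion_standard:
  "fusion q lam T e \<Longrightarrow> standard_tableau lam T \<and> e = seq_idempotent (content_seq T (sum_list lam))"
proof (induction rule: fusion.induct)
  case start
  have "content_seq [(1, 1) \<mapsto> 1] 1 = [0]"
    using content_seq_standard(1)[OF standard_one_node] by (simp add: std_seqs_1)
  moreover have "idem q fscal fgen [0] = 1"
    using idem_snoc[of q fscal fgen "[]" 0]
    by (simp add: idem_Nil maya_Nil addable_initial lagrange_poly_def one_free_elt[symmetric]
      poly_at_pCons one_pCons)
  ultimately show ?case using standard_one_node by (simp add: seq_idempotent_def proj_ops(4) fun_upd_def)
next
  case (step lam T e j)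
  then have T: "standard_tableau lam T" and e: "e = seq_idempotent (content_seq T (sum_list lam))"
    by auto
  show ?case
    using standard_extend[OF T step.hyps(2)] fusion_step_seq[OF T step.hyps(2)]
      sum_list_add_corner[OF standard_tableauD(1)[OF T] step.hyps(2)]
    by (simp add: e)
qed

lemma fusion_exists: "standard_tableau lam T \<Longrightarrow> \<exists>e. fusion q lam T e"
  by (induction rule: tableau_induct) (blast intro: fusion.intros)+

end

theorem mainTheorem5:
  fixes q :: complex and lam :: "nat list" and T :: tableau
  assumes "generic q"
    and "standard_tableau lam T"
  shows "(\<exists>!e. corresponds q T e) \<and>
    hecke_incl q (sum_list lam) (tableau_idempotent q T)
      \<otimes>\<^bsub>hecke q (sum_list lam + 1)\<^esub> annihilating_product q lam
      = \<zero>\<^bsub>hecke q (sum_list lam + 1)\<^esub> \<and>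
    (\<forall>j\<in>{1..num_blocks lam + 1}.
       standard_tableau (add_corner lam j) (extend_tableau lam T j) \<and>
       tableau_idempotent q (extend_tableau lam T j)
         = fusion_step q lam j (tableau_idempotent q T)) \<and>
    (\<exists>e. fusion q lam T e) \<and>
    (\<forall>e. fusion q lam T e \<longrightarrow> e = tableau_idempotent q T)"
proof -
  interpret generic_parameter q
    using generic_not_root_of_unity[OF assms(1)] assms(1) by unfold_locales (auto simp: generic_def)
  note T = assms(2)
  note idem = tableau_idempotent_seq[OF T]
  have step: "standard_tableau (add_corner lam j) (extend_tableau lam T j) \<and>
      tableau_idempotent q (extend_tableau lam T j) = fusion_step q lam j (tableau_idempotent q T)"
    if j: "j \<in> {1..num_blocks lam + 1}" for j
    using standard_extend[OF T j] tableau_idempotent_seq[OF standard_extend[OF T j]]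
      fusion_step_seq[OF T j] sum_list_add_corner[OF standard_tableauD(1)[OF T] j]
    by (simp add: idem)
  show ?thesis
  proof (intro conjI ballI allI impI)
    show "\<exists>!e. corresponds q T e" unfolding corresponds_iff[OF T] by simp
    show "hecke_incl q (sum_list lam) (tableau_idempotent q T)
      \<otimes>\<^bsub>hecke q (sum_list lam + 1)\<^esub> annihilating_product q lam = \<zero>\<^bsub>hecke q (sum_list lam + 1)\<^esub>"
      unfolding idem by (rule annihilating_product_zero[OF T])
    show "\<exists>e. fusion q lam T e" by (rule fusion_exists[OF T])
    show "e = tableau_idempotent q T" if "fusion q lam T e" for e
      unfolding idem using fusion_standard[OF that] by (rule conjunct2)
  qed (use step in blast)+
qed

end
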